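(* Let $N\geqslant 4$ and let $s$ be any positive integer. If $I\subset\Bbbk[x_0,\dots,x_N]$ is the defining ideal of a general set of $s$ points in $\mathbb{P}^N_{\Bbbk}$, then $I$ satisfies Chudnovsky's conjecture, i.e. $$\widehat{\alpha}(I)\geqslant\frac{\alpha(I)+N-1}{N}.$$
   Context: $\Bbbk$ is an algebraically closed field. A property is said to hold for a general set of $s$ points in $\mathbb{P}^N_{\Bbbk}$ if there is one open dense subset $U$ of the Chow variety $G(1,s,N+1)$ of $0$-cycles of degree $s$ in $\mathbb{P}^N_{\Bbbk}$ such that the property holds for every $\mathbb{X}\in U$. (It suffices that there is an open dense subset $W$ of the affine space $\mathbb{A}^{s(N+1)}_{\Bbbk}$ such that the property holds for $\{[a_{i0}:\dots:a_{iN}]\}_{i=1}^s$ whenever $(a_{ij})\in W$.) If $I=\mathfrak{p}_1\cap\dots\cap\mathfrak{p}_s$, with $\mathfrak{p}_i$ the homogeneous ideal of the $i$-th point, then $I^{(m)}=\mathfrak{p}_1^m\cap\dots\cap\mathfrak{p}_s^m$. For a nonzero homogeneous ideal $J$, $\alpha(J)$ is the least degree of a nonzero element of $J$, and the Waldschmidt constant is $\widehat{\alpha}(I)=\lim_{m\to\infty}\alpha(I^{(m)})/m=\inf_{m\geqslant 1}\alpha(I^{(m)})/m$. *)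

theory Defs
  imports
    "HOL-Analysis.Abstract_Topology"
    "HOL-Algebra.Ideal_Product"
    "HOL-Computational_Algebra.Polynomial"
    "HOL-Library.Multiset"
    "HOL-Library.Poly_Mapping"
begin

section \<open>Multivariate polynomials\<close>

text \<open>
  A monomial in variables of type \<open>'v\<close> is its exponent vector, a finitely supported function
  \<open>'v \<Rightarrow>\<^sub>0 nat\<close>; a polynomial is a finitely supported family of coefficients indexed by monomials.
  The ring operations are those of the library type (convolution product).
\<close>

type_synonym ('v, 'k) mpoly = "('v \<Rightarrow>\<^sub>0 nat) \<Rightarrow>\<^sub>0 'k"

definition monom_degree :: "('v \<Rightarrow>\<^sub>0 nat) \<Rightarrow> nat" where
  "monom_degree m = (\<Sum>v\<in>Poly_Mapping.keys m. Poly_Mapping.lookup m v)"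

definition eval_mpoly :: "('v, 'k::field) mpoly \<Rightarrow> ('v \<Rightarrow> 'k) \<Rightarrow> 'k" where
  "eval_mpoly f a =
     (\<Sum>m\<in>Poly_Mapping.keys f. Poly_Mapping.lookup f m *
        (\<Prod>v\<in>Poly_Mapping.keys m. a v ^ Poly_Mapping.lookup m v))"

definition homogeneous :: "nat \<Rightarrow> ('v, 'k::field) mpoly \<Rightarrow> bool" where
  "homogeneous d f \<longleftrightarrow> (\<forall>m\<in>Poly_Mapping.keys f. monom_degree m = d)"

text \<open>Only meaningful for \<open>f \<noteq> 0\<close>.\<close>

definition total_degree :: "('v, 'k::field) mpoly \<Rightarrow> nat" where
  "total_degree f = Max (monom_degree ` Poly_Mapping.keys f)"

text \<open>The ring \<open>k[x\<^sub>0, \<dots>, x\<^sub>N]\<close>, as a subring of the polynomials in the variables \<open>x\<^sub>i\<close>, \<open>i :: nat\<close>.\<close>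

definition poly_ring :: "nat \<Rightarrow> (nat, 'k::field) mpoly ring" where
  "poly_ring N =
     \<lparr>carrier = {f. \<forall>m\<in>Poly_Mapping.keys f. Poly_Mapping.keys m \<subseteq> {..N}},
      monoid.mult = (*), one = 1, zero = 0, add = (+)\<rparr>"

lemma cring_poly_ring: "cring (poly_ring N :: (nat, 'k::field) mpoly ring)"
proof -
  let ?C = "carrier (poly_ring N :: (nat, 'k) mpoly ring)"
  have mem: "f \<in> ?C \<longleftrightarrow> (\<forall>m\<in>Poly_Mapping.keys f. Poly_Mapping.keys m \<subseteq> {..N})" for f
    by (simp add: poly_ring_def)
  have ops: "f \<oplus>\<^bsub>poly_ring N\<^esub> g = f + g" "f \<otimes>\<^bsub>poly_ring N\<^esub> g = f * g"
    "\<zero>\<^bsub>poly_ring N\<^esub> = (0 :: (nat, 'k) mpoly)" "\<one>\<^bsub>poly_ring N\<^esub> = (1 :: (nat, 'k) mpoly)"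
    for f g :: "(nat, 'k) mpoly"
    by (simp_all add: poly_ring_def)
  have zero: "0 \<in> ?C" and one: "1 \<in> ?C"
    by (simp_all add: mem)
  have add: "f + g \<in> ?C" if "f \<in> ?C" "g \<in> ?C" for f g
    using that Poly_Mapping.keys_add[of f g] unfolding mem by blast
  have neg: "- f \<in> ?C" if "f \<in> ?C" for f
    using that unfolding mem by simp
  have mult: "f * g \<in> ?C" if f: "f \<in> ?C" and g: "g \<in> ?C" for f g
    unfolding mem
  proof
    fix m assume "m \<in> Poly_Mapping.keys (f * g)"
    then obtain a b where "m = a + b" "a \<in> Poly_Mapping.keys f" "b \<in> Poly_Mapping.keys g"
      using Poly_Mapping.keys_mult[of f g] by blast
    then show "Poly_Mapping.keys m \<subseteq> {..N}"
      using f g Poly_Mapping.keys_add[of a b] unfolding mem by blast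
  qed
  show ?thesis
  proof (rule cringI)
    show "abelian_group (poly_ring N :: (nat, 'k) mpoly ring)"
    proof (rule abelian_groupI, unfold ops)
      fix f assume "f \<in> ?C"
      then show "\<exists>g\<in>?C. g + f = 0"
        by (intro bexI[of _ "- f"] neg) simp_all
    qed (simp_all only: add zero add_ac add_0_left add_0_right)
    show "Group.comm_monoid (poly_ring N :: (nat, 'k) mpoly ring)"
      by (rule comm_monoidI, unfold ops) (simp_all only: mult one mult_ac mult_1_left mult_1_right)
  qed (simp only: ops distrib_right)
qed


section \<open>Points of projective space and their ideals\<close>

text \<open>
  A point of projective \<open>N\<close>-space is the set of all its homogeneous coordinate vectors
  \<open>(a\<^sub>0, \<dots>, a\<^sub>N)\<close>; vectors are padded by zeros beyond index \<open>N\<close>.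
\<close>

definition proj_space :: "nat \<Rightarrow> (nat \<Rightarrow> 'k::field) set set" where
  "proj_space N = {{\<lambda>i. c * a i | c. c \<noteq> 0} | a. (\<forall>i>N. a i = 0) \<and> (\<exists>i\<le>N. a i \<noteq> 0)}"

definition point_ideal :: "nat \<Rightarrow> (nat \<Rightarrow> 'k::field) set \<Rightarrow> (nat, 'k) mpoly set" where
  "point_ideal N P =
     genideal (poly_ring N)
       {f \<in> carrier (poly_ring N). (\<exists>d. homogeneous d f) \<and> (\<forall>a\<in>P. eval_mpoly f a = 0)}"

definition defining_ideal :: "nat \<Rightarrow> (nat \<Rightarrow> 'k::field) set set \<Rightarrow> (nat, 'k) mpoly set" where
  "defining_ideal N X = (\<Inter>P\<in>X. point_ideal N P)"

text \<open>
  The \<open>m\<close>-th symbolic power of the defining ideal of \<open>X\<close>; the powers of the point ideals are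
  powers with respect to the ideal product.
\<close>

definition symbolic_power ::
  "nat \<Rightarrow> (nat \<Rightarrow> 'k::field) set set \<Rightarrow> nat \<Rightarrow> (nat, 'k) mpoly set" where
  "symbolic_power N X m = (\<Inter>P\<in>X. point_ideal N P [^]\<^bsub>ideals_set (poly_ring N)\<^esub> m)"

definition initial_degree :: "('v, 'k::field) mpoly set \<Rightarrow> nat" where
  "initial_degree J = (LEAST d. \<exists>f\<in>J. f \<noteq> 0 \<and> total_degree f = d)"

definition waldschmidt_constant :: "nat \<Rightarrow> (nat \<Rightarrow> 'k::field) set set \<Rightarrow> real" where
  "waldschmidt_constant N X =
     lim (\<lambda>m. real (initial_degree (symbolic_power N X m)) / real m)"


section \<open>The Chow variety of 0-cycles and general sets of points\<close>

text \<open>An effective 0-cycle of degree \<open>s\<close> is a multiset of \<open>s\<close> points.\<close>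

definition zero_cycles :: "nat \<Rightarrow> nat \<Rightarrow> (nat \<Rightarrow> 'k::field) set multiset set" where
  "zero_cycles N s = {Z. size Z = s \<and> set_mset Z \<subseteq> proj_space N}"

definition linear_form :: "nat \<Rightarrow> (nat \<Rightarrow> 'k::field) \<Rightarrow> (nat, 'k) mpoly" where
  "linear_form N a = (\<Sum>i\<le>N. Poly_Mapping.single (Poly_Mapping.single i 1) (a i))"

text \<open>
  The Chow form of the cycle \<open>[a\<^sub>1] + \<dots> + [a\<^sub>s]\<close> is the product of the linear forms
  \<open>a\<^sub>j\<^sub>0 u\<^sub>0 + \<dots> + a\<^sub>j\<^sub>N u\<^sub>N\<close>. It depends on the chosen coordinate vectors only up to a nonzero
  scalar factor.
\<close>

definition chow_form :: "nat \<Rightarrow> (nat \<Rightarrow> 'k::field) set multiset \<Rightarrow> (nat, 'k) mpoly" where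
  "chow_form N Z = (\<Prod>P\<in>#Z. linear_form N (SOME a. a \<in> P))"

text \<open>
  The Chow variety is the set of cycles, embedded by \<open>Z \<mapsto> [chow_form N Z]\<close> in the projective space
  of forms of degree \<open>s\<close>, with the induced Zariski topology. Homogeneous coordinates on that
  projective space are the coefficients of the form, so \<open>\<Phi>\<close> below is a polynomial whose
  variables are indexed by the monomials in \<open>u\<^sub>0, u\<^sub>1, \<dots>\<close>; since \<open>\<Phi>\<close> is homogeneous, the condition
  on \<open>Z\<close> does not depend on the scalar factor.
\<close>

definition chow_variety :: "nat \<Rightarrow> nat \<Rightarrow> (nat \<Rightarrow> 'k::field) set multiset topology" where
  "chow_variety N s =
     topology_generated_by
       {{Z \<in> zero_cycles N s. eval_mpoly \<Phi> (Poly_Mapping.lookup (chow_form N Z)) \<noteq> 0}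
         | \<Phi> :: (nat \<Rightarrow>\<^sub>0 nat, 'k) mpoly. \<exists>d. homogeneous d \<Phi>}"

lemma topspace_chow_variety:
  "topspace (chow_variety N s :: (nat \<Rightarrow> 'k::field) set multiset topology) = zero_cycles N s"
proof -
  have "homogeneous 0 (1 :: (nat \<Rightarrow>\<^sub>0 nat, 'k) mpoly)"
    by (simp add: homogeneous_def monom_degree_def)
  moreover have "eval_mpoly (1 :: (nat \<Rightarrow>\<^sub>0 nat, 'k) mpoly) x = 1" for x
    by (simp add: eval_mpoly_def)
  ultimately have "zero_cycles N s \<in> {{Z \<in> zero_cycles N s. eval_mpoly \<Phi> (Poly_Mapping.lookup (chow_form N Z)) \<noteq> 0}
         | \<Phi> :: (nat \<Rightarrow>\<^sub>0 nat, 'k) mpoly. \<exists>d. homogeneous d \<Phi>}"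
    by (intro CollectI exI[of _ "1 :: (nat \<Rightarrow>\<^sub>0 nat, 'k) mpoly"]) auto
  then show ?thesis
    unfolding chow_variety_def topology_generated_by_topspace by blast
qed

text \<open>
  A property of finite sets of points is evaluated at the support of the cycle. Cycles with
  repeated points are not excluded from \<open>U\<close>: then the property is also required of their supports.
\<close>

definition holds_for_general_points ::
  "nat \<Rightarrow> nat \<Rightarrow> ((nat \<Rightarrow> 'k::field) set set \<Rightarrow> bool) \<Rightarrow> bool" where
  "holds_for_general_points N s Q \<longleftrightarrow>
     (\<exists>U. openin (chow_variety N s) U \<and>
          Abstract_Topology.closure_of (chow_variety N s) U = topspace (chow_variety N s) \<and>
          (\<forall>Z\<in>U. Q (set_mset Z)))"

end

theory Submission
  imports Defs "HOL-Computational_Algebra.Primes" "HOL-Library.Function_Algebras"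
begin

text \<open>Let \<open>x\<close> be maximal with \<open>C(N + x, N) \<le> s\<close>. Fewer than \<open>C(N + x + 1, N)\<close> points lie on a form of degree
\<open>x + 1\<close>, because there are more monomials of that degree than points (\<open>ex_form_through_points\<close>). Hence
\<open>\<alpha>(I) \<le> x + 1\<close>, and it is enough to show that every nonzero \<open>f \<in> I\<^sup>(\<^sup>m\<^sup>)\<close> has degree at least
\<open>m (N + x) / N\<close>, on one open dense set of cycles that serves all \<open>m\<close> (\<open>chudnovsky_of_degree_bound\<close>).

For \<open>x = 0\<close> and \<open>x = 1\<close> this follows from Bezout's theorem on curves: a line through one of the points
(\<open>total_degree_ge_mult\<close>) and, if the points span, a rational normal curve through \<open>N + 1\<close> of them and
through an arbitrary further point (\<open>total_degree_ge_spanning\<close>).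

For \<open>x \<ge> 2\<close> the proof goes by specialization. Distributing at most \<open>C(N + x, N)\<close> points of affine space
over \<open>x + 1\<close> parallel hyperplanes, by induction on the dimension, gives a special configuration for
which degree \<open>\<ge> c m\<close> holds with a constant \<open>c\<close> strictly larger than \<open>(N + x) / N\<close>
(\<open>layers_bound\<close>, \<open>ex_points_mult_less_deg\<close>). For a fixed \<open>m\<close> such an estimate spreads to an open set by
semicontinuity, but the open set depends on \<open>m\<close>, and over a countable field the intersection of all of
them may be empty. The slack in the constant removes this dependence. Choose \<open>M\<close> large and \<open>b\<close> about
\<open>c M\<close>. At the special configuration a polynomial of degree less than \<open>b\<close> is determined by its jets of
order less than \<open>M\<close> at the points. The linear map that takes polynomials to jets then has a left inverse,
and this persists on an open set (\<open>ex_open_jets_inverse\<close>).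

The bridge to all \<open>m\<close> is \<open>degree_bound_of_jets_inverse\<close>: wherever the left inverse exists, every nonzero
polynomial of degree \<open>D\<close> that vanishes to order \<open>m\<close> at the points satisfies \<open>b m \<le> D (M + N)\<close>. It is a
containment of ideals in characteristic \<open>p\<close> in disguise. Let \<open>q = p\<^sup>e\<close>. If \<open>G\<close> vanishes to order
\<open>q (M + N)\<close> at the points, then, modulo \<open>p\<close>, the coefficients of \<open>G\<close> whose exponents lie in a fixed
residue class modulo \<open>q\<close> form a polynomial that vanishes to order \<open>M\<close> at the points with coordinates
raised to the power \<open>q\<close>. If the degree of \<open>G\<close> is less than \<open>q b\<close>, this polynomial has degree less than
\<open>b\<close>, so the left inverse, also raised to the power \<open>q\<close>, shows that it is zero modulo \<open>p\<close>
(\<open>frobenius_descent\<close>). Applying this to powers of a given polynomial, with \<open>e \<rightarrow> \<infinity>\<close>, yields the bound.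
In characteristic \<open>0\<close> a prime \<open>p\<close> is brought in by a valuation ring of the field that contains the
finitely many coordinates and entries of the left inverse and in which \<open>p\<close> is not invertible
(\<open>ex_valuation_subring_prime\<close>); \<open>G\<close> is scaled so that its coefficients lie in this ring and one of them is
\<open>1\<close>.

It remains to turn an open condition on the affine coordinates of \<open>s\<close> points into an open dense subset
of the Chow variety (\<open>general_points\<close>). The coordinates of the points are integral over the coefficients
of the Chow form, so every nonzero polynomial in them divides a nonzero polynomial in the Chow
coordinates (\<open>coordinate_integral\<close>, \<open>ex_chow_multiple\<close>).\<close>

section \<open>Substitution into polynomials\<close>

text \<open>Ring homomorphisms out of the coefficient field. The target is arbitrary, so that one substitution
operator covers values, restrictions to curves and changes of coordinates.\<close>

definition is_hom :: "('k::field \<Rightarrow> 'r::comm_ring_1) \<Rightarrow> bool" where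
  "is_hom h \<longleftrightarrow> h 0 = 0 \<and> h 1 = 1 \<and> (\<forall>a b. h (a + b) = h a + h b \<and> h (a * b) = h a * h b)"

definition monom_val :: "('v \<Rightarrow> 'r::comm_ring_1) \<Rightarrow> ('v \<Rightarrow>\<^sub>0 nat) \<Rightarrow> 'r" where
  "monom_val \<sigma> m = (\<Prod>v\<in>Poly_Mapping.keys m. \<sigma> v ^ Poly_Mapping.lookup m v)"

definition ev :: "('k::field \<Rightarrow> 'r::comm_ring_1) \<Rightarrow> ('v \<Rightarrow> 'r) \<Rightarrow> ('v, 'k) mpoly \<Rightarrow> 'r" where
  "ev h \<sigma> f = (\<Sum>m\<in>Poly_Mapping.keys f. h (Poly_Mapping.lookup f m) * monom_val \<sigma> m)"

lemma eval_mpoly_ev: "eval_mpoly f a = ev (\<lambda>c. c) a f"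
  by (simp add: eval_mpoly_def ev_def monom_val_def)

lemma monom_val_superset:
  assumes "finite S" "Poly_Mapping.keys m \<subseteq> S"
  shows "monom_val \<sigma> m = (\<Prod>v\<in>S. \<sigma> v ^ Poly_Mapping.lookup m v)"
  unfolding monom_val_def using assms
  by (intro prod.mono_neutral_left) (auto simp: in_keys_iff)

lemma monom_val_0 [simp]: "monom_val \<sigma> 0 = 1"
  by (simp add: monom_val_def)

lemma monom_val_single [simp]: "monom_val \<sigma> (Poly_Mapping.single v n) = \<sigma> v ^ n"
  by (simp add: monom_val_def)

lemma monom_val_add: "monom_val \<sigma> (a + b) = monom_val \<sigma> a * monom_val \<sigma> b"
proof -
  let ?S = "Poly_Mapping.keys a \<union> Poly_Mapping.keys b"
  have "monom_val \<sigma> (a + b) = (\<Prod>v\<in>?S. \<sigma> v ^ Poly_Mapping.lookup (a + b) v)"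
    by (rule monom_val_superset) (use Poly_Mapping.keys_add in \<open>simp, fast\<close>)
  also have "\<dots> = monom_val \<sigma> a * monom_val \<sigma> b"
    by (subst (1 2) monom_val_superset[of ?S]) (auto simp: lookup_add power_add prod.distrib)
  finally show ?thesis .
qed

lemma ev_superset:
  assumes "is_hom h" "finite S" "Poly_Mapping.keys f \<subseteq> S"
  shows "ev h \<sigma> f = (\<Sum>m\<in>S. h (Poly_Mapping.lookup f m) * monom_val \<sigma> m)"
  unfolding ev_def using assms
  by (intro sum.mono_neutral_left) (auto simp: in_keys_iff is_hom_def)

lemma ev_0 [simp]: "ev h \<sigma> 0 = 0"
  by (simp add: ev_def)

lemma ev_add: assumes "is_hom h" shows "ev h \<sigma> (f + g) = ev h \<sigma> f + ev h \<sigma> g"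
proof -
  let ?S = "Poly_Mapping.keys f \<union> Poly_Mapping.keys g"
  have "ev h \<sigma> (f + g) = (\<Sum>m\<in>?S. h (Poly_Mapping.lookup (f + g) m) * monom_val \<sigma> m)"
    by (rule ev_superset[OF assms]) (use Poly_Mapping.keys_add in \<open>simp, fast\<close>)
  also have "\<dots> = ev h \<sigma> f + ev h \<sigma> g"
    using assms
    by (subst (1 2) ev_superset[OF assms, of ?S]) (auto simp: lookup_add is_hom_def distrib_right sum.distrib)
  finally show ?thesis .
qed

lemma ev_single: assumes "is_hom h" shows "ev h \<sigma> (Poly_Mapping.single m c) = h c * monom_val \<sigma> m"
  using assms by (cases "c = 0") (simp_all add: ev_def is_hom_def)

lemma ev_sum: assumes "is_hom h" shows "ev h \<sigma> (sum f I) = (\<Sum>i\<in>I. ev h \<sigma> (f i))"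
  by (induction I rule: infinite_finite_induct) (simp_all add: ev_add[OF assms])

lemma mpoly_expand:
  "f = (\<Sum>m\<in>Poly_Mapping.keys f. Poly_Mapping.single m (Poly_Mapping.lookup f m))"
  by (rule poly_mapping_eqI)
     (auto simp: lookup_sum lookup_single when_def in_keys_iff if_distrib cong: if_cong)

lemma mpoly_induct [case_names zero single add]:
  assumes "P 0" "\<And>m c. c \<noteq> 0 \<Longrightarrow> m \<in> Poly_Mapping.keys f \<Longrightarrow> P (Poly_Mapping.single m c)" "\<And>f g. P f \<Longrightarrow> P g \<Longrightarrow> P (f + g)"
  shows "P (f :: ('v, 'k::field) mpoly)"
proof -
  have "P (\<Sum>m\<in>S. Poly_Mapping.single m (Poly_Mapping.lookup f m))" if "S \<subseteq> Poly_Mapping.keys f" for S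
    using finite_subset[OF that finite_keys] that
    by (induction S rule: finite_induct) (use assms in \<open>auto simp: in_keys_iff\<close>)
  from this[of "Poly_Mapping.keys f"] show ?thesis by (simp flip: mpoly_expand)
qed

lemma ev_mult: assumes h: "is_hom h" shows "ev h \<sigma> (f * g) = ev h \<sigma> f * ev h \<sigma> g"
proof (induction f rule: mpoly_induct)
  case (single m c)
  show ?case
  proof (induction g rule: mpoly_induct)
    case (single n d)
    then show ?case using h
      by (simp add: mult_single ev_single[OF h] monom_val_add is_hom_def)
  qed (simp_all add: ev_add[OF h] algebra_simps)
qed (simp_all add: ev_add[OF h] algebra_simps)

lemma ev_1 [simp]: assumes "is_hom h" shows "ev h \<sigma> 1 = 1"
  using ev_single[OF assms, of \<sigma> 0 1] assms by (simp add: is_hom_def)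

lemma ev_power: assumes "is_hom h" shows "ev h \<sigma> (f ^ n) = ev h \<sigma> f ^ n"
  using assms by (induction n) (simp_all add: ev_mult)

lemma ev_prod: assumes "is_hom h" shows "ev h \<sigma> (prod f I) = (\<Prod>i\<in>I. ev h \<sigma> (f i))"
  using assms by (induction I rule: infinite_finite_induct) (simp_all add: ev_mult)

definition const :: "'k::field \<Rightarrow> ('v, 'k) mpoly" where
  "const c = Poly_Mapping.single 0 c"

definition var :: "'v \<Rightarrow> ('v, 'k::field) mpoly" where
  "var v = Poly_Mapping.single (Poly_Mapping.single v 1) 1"

lemma is_hom_const: "is_hom const"
  by (simp add: is_hom_def const_def single_add mult_single)

lemma is_hom_id: "is_hom (\<lambda>c. c)"
  by (simp add: is_hom_def)

lemma is_hom_pCons: "is_hom (\<lambda>c. [:c:])"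
  by (simp add: is_hom_def one_pCons)

lemma const_0 [simp]: "const 0 = 0" and const_1 [simp]: "const 1 = 1"
  by (simp_all add: const_def)

lemma const_add: "const (a + b) = const a + const b"
  and const_mult: "const (a * b) = const a * const b"
  by (simp_all add: const_def single_add mult_single)

lemma ev_const: assumes "is_hom h" shows "ev h \<sigma> (const c) = h c"
  by (simp add: const_def ev_single[OF assms])

lemma ev_var: assumes "is_hom h" shows "ev h \<sigma> (var v) = \<sigma> v"
  using assms by (simp add: var_def ev_single[OF assms] is_hom_def)

abbreviation subst :: "('v \<Rightarrow> ('w, 'k::field) mpoly) \<Rightarrow> ('v, 'k) mpoly \<Rightarrow> ('w, 'k) mpoly" where
  "subst \<equiv> ev const"

lemma ev_subst:
  assumes h: "is_hom h"
  shows "ev h \<tau> (subst \<sigma> f) = ev h (\<lambda>v. ev h \<tau> (\<sigma> v)) f"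
proof (induction f rule: mpoly_induct)
  case (single m c)
  then show ?case
    by (simp add: ev_single[OF is_hom_const] ev_single[OF h] ev_mult[OF h] ev_const[OF h] monom_val_def
        ev_prod[OF h] ev_power[OF h])
qed (simp_all add: ev_add[OF is_hom_const] ev_add[OF h])

lemma ev_cong:
  assumes "\<And>m v. m \<in> Poly_Mapping.keys f \<Longrightarrow> v \<in> Poly_Mapping.keys m \<Longrightarrow> \<sigma> v = \<tau> v"
  shows "ev h \<sigma> f = ev h \<tau> f"
  unfolding ev_def monom_val_def using assms by (intro sum.cong prod.cong refl arg_cong2[of _ _ _ _ "(*)"]) auto

lemma monom_val_var:
  fixes m :: "'v \<Rightarrow>\<^sub>0 nat"
  shows "monom_val var m = (Poly_Mapping.single m 1 :: ('v, 'k::field) mpoly)"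
proof -
  have sp: "var v ^ n = (Poly_Mapping.single (Poly_Mapping.single v n) 1 :: ('v, 'k) mpoly)" for v n
    by (induction n) (simp_all add: var_def mult_single flip: single_add)
  have pr: "(\<Prod>v\<in>S. Poly_Mapping.single (g v) 1) = (Poly_Mapping.single (sum g S) 1 :: ('v, 'k) mpoly)"
    for S and g :: "'v \<Rightarrow> 'v \<Rightarrow>\<^sub>0 nat"
    by (induction S rule: infinite_finite_induct) (simp_all add: mult_single)
  have "(\<Sum>v\<in>Poly_Mapping.keys m. Poly_Mapping.single v (Poly_Mapping.lookup m v)) = m"
    by (rule poly_mapping_eqI)
       (auto simp: lookup_sum lookup_single when_def in_keys_iff if_distrib cong: if_cong)
  then show ?thesis unfolding monom_val_def sp pr by simp
qed

lemma subst_var: "subst var f = f"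
proof (induction f rule: mpoly_induct)
  case (single m c)
  then show ?case by (simp add: ev_single[OF is_hom_const] monom_val_var, simp add: const_def mult_single)
qed (simp_all add: ev_add[OF is_hom_const])

section \<open>Degree and order filtrations\<close>

lemma monom_degree_superset:
  assumes "finite S" "Poly_Mapping.keys m \<subseteq> S"
  shows "monom_degree m = (\<Sum>v\<in>S. Poly_Mapping.lookup m v)"
  unfolding monom_degree_def using assms
  by (intro sum.mono_neutral_left) (auto simp: in_keys_iff)

lemma monom_degree_add: "monom_degree (a + b) = monom_degree a + monom_degree b"
proof -
  let ?S = "Poly_Mapping.keys a \<union> Poly_Mapping.keys b"
  have "monom_degree (a + b) = (\<Sum>v\<in>?S. Poly_Mapping.lookup (a + b) v)"
    by (rule monom_degree_superset) (use Poly_Mapping.keys_add in \<open>simp, fast\<close>)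
  also have "\<dots> = monom_degree a + monom_degree b"
    by (subst (1 2) monom_degree_superset[of ?S]) (auto simp: lookup_add sum.distrib)
  finally show ?thesis .
qed

lemma monom_degree_0 [simp]: "monom_degree 0 = 0"
  and monom_degree_single [simp]: "monom_degree (Poly_Mapping.single v n) = n"
  by (simp_all add: monom_degree_def)

definition deg_le :: "nat \<Rightarrow> ('v, 'k::field) mpoly \<Rightarrow> bool" where
  "deg_le d f \<longleftrightarrow> (\<forall>m\<in>Poly_Mapping.keys f. monom_degree m \<le> d)"

definition vars_in :: "'v set \<Rightarrow> ('v, 'k::field) mpoly \<Rightarrow> bool" where
  "vars_in S f \<longleftrightarrow> (\<forall>m\<in>Poly_Mapping.keys f. Poly_Mapping.keys m \<subseteq> S)"

text \<open>The variable \<open>x\<^sub>0\<close> is kept for homogenization; the affine coordinates are \<open>x\<^sub>1, x\<^sub>2, \<dots>\<close>. The order of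
vanishing at the origin of affine space therefore ignores \<open>x\<^sub>0\<close>.\<close>

definition odeg :: "(nat \<Rightarrow>\<^sub>0 nat) \<Rightarrow> nat" where
  "odeg m = monom_degree m - Poly_Mapping.lookup m 0"

definition ord_ge :: "nat \<Rightarrow> (nat, 'k::field) mpoly \<Rightarrow> bool" where
  "ord_ge d f \<longleftrightarrow> (\<forall>m\<in>Poly_Mapping.keys f. d \<le> odeg m)"

lemma lookup_le_monom_degree: "Poly_Mapping.lookup m v \<le> monom_degree m"
proof (cases "v \<in> Poly_Mapping.keys m")
  case True
  then show ?thesis unfolding monom_degree_def by (intro member_le_sum) auto
qed (simp add: in_keys_iff)

lemma odeg_add: "odeg (a + b) = odeg a + odeg b"
  using lookup_le_monom_degree[of a 0] lookup_le_monom_degree[of b 0]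
  by (simp add: odeg_def monom_degree_add lookup_add)

lemma odeg_0 [simp]: "odeg 0 = 0" by (simp add: odeg_def)

lemma odeg_eq: "0 \<notin> Poly_Mapping.keys m \<Longrightarrow> odeg m = monom_degree m"
  by (simp add: odeg_def in_keys_iff)

text \<open>Degree, order and set of variables are all controlled through the monomials, and every monomial of a
product is a product of monomials of the factors. The calculus below follows from this.\<close>

lemma keys_mult_all:
  assumes "\<And>a b. a \<in> Poly_Mapping.keys f \<Longrightarrow> b \<in> Poly_Mapping.keys g \<Longrightarrow> P (a + b)"
  shows "\<forall>m\<in>Poly_Mapping.keys (f * g :: ('v, 'k::field) mpoly). P m"
  using assms Poly_Mapping.keys_mult[of f g] by blast

lemma keys_add_all:
  assumes "\<forall>m\<in>Poly_Mapping.keys f. P m" "\<forall>m\<in>Poly_Mapping.keys g. P m"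
  shows "\<forall>m\<in>Poly_Mapping.keys (f + g :: ('v, 'k::field) mpoly). P m"
  using assms Poly_Mapping.keys_add[of f g] by blast

lemma deg_le_0 [simp]: "deg_le d 0" and vars_in_0 [simp]: "vars_in S 0" and ord_ge_0 [simp]: "ord_ge e 0"
  by (simp_all add: deg_le_def vars_in_def ord_ge_def)

lemma deg_le_const [simp]: "deg_le d (const c)" and vars_in_const [simp]: "vars_in S (const c)"
  by (auto simp: deg_le_def vars_in_def const_def)

lemma deg_le_1 [simp]: "deg_le d 1" and vars_in_1 [simp]: "vars_in S 1"
  by (auto simp: deg_le_def vars_in_def)

lemma ord_ge_zero [simp]: "ord_ge 0 f" by (simp add: ord_ge_def)

lemma deg_le_var: "1 \<le> d \<Longrightarrow> deg_le d (var v)" and vars_in_var: "v \<in> S \<Longrightarrow> vars_in S (var v)"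
  by (auto simp: deg_le_def vars_in_def var_def)

lemma ord_ge_var: "i \<noteq> 0 \<Longrightarrow> ord_ge 1 (var i)"
  by (auto simp: ord_ge_def var_def odeg_def lookup_single)

lemma deg_le_add: "deg_le d f \<Longrightarrow> deg_le d g \<Longrightarrow> deg_le d (f + g)"
  and vars_in_add: "vars_in S f \<Longrightarrow> vars_in S g \<Longrightarrow> vars_in S (f + g)"
  unfolding deg_le_def vars_in_def by (rule keys_add_all; assumption)+

lemma ord_ge_add: "ord_ge e f \<Longrightarrow> ord_ge e g \<Longrightarrow> ord_ge e (f + g)"
  unfolding ord_ge_def by (rule keys_add_all)

lemma deg_le_mult: "deg_le d f \<Longrightarrow> deg_le e g \<Longrightarrow> deg_le (d + e) (f * g)"
  unfolding deg_le_def by (rule keys_mult_all) (auto simp: monom_degree_add intro: add_mono)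

lemma vars_in_mult: "vars_in S f \<Longrightarrow> vars_in S g \<Longrightarrow> vars_in S (f * g)"
  unfolding vars_in_def
proof (rule keys_mult_all)
  fix a b assume "\<forall>m\<in>Poly_Mapping.keys f. Poly_Mapping.keys m \<subseteq> S" "\<forall>m\<in>Poly_Mapping.keys g. Poly_Mapping.keys m \<subseteq> S"
    "a \<in> Poly_Mapping.keys f" "b \<in> Poly_Mapping.keys g"
  then show "Poly_Mapping.keys (a + b) \<subseteq> S" using Poly_Mapping.keys_add[of a b] by blast
qed

lemma ord_ge_mult: "ord_ge d f \<Longrightarrow> ord_ge e g \<Longrightarrow> ord_ge (d + e) (f * g)"
  unfolding ord_ge_def by (rule keys_mult_all) (auto simp: odeg_add intro: add_mono)

lemma deg_le_power: "deg_le d f \<Longrightarrow> deg_le (n * d) (f ^ n)"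
  by (induction n) (auto intro: deg_le_mult)

lemma vars_in_power: "vars_in S f \<Longrightarrow> vars_in S (f ^ n)"
  by (induction n) (auto intro: vars_in_mult)

lemma ord_ge_power: "ord_ge d f \<Longrightarrow> ord_ge (n * d) (f ^ n)"
  by (induction n) (auto intro: ord_ge_mult)

lemma deg_le_mono: "deg_le d f \<Longrightarrow> d \<le> e \<Longrightarrow> deg_le e f" by (auto simp: deg_le_def)
lemma ord_ge_mono: "ord_ge d f \<Longrightarrow> e \<le> d \<Longrightarrow> ord_ge e f" by (auto simp: ord_ge_def)

lemma deg_le_sum: "(\<And>i. i \<in> I \<Longrightarrow> deg_le d (f i)) \<Longrightarrow> deg_le d (sum f I)"
  by (induction I rule: infinite_finite_induct) (auto intro: deg_le_add)
lemma vars_in_sum: "(\<And>i. i \<in> I \<Longrightarrow> vars_in d (f i)) \<Longrightarrow> vars_in d (sum f I)"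
  by (induction I rule: infinite_finite_induct) (auto intro: vars_in_add)
lemma ord_ge_sum: "(\<And>i. i \<in> I \<Longrightarrow> ord_ge d (f i)) \<Longrightarrow> ord_ge d (sum f I)"
  by (induction I rule: infinite_finite_induct) (auto intro: ord_ge_add)

lemma deg_le_prod: "(\<And>i. i \<in> I \<Longrightarrow> deg_le (d i) (f i)) \<Longrightarrow> deg_le (sum d I) (prod f I)"
  by (induction I rule: infinite_finite_induct) (auto intro: deg_le_mult)
lemma vars_in_prod: "(\<And>i. i \<in> I \<Longrightarrow> vars_in d (f i)) \<Longrightarrow> vars_in d (prod f I)"
  by (induction I rule: infinite_finite_induct) (auto intro: vars_in_mult)
lemma ord_ge_prod: "(\<And>i. i \<in> I \<Longrightarrow> ord_ge (d i) (f i)) \<Longrightarrow> ord_ge (sum d I) (prod f I)"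
  by (induction I rule: infinite_finite_induct) (auto intro: ord_ge_mult)

lemma deg_le_subst:
  assumes "deg_le d f" "\<And>v. deg_le 1 (\<sigma> v)"
  shows "deg_le d (subst \<sigma> f)"
  unfolding ev_def
proof (rule deg_le_sum)
  fix m assume m: "m \<in> Poly_Mapping.keys f"
  have "deg_le (\<Sum>v\<in>Poly_Mapping.keys m. Poly_Mapping.lookup m v * 1) (monom_val \<sigma> m)"
    unfolding monom_val_def by (intro deg_le_prod deg_le_power assms)
  then have "deg_le (monom_degree m) (monom_val \<sigma> m)" by (simp add: monom_degree_def)
  then have "deg_le (0 + monom_degree m) (const (Poly_Mapping.lookup f m) * monom_val \<sigma> m)"
    by (intro deg_le_mult) auto
  then show "deg_le d (const (Poly_Mapping.lookup f m) * monom_val \<sigma> m)"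
    using assms(1) m by (elim deg_le_mono) (auto simp: deg_le_def)
qed

lemma vars_in_subst:
  assumes "vars_in S f" "\<And>v. v \<in> S \<Longrightarrow> vars_in T (\<sigma> v)"
  shows "vars_in T (subst \<sigma> f)"
  unfolding ev_def monom_val_def
proof (intro vars_in_sum vars_in_mult vars_in_prod vars_in_power vars_in_const assms(2))
  fix m v assume "m \<in> Poly_Mapping.keys f" "v \<in> Poly_Mapping.keys m"
  then show "v \<in> S" using assms(1) by (auto simp: vars_in_def)
qed

lemma ord_ge_subst:
  assumes "ord_ge d f" "\<And>v. v \<noteq> 0 \<Longrightarrow> ord_ge 1 (\<sigma> v)"
  shows "ord_ge d (subst \<sigma> f)"
  unfolding ev_def
proof (rule ord_ge_sum)
  fix m assume m: "m \<in> Poly_Mapping.keys f"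
  have "ord_ge (\<Sum>v\<in>Poly_Mapping.keys m. Poly_Mapping.lookup m v * (if v = 0 then 0 else 1)) (monom_val \<sigma> m)"
    unfolding monom_val_def by (intro ord_ge_prod ord_ge_power) (use assms in auto)
  moreover have "(\<Sum>v\<in>Poly_Mapping.keys m. Poly_Mapping.lookup m v * (if v = 0 then 0 else 1)) = odeg m"
  proof (cases "0 \<in> Poly_Mapping.keys m")
    case True
    then show ?thesis
      by (subst sum.remove[OF _ True]) (auto simp: odeg_def monom_degree_def sum.remove[OF _ True] intro!: sum.cong)
  next
    case False
    then have "(\<Sum>v\<in>Poly_Mapping.keys m. Poly_Mapping.lookup m v * (if v = 0 then 0 else 1)) = monom_degree m"
      unfolding monom_degree_def by (intro sum.cong) auto
    then show ?thesis using False by (simp add: odeg_eq)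
  qed
  ultimately have "ord_ge (0 + odeg m) (const (Poly_Mapping.lookup f m) * monom_val \<sigma> m)"
    by (intro ord_ge_mult) auto
  then show "ord_ge d (const (Poly_Mapping.lookup f m) * monom_val \<sigma> m)"
    using assms(1) m by (elim ord_ge_mono) (auto simp: ord_ge_def)
qed

text \<open>With the point \<open>y\<close> moved to the origin, vanishing of \<open>f\<close> to order \<open>m\<close> at \<open>y\<close> becomes
\<open>ord_ge m (shift y f)\<close>.\<close>

definition shift :: "(nat \<Rightarrow> 'k::field) \<Rightarrow> (nat, 'k) mpoly \<Rightarrow> (nat, 'k) mpoly" where
  "shift y = subst (\<lambda>i. var i + const (y i))"

lemma shift_shift: "shift y (shift z f) = shift (\<lambda>i. y i + z i) f"
  unfolding shift_def ev_subst[OF is_hom_const]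
  by (rule ev_cong) (simp add: ev_add[OF is_hom_const] ev_var[OF is_hom_const] ev_const[OF is_hom_const] const_add algebra_simps)

lemma shift_0: "shift (\<lambda>i. 0) f = f"
  by (simp add: shift_def subst_var)

lemma shift_inverse: "shift (\<lambda>i. - y i) (shift y f) = f" "shift y (shift (\<lambda>i. - y i) f) = f"
  by (simp_all add: shift_shift shift_0)

lemma shift_eq_0_iff: "shift y f = 0 \<longleftrightarrow> f = 0"
proof
  assume "shift y f = 0"
  then have "shift (\<lambda>i. - y i) (shift y f) = 0" by (simp add: shift_def)
  then show "f = 0" by (simp add: shift_inverse)
qed (simp add: shift_def)

lemma shift_mult: "shift y (f * g) = shift y f * shift y g"
  and shift_add: "shift y (f + g) = shift y f + shift y g"
  and shift_power: "shift y (f ^ n) = shift y f ^ n"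
  and shift_var: "shift y (var i) = var i + const (y i)"
  and shift_const: "shift y (const c) = const c"
  by (simp_all add: shift_def ev_mult[OF is_hom_const] ev_add[OF is_hom_const] ev_power[OF is_hom_const]
      ev_var[OF is_hom_const] ev_const[OF is_hom_const])

lemma deg_le_shift: "deg_le d f \<Longrightarrow> deg_le d (shift y f)"
  unfolding shift_def by (rule deg_le_subst) (auto intro!: deg_le_add deg_le_var)

lemma vars_in_shift: "vars_in S f \<Longrightarrow> vars_in S (shift y f)"
  unfolding shift_def by (rule vars_in_subst) (auto intro: vars_in_add vars_in_var)

section \<open>Points on parallel hyperplanes\<close>

text \<open>For projective points in the chart \<open>x\<^sub>0 \<noteq> 0\<close> the best \<open>\<kappa>\<close> is the reciprocal of the Waldschmidt constant.\<close>

definition mult_le_deg :: "nat \<Rightarrow> (nat \<Rightarrow> 'k::field) set \<Rightarrow> real \<Rightarrow> bool" where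
  "mult_le_deg N Y \<kappa> \<longleftrightarrow> (\<forall>g m D. g \<noteq> 0 \<longrightarrow> vars_in {1..N} g \<longrightarrow> deg_le D g \<longrightarrow>
      (\<forall>y\<in>Y. ord_ge m (shift y g)) \<longrightarrow> real m \<le> \<kappa> * real D)"

lemma lookup_var_mult:
  "Poly_Mapping.lookup (var v * G) (Poly_Mapping.single v 1 + \<mu>) = Poly_Mapping.lookup G \<mu>"
proof (induction G rule: mpoly_induct)
  case (single m c)
  then show ?case by (simp add: var_def mult_single lookup_single when_def)
qed (simp_all add: distrib_left lookup_add)

lemma odeg_single_add: "v \<noteq> 0 \<Longrightarrow> odeg (Poly_Mapping.single v 1 + \<mu>) = Suc (odeg \<mu>)"
  by (simp only: odeg_add) (simp add: odeg_def lookup_single)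

lemma ord_ge_cancel_var:
  assumes "ord_ge d (var v * G)" "v \<noteq> 0" shows "ord_ge (d - 1) G"
  unfolding ord_ge_def
proof
  fix \<mu> assume "\<mu> \<in> Poly_Mapping.keys G"
  then have "Poly_Mapping.single v 1 + \<mu> \<in> Poly_Mapping.keys (var v * G)"
    by (simp only: in_keys_iff lookup_var_mult) simp
  then have "d \<le> odeg (Poly_Mapping.single v 1 + \<mu>)" using assms(1) unfolding ord_ge_def by blast
  then show "d - 1 \<le> odeg \<mu>" using odeg_single_add[OF assms(2), of \<mu>] by linarith
qed

lemma keys_var_mult:
  "\<mu> \<in> Poly_Mapping.keys (var v * G) \<Longrightarrow> \<exists>\<nu>\<in>Poly_Mapping.keys G. \<mu> = Poly_Mapping.single v 1 + \<nu>"
  using Poly_Mapping.keys_mult[of "var v" G] by (auto simp: var_def)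

lemma lookup_const_mult: "Poly_Mapping.lookup (const c * G) \<mu> = c * Poly_Mapping.lookup G \<mu>"
proof (induction G rule: mpoly_induct)
  case (single m d)
  then show ?case by (simp add: const_def mult_single lookup_single when_def)
qed (simp_all add: distrib_left lookup_add)

text \<open>A factor that does not vanish at the origin leaves the order there unchanged: the lowest
  terms of \<open>G\<close> survive in the product.\<close>

lemma ord_ge_cancel_unit:
  assumes "ord_ge d ((var v + const c) * G)" "v \<noteq> 0" "c \<noteq> 0" shows "ord_ge d G"
proof (cases "G = 0")
  case False
  then obtain \<mu>0 where "\<mu>0 \<in> Poly_Mapping.keys G" using keys_eq_empty by blast
  from ex_has_least_nat[of "\<lambda>\<mu>. \<mu> \<in> Poly_Mapping.keys G", OF this, of odeg]
  obtain \<mu> where \<mu>: "\<mu> \<in> Poly_Mapping.keys G" "\<And>\<nu>. \<nu> \<in> Poly_Mapping.keys G \<Longrightarrow> odeg \<mu> \<le> odeg \<nu>"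
    by (elim exE conjE) (rule that, assumption, blast)
  have "\<mu> \<notin> Poly_Mapping.keys (var v * G)"
  proof
    assume "\<mu> \<in> Poly_Mapping.keys (var v * G)"
    then obtain \<nu> where "\<nu> \<in> Poly_Mapping.keys G" "\<mu> = Poly_Mapping.single v 1 + \<nu>"
      using keys_var_mult[of \<mu> v G] by blast
    then show False using \<mu>(2)[of \<nu>] odeg_single_add[OF assms(2), of \<nu>] by simp
  qed
  then have "Poly_Mapping.lookup ((var v + const c) * G) \<mu> = c * Poly_Mapping.lookup G \<mu>"
    by (simp add: distrib_right lookup_add lookup_const_mult in_keys_iff)
  then have "\<mu> \<in> Poly_Mapping.keys ((var v + const c) * G)" using \<mu>(1) assms(3) by (simp add: in_keys_iff)
  then have "d \<le> odeg \<mu>" using assms(1) by (simp add: ord_ge_def)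
  then show ?thesis unfolding ord_ge_def using \<mu>(2) by (meson order_trans)
qed simp

text \<open>If the restriction of \<open>h\<close> to a coordinate hyperplane is zero, the hyperplane splits off as a factor. The
last conclusion is what makes an induction on the degree bound terminate.\<close>

lemma divide_var:
  assumes z: "subst (\<lambda>i. if i = v then 0 else var i) h = 0" and S: "vars_in S h" and D: "deg_le D h"
  obtains h' where "h = var v * h'" "vars_in S h'" "deg_le (D - 1) h'" "h \<noteq> 0 \<Longrightarrow> D \<ge> 1"
proof -
  have v: "v \<in> Poly_Mapping.keys m" if m: "m \<in> Poly_Mapping.keys h" for m
  proof (rule ccontr)
    assume nv: "v \<notin> Poly_Mapping.keys m"
    have mv: "monom_val (\<lambda>i. if i = v then 0 else var i) \<mu> =
        (if v \<in> Poly_Mapping.keys \<mu> then 0 else Poly_Mapping.single \<mu> (1::'b))" for \<mu>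
    proof (cases "v \<in> Poly_Mapping.keys \<mu>")
      case True
      then show ?thesis unfolding monom_val_def
        by (subst prod.remove[OF _ True]) (auto simp: in_keys_iff power_0_left)
    next
      case False
      then have "monom_val (\<lambda>i. if i = v then 0 else var i) \<mu> = monom_val var \<mu>"
        unfolding monom_val_def by (intro prod.cong) auto
      then show ?thesis using False by (simp add: monom_val_var)
    qed
    have "0 = Poly_Mapping.lookup (subst (\<lambda>i. if i = v then 0 else var i) h) m" by (simp add: z)
    also have "\<dots> = (\<Sum>\<mu>\<in>Poly_Mapping.keys h. Poly_Mapping.lookup h \<mu> * (if \<mu> = m then 1 else 0))"
      unfolding ev_def lookup_sum mv
      by (intro sum.cong) (use nv in \<open>auto simp: lookup_const_mult lookup_single\<close>)
    also have "\<dots> = Poly_Mapping.lookup h m" using m by (simp add: sum.remove[OF _ m])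
    finally show False using m by (simp add: in_keys_iff)
  qed
  define \<pi> where "\<pi> m = m - Poly_Mapping.single v (1::nat)" for m
  have pi: "m = Poly_Mapping.single v 1 + \<pi> m" if "m \<in> Poly_Mapping.keys h" for m
    unfolding \<pi>_def using v[OF that]
    by (intro poly_mapping_eqI) (auto simp: lookup_add lookup_minus lookup_single when_def in_keys_iff)
  define h' where "h' = (\<Sum>m\<in>Poly_Mapping.keys h. Poly_Mapping.single (\<pi> m) (Poly_Mapping.lookup h m))"
  have "var v * h' = (\<Sum>m\<in>Poly_Mapping.keys h. Poly_Mapping.single (Poly_Mapping.single v 1 + \<pi> m) (Poly_Mapping.lookup h m))"
    by (simp add: h'_def var_def sum_distrib_left mult_single)
  also have "\<dots> = (\<Sum>m\<in>Poly_Mapping.keys h. Poly_Mapping.single m (Poly_Mapping.lookup h m))"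
    by (rule sum.cong) (simp_all only: pi[symmetric])
  also have "\<dots> = h" by (rule mpoly_expand[symmetric])
  finally have 1: "h = var v * h'" by simp
  have d: "monom_degree m = Suc (monom_degree (\<pi> m))" if "m \<in> Poly_Mapping.keys h" for m
    by (subst pi[OF that]) (simp add: monom_degree_add)
  have k: "Poly_Mapping.keys (\<pi> m) \<subseteq> Poly_Mapping.keys m" for m
    by (auto simp: \<pi>_def in_keys_iff lookup_minus)
  have "vars_in S h'" unfolding h'_def
    by (intro vars_in_sum) (use S k in \<open>fastforce simp: vars_in_def\<close>)
  moreover have "deg_le (D - 1) h'" unfolding h'_def
    by (intro deg_le_sum) (use D d in \<open>fastforce simp: deg_le_def\<close>)
  moreover have "D \<ge> 1" if "h \<noteq> 0"
  proof -
    from that obtain m where m: "m \<in> Poly_Mapping.keys h" by fastforce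
    then show ?thesis using d[OF m] D by (auto simp: deg_le_def)
  qed
  ultimately show thesis using that 1 by blast
qed

text \<open>If \<open>g\<close> does not vanish identically on any of the hyperplanes \<open>x\<^sub>N\<^sub>+\<^sub>1 = t\<^sub>j\<close>, restriction to each of them gives
\<open>m\<^sub>j \<le> \<kappa>\<^sub>j D\<close>, and the weighted sum of these inequalities is the claim. If \<open>g\<close> vanishes on one of them,
divide by its equation: the degree drops by \<open>1\<close>, only the multiplicity on that layer drops, by at most
\<open>1\<close>, and its weight is at most \<open>1\<close>. The multiplicities must be allowed to differ between the layers for
this induction.\<close>

lemma layers_bound:
  fixes g :: "(nat, 'k::field) mpoly" and N :: nat
  assumes J: "finite J" "inj_on t J" and Y: "\<And>j. j \<in> J \<Longrightarrow> mult_le_deg N (Y j) (\<kappa> j)"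
    and w: "\<And>j. j \<in> J \<Longrightarrow> 0 \<le> w j \<and> w j \<le> 1" "(\<Sum>j\<in>J. w j * \<kappa> j) \<le> 1"
    and "g \<noteq> 0" "vars_in {1..Suc N} g" "deg_le D g"
    and "\<And>j y. j \<in> J \<Longrightarrow> y \<in> Y j \<Longrightarrow> ord_ge (m j) (shift (y(Suc N := t j)) g)"
  shows "(\<Sum>j\<in>J. w j * real (m j)) \<le> real D"
  using assms(6-)
proof (induction D arbitrary: g m rule: less_induct)
  case (less D)
  define res where "res j = subst (\<lambda>i. if i = Suc N then const (t j) else var i) g" for j
  show ?case
  proof (cases "\<exists>j\<in>J. res j = 0")
    case False
    have b: "real (m j) \<le> \<kappa> j * real D" if j: "j \<in> J" for j
    proof -
      have "res j \<noteq> 0" using False j by blast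
      moreover have "vars_in {1..N} (res j)" unfolding res_def
        by (rule vars_in_subst[OF less.prems(2)]) (auto intro: vars_in_var)
      moreover have "deg_le D (res j)" unfolding res_def
        by (rule deg_le_subst[OF less.prems(3)]) (auto intro: deg_le_var)
      moreover have "ord_ge (m j) (shift y (res j))" if y: "y \<in> Y j" for y
      proof -
        have "shift y (res j) = subst (\<lambda>i. if i = Suc N then 0 else var i) (shift (y(Suc N := t j)) g)"
          unfolding shift_def res_def ev_subst[OF is_hom_const]
          by (rule ev_cong) (auto simp: ev_add[OF is_hom_const] ev_const[OF is_hom_const] ev_var[OF is_hom_const])
        moreover have "ord_ge (m j) \<dots>"
          by (rule ord_ge_subst[OF less.prems(4)[OF j y]]) (auto intro: ord_ge_var[unfolded One_nat_def])
        ultimately show ?thesis by simp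
      qed
      ultimately show ?thesis using Y[OF j] unfolding mult_le_deg_def by blast
    qed
    have "(\<Sum>j\<in>J. w j * real (m j)) \<le> (\<Sum>j\<in>J. w j * (\<kappa> j * real D))"
      by (intro sum_mono mult_left_mono b) (use w(1) in auto)
    also have "\<dots> = (\<Sum>j\<in>J. w j * \<kappa> j) * real D" by (simp add: sum_distrib_right mult.assoc)
    also have "\<dots> \<le> 1 * real D" by (intro mult_right_mono w(2)) auto
    finally show ?thesis by simp
  next
    case True
    then obtain j where j: "j \<in> J" "res j = 0" by blast
    define e where "e i = (if i = Suc N then t j else 0)" for i
    have "subst (\<lambda>i. if i = Suc N then 0 else var i) (shift e g) = res j"
      unfolding shift_def res_def ev_subst[OF is_hom_const]
      by (rule ev_cong) (auto simp: e_def ev_add[OF is_hom_const] ev_const[OF is_hom_const] ev_var[OF is_hom_const])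
    then obtain h where h: "shift e g = var (Suc N) * h" "vars_in {1..Suc N} h" "deg_le (D - 1) h"
      and D: "shift e g \<noteq> 0 \<Longrightarrow> D \<ge> 1"
      using divide_var[of "Suc N" "shift e g" "{1..Suc N}" D] j(2) vars_in_shift[OF less.prems(2)]
        deg_le_shift[OF less.prems(3)] by metis
    have D1: "D \<ge> 1" using D less.prems(1) by (simp add: shift_eq_0_iff)
    define g' where "g' = shift (\<lambda>i. - e i) h"
    have g: "g = (var (Suc N) + const (- t j)) * g'"
      using shift_inverse(1)[of e g] unfolding h(1) by (simp add: shift_mult shift_var g'_def e_def)
    have g'0: "g' \<noteq> 0" using g less.prems(1) by auto
    have IH: "(\<Sum>i\<in>J. w i * real ((m(j := m j - 1)) i)) \<le> real (D - 1)"
    proof (rule less.IH)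
      show "D - 1 < D" using D1 by simp
      show "g' \<noteq> 0" by fact
      show "vars_in {1..Suc N} g'" "deg_le (D - 1) g'"
        using h by (auto simp: g'_def intro: vars_in_shift deg_le_shift)
      fix i y assume i: "i \<in> J" and y: "y \<in> Y i"
      let ?z = "y(Suc N := t i)"
      have sh: "shift ?z g = (var (Suc N) + const (t i - t j)) * shift ?z g'"
        unfolding g shift_mult shift_add shift_var shift_const
        by (simp add: add.assoc flip: const_add)
      have o: "ord_ge (m i) ((var (Suc N) + const (t i - t j)) * shift ?z g')"
        using less.prems(4)[OF i y] unfolding sh .
      show "ord_ge ((m(j := m j - 1)) i) (shift ?z g')"
      proof (cases "i = j")
        case True
        then show ?thesis using o ord_ge_cancel_var[of "m j" "Suc N"] by simp
      next
        case False
        then have "t i - t j \<noteq> 0" using J(2) i j(1) by (auto dest: inj_onD)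
        then show ?thesis using ord_ge_cancel_unit[OF o] False by simp
      qed
    qed
    have "(\<Sum>i\<in>J. w i * real (m i)) \<le> (\<Sum>i\<in>J. w i * real ((m(j := m j - 1)) i) + (if i = j then w j else 0))"
    proof (rule sum_mono)
      fix i assume i: "i \<in> J"
      have "w i * real (m i) \<le> w i * (real (m i - 1) + 1)"
        using w(1)[OF i] by (intro mult_left_mono) auto
      then show "w i * real (m i) \<le> w i * real ((m(j := m j - 1)) i) + (if i = j then w j else 0)"
        by (auto simp: algebra_simps)
    qed
    also have "\<dots> \<le> real (D - 1) + 1"
      using IH w(1)[OF j(1)] j(1) J(1) by (simp add: sum.distrib)
    finally show ?thesis using D1 by simp
  qed
qed

text \<open>Choosing weights in \<open>[0, 1]\<close> with the largest sum under the constraint \<open>\<Sum>\<^sub>j w\<^sub>j \<kappa>\<^sub>j \<le> 1\<close> is a fractional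
knapsack problem. Layer \<open>j\<close> carries \<open>C(n + x - j, n)\<close> points and has \<open>\<kappa>\<^sub>j = n / (n + x - j)\<close>, so the cheap
layers come first: the first \<open>r\<close> of them get weight \<open>1\<close> and the next one the fraction that brings the
total to the required \<open>(n + 1 + x) / (n + 1)\<close>.\<close>

definition layer_weight :: "nat \<Rightarrow> nat \<Rightarrow> nat \<Rightarrow> real" where
  "layer_weight n x j = (let r = (Suc n + x) div Suc n; \<rho> = (Suc n + x) mod Suc n in
     if j < r then 1 else if j = r then real \<rho> / real (Suc n) else 0)"

lemma layer_weight_bounds: "0 \<le> layer_weight n x j" "layer_weight n x j \<le> 1"
proof -
  have "real ((Suc n + x) mod Suc n) \<le> real (Suc n)"
    by (intro of_nat_mono less_imp_le mod_less_divisor) simp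
  then show "0 \<le> layer_weight n x j" "layer_weight n x j \<le> 1"
    by (auto simp: layer_weight_def Let_def divide_le_eq)
qed

lemma layer_index_le: "n \<ge> 1 \<Longrightarrow> x \<ge> 1 \<Longrightarrow> (Suc n + x) div Suc n \<le> x"
proof -
  assume "n \<ge> 1" "x \<ge> 1"
  have "(Suc n + x) div Suc n = 1 + x div Suc n" by (metis One_nat_def add.commute add_Suc div_add_self1 nat.simps(3) plus_1_eq_Suc)
  moreover have "x div Suc n < x" using \<open>n \<ge> 1\<close> \<open>x \<ge> 1\<close> by (intro div_less_dividend) auto
  ultimately show ?thesis by simp
qed

text \<open>The fractional layer must exist: its index has to be at most \<open>x\<close>, unless its weight is zero.\<close>

lemma layer_weight_sum_split:
  assumes "(Suc n + x) div Suc n \<le> x \<or> (Suc n + x) mod Suc n = 0" "(Suc n + x) div Suc n \<le> Suc x"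
  shows "(\<Sum>j\<le>x. layer_weight n x j * a j) = (\<Sum>j<(Suc n + x) div Suc n. a j)
     + real ((Suc n + x) mod Suc n) / real (Suc n) * a ((Suc n + x) div Suc n)"
proof -
  define r where "r = (Suc n + x) div Suc n"
  define \<rho> where "\<rho> = (Suc n + x) mod Suc n"
  have w: "layer_weight n x j = (if j < r then 1 else if j = r then real \<rho> / real (Suc n) else 0)" for j
    by (simp add: layer_weight_def r_def \<rho>_def Let_def)
  have "(\<Sum>j\<le>x. layer_weight n x j * a j) = (\<Sum>j\<in>{..<r} \<union> {r}. layer_weight n x j * a j)"
  proof (cases "r \<le> x")
    case True
    then show ?thesis by (intro sum.mono_neutral_right) (auto simp: w)
  next
    case False
    then have "\<rho> = 0" "r = Suc x" using assms by (auto simp: r_def \<rho>_def)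
    then show ?thesis by (intro sum.mono_neutral_left) (auto simp: w)
  qed
  also have "\<dots> = (\<Sum>j<r. a j) + real \<rho> / real (Suc n) * a r"
    by (subst sum.union_disjoint) (auto simp: w)
  finally show ?thesis by (simp add: r_def \<rho>_def)
qed

lemma layer_weight_cond:
  "(Suc n + x) div Suc n \<le> x \<or> (Suc n + x) mod Suc n = 0" "(Suc n + x) div Suc n \<le> Suc x"
proof -
  have "n = 0 \<or> x = 0 \<or> (n \<ge> 1 \<and> x \<ge> 1)" by auto
  then show "(Suc n + x) div Suc n \<le> x \<or> (Suc n + x) mod Suc n = 0" "(Suc n + x) div Suc n \<le> Suc x"
    using layer_index_le[of n x] by auto
qed

lemma layer_weight_sum: "(\<Sum>j\<le>x. layer_weight n x j) = real (Suc n + x) / real (Suc n)"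
proof -
  have "(\<Sum>j\<le>x. layer_weight n x j * 1) = real ((Suc n + x) div Suc n) + real ((Suc n + x) mod Suc n) / real (Suc n)"
    by (subst layer_weight_sum_split[OF layer_weight_cond]) simp
  also have "\<dots> = real (Suc n + x) / real (Suc n)"
  proof -
    have "real (Suc n + x) = real ((Suc n + x) div Suc n) * real (Suc n) + real ((Suc n + x) mod Suc n)"
      by (metis div_mult_mod_eq of_nat_add of_nat_mult)
    then show ?thesis by (simp add: field_simps del: of_nat_Suc of_nat_add)
  qed
  finally show ?thesis by simp
qed

text \<open>Put \<open>A = n + x - r\<close>. The \<open>r\<close> full layers have constants at most \<open>n / (A + 1)\<close> and the fractional layer has
\<open>n / A\<close>; as the total weight is \<open>(n + 1 + x) / (n + 1)\<close>, the sum is at most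
\<open>1 - \<theta> (A - n) / (A (A + 1))\<close>, where \<open>\<theta>\<close> is the fraction. For \<open>x \<ge> 2\<close> the inequality is strict: either
\<open>\<theta> > 0\<close> and \<open>A > n\<close>, or there are at least two full layers and the first has a smaller constant than the
bound used for it.\<close>

lemma layer_weight_kappa:
  assumes n: "n \<ge> 1"
  shows "(\<Sum>j\<le>x. layer_weight n x j * (real n / real (n + (x - j)))) \<le> 1"
    and "x \<ge> 2 \<Longrightarrow> (\<Sum>j\<le>x. layer_weight n x j * (real n / real (n + (x - j)))) < 1"
proof -
  define r where "r = (Suc n + x) div Suc n"
  define \<rho> where "\<rho> = (Suc n + x) mod Suc n"
  define \<theta> where "\<theta> = real \<rho> / real (Suc n)"
  define a where "a j = real n / real (n + (x - j))" for j
  have s: "(\<Sum>j\<le>x. layer_weight n x j * a j) = (\<Sum>j<r. a j) + \<theta> * a r"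
    by (subst layer_weight_sum_split[OF layer_weight_cond]) (simp add: r_def \<rho>_def \<theta>_def)
  have "(\<Sum>j\<le>x. layer_weight n x j * a j) \<le> 1 \<and> (x \<ge> 2 \<longrightarrow> (\<Sum>j\<le>x. layer_weight n x j * a j) < 1)"
  proof (cases "x = 0")
    case True
    then have "r = 1" "\<rho> = 0" by (auto simp: r_def \<rho>_def)
    then show ?thesis using n True unfolding s by (simp add: a_def \<theta>_def)
  next
    case False
    then have rx: "r \<le> x" using layer_index_le n by (simp add: r_def)
    have rho: "Suc n * r + \<rho> = Suc n + x" by (simp only: r_def \<rho>_def mult_div_mod_eq)
    have r1: "r \<ge> 1" by (simp add: r_def div_greater_zero_iff Suc_le_eq)
    define A where "A = real (n + x - r)"
    have An: "A \<ge> real n" "A > 0" using rx n by (auto simp: A_def)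
    have th: "0 \<le> \<theta>" by (simp add: \<theta>_def)
    have "real (Suc n) * \<theta> = real \<rho>" by (simp add: \<theta>_def)
    moreover have "real (Suc n) * real r + real \<rho> = real (Suc n) + real x"
      using rho by (metis of_nat_add of_nat_mult)
    \<comment> \<open>the total weight \<open>r + \<theta>\<close>, rewritten in terms of \<open>A\<close>\<close>
    ultimately have rel: "real n * (real r + \<theta>) = A + 1 - \<theta>"
      using rx by (simp add: A_def of_nat_diff algebra_simps)
    define B where "B = real n / (A + 1)"
    have aj: "a j \<le> B" if "j < r" for j
      unfolding a_def B_def using that rx n
      by (intro divide_left_mono) (auto simp: A_def of_nat_diff)
    have ar: "a r = real n / A" using rx by (simp add: a_def A_def)
    have key: "real r * B + \<theta> * (real n / A) = 1 - \<theta> * (A - real n) / (A * (A + 1))"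
    proof -
      have B: "B * (A + 1) = real n" and q: "(real n / A) * A = real n" using An by (simp_all add: B_def)
      have "(real r * B + \<theta> * (real n / A)) * (A * (A + 1)) = real r * (B * (A + 1)) * A + \<theta> * ((real n / A) * A) * (A + 1)"
        by (simp only: algebra_simps)
      also have "\<dots> = real n * (real r + \<theta>) * A + \<theta> * real n" unfolding B q by (simp add: algebra_simps)
      also have "\<dots> = A * (A + 1) - \<theta> * (A - real n)" unfolding rel by (simp add: algebra_simps)
      finally have "real r * B + \<theta> * (real n / A) = (A * (A + 1) - \<theta> * (A - real n)) / (A * (A + 1))"
        using An by (simp add: eq_divide_eq)
      then show ?thesis using An by (simp add: diff_divide_distrib)
    qed
    have nn: "\<theta> * (A - real n) / (A * (A + 1)) \<ge> 0" using An th by simp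
    have sm: "(\<Sum>j<r. a j) \<le> real r * B" using sum_bounded_above[of "{..<r}" a B] aj by simp
    have le: "(\<Sum>j<r. a j) + \<theta> * a r \<le> 1" using sm key nn unfolding ar by linarith
    moreover have "(\<Sum>j<r. a j) + \<theta> * a r < 1" if x2: "x \<ge> 2"
    proof (cases "\<rho> = 0")
      case True
      have "r \<noteq> 1" using rho True False by auto
      then have r2: "r \<ge> 2" using r1 by simp
      have "a 0 < B" unfolding a_def B_def using r2 rx n
        by (intro divide_strict_left_mono) (auto simp: A_def of_nat_diff)
      then have "(\<Sum>j<r. a j) < (\<Sum>j<r. B)" using aj r1
        by (intro sum_strict_mono_ex1) (auto intro!: bexI[of _ 0])
      then show ?thesis using True key by (simp add: \<theta>_def ar)
    next
      case rho0: False
      have "r \<noteq> x"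
      proof
        assume "r = x"
        then have "n * x + \<rho> = Suc n" using rho by simp
        moreover have "n * x \<ge> n * 2" using x2 by simp
        ultimately show False using n rho0 by linarith
      qed
      then have "A > real n" using rx by (simp add: A_def)
      moreover have "\<theta> > 0" using rho0 by (simp add: \<theta>_def)
      ultimately have "\<theta> * (A - real n) / (A * (A + 1)) > 0" using An by simp
      then show ?thesis using sm key unfolding ar by linarith
    qed
    ultimately show ?thesis unfolding s by blast
  qed
  then show "(\<Sum>j\<le>x. layer_weight n x j * (real n / real (n + (x - j)))) \<le> 1"
    and "x \<ge> 2 \<Longrightarrow> (\<Sum>j\<le>x. layer_weight n x j * (real n / real (n + (x - j)))) < 1"
    by (simp_all add: a_def)
qed

text \<open>The sizes add up by the identity \<open>\<Sum>\<^sub>j C(n + j, n) = C(n + 1 + x, n + 1)\<close>. The weights are left open,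
because they are used once as above and once slightly enlarged.\<close>

lemma layered_union:
  fixes Y :: "nat \<Rightarrow> (nat \<Rightarrow> 'k::field) set"
  assumes inf: "infinite (UNIV :: 'k set)"
    and Y: "\<And>j. j \<le> x \<Longrightarrow> finite (Y j) \<and> card (Y j) \<le> (n + (x - j)) choose n"
      "\<And>j. j \<le> x \<Longrightarrow> mult_le_deg n (Y j) (\<kappa> j)"
  shows "\<exists>Z :: (nat \<Rightarrow> 'k) set. finite Z \<and> card Z \<le> (Suc n + x) choose Suc n \<and> (Y 0 \<noteq> {} \<longrightarrow> Z \<noteq> {}) \<and>
    (\<forall>w. (\<forall>j\<le>x. 0 \<le> w j \<and> w j \<le> 1) \<longrightarrow> (\<Sum>j\<le>x. w j * \<kappa> j) \<le> 1 \<longrightarrow> 0 < (\<Sum>j\<le>x. w j) \<longrightarrow>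
      mult_le_deg (Suc n) Z (1 / (\<Sum>j\<le>x. w j)))"
proof -
  obtain t :: "nat \<Rightarrow> 'k" where t: "inj t" using infinite_countable_subset[OF inf] by blast
  define Z where "Z = (\<Union>j\<le>x. (\<lambda>y. y(Suc n := t j)) ` Y j)"
  have "finite Z" unfolding Z_def using Y(1) by auto
  moreover have "card Z \<le> (Suc n + x) choose Suc n"
  proof -
    have "card Z \<le> (\<Sum>j\<le>x. card ((\<lambda>y. y(Suc n := t j)) ` Y j))" unfolding Z_def by (rule card_UN_le) simp
    also have "\<dots> \<le> (\<Sum>j\<le>x. (n + (x - j)) choose n)"
      using Y(1) by (intro sum_mono order_trans[OF card_image_le]) auto
    also have "\<dots> = (\<Sum>j\<le>x. (n + j) choose n)"
      by (rule sum.reindex_bij_witness[of _ "\<lambda>j. x - j" "\<lambda>j. x - j"]) auto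
    also have "\<dots> = (Suc n + x) choose Suc n" by (simp add: choose_rising_sum)
    finally show ?thesis .
  qed
  moreover have "Z \<noteq> {}" if "Y 0 \<noteq> {}" using that unfolding Z_def by auto
  moreover have "mult_le_deg (Suc n) Z (1 / (\<Sum>j\<le>x. w j))"
    if w: "\<forall>j\<le>x. 0 \<le> w j \<and> w j \<le> 1" "(\<Sum>j\<le>x. w j * \<kappa> j) \<le> 1" "0 < (\<Sum>j\<le>x. w j)" for w
    unfolding mult_le_deg_def
  proof (intro allI impI)
    fix g :: "(nat, 'k) mpoly" and m D
    assume g: "g \<noteq> 0" "vars_in {1..Suc n} g" "deg_le D g" "\<forall>y\<in>Z. ord_ge m (shift y g)"
    have "(\<Sum>j\<le>x. w j * real m) \<le> real D"
      by (rule layers_bound[where t = t and Y = Y and \<kappa> = \<kappa> and g = g and m = "\<lambda>_. m" and N = n])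
         (use w g Y(2) t in \<open>auto simp: Z_def inj_on_def inj_def\<close>)
    then have "(\<Sum>j\<le>x. w j) * real m \<le> real D" by (simp only: sum_distrib_right)
    then show "real m \<le> 1 / (\<Sum>j\<le>x. w j) * real D" using w(3) by (simp add: pos_le_divide_eq mult.commute)
  qed
  ultimately show ?thesis by - (rule exI[of _ Z], intro conjI allI impI, simp_all)
qed

text \<open>Repeating the construction in every dimension gives a simplex-shaped grid of points. In dimension \<open>0\<close>
a nonzero constant does not vanish at the only point.\<close>

lemma ex_points_mult_le_deg:
  assumes inf: "infinite (UNIV :: 'k::field set)"
  shows "\<exists>Y :: (nat \<Rightarrow> 'k) set. finite Y \<and> Y \<noteq> {} \<and> card Y \<le> (N + x) choose N \<and>
    mult_le_deg N Y (real N / real (N + x))"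
proof (induction N arbitrary: x)
  case 0
  have "m = 0" if "g \<noteq> 0" "vars_in {1..0} g" "ord_ge m (shift (\<lambda>_. 0) g)" for g :: "(nat, 'k) mpoly" and m
  proof -
    obtain \<mu> where \<mu>: "\<mu> \<in> Poly_Mapping.keys g" using \<open>g \<noteq> 0\<close> by fastforce
    then have "Poly_Mapping.keys \<mu> = {}" using that(2) by (auto simp: vars_in_def)
    then show ?thesis using that(3) \<mu> by (auto simp: shift_0 ord_ge_def)
  qed
  then have "mult_le_deg 0 {\<lambda>_. 0 :: 'k} (real 0 / real (0 + x))"
    unfolding mult_le_deg_def by fastforce
  then show ?case by (intro exI[of _ "{\<lambda>_. 0}"]) auto
next
  case (Suc n)
  define P where "P Y x \<longleftrightarrow> finite Y \<and> Y \<noteq> {} \<and> card Y \<le> (n + x) choose n \<and>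
    mult_le_deg n Y (real n / real (n + x))" for Y :: "(nat \<Rightarrow> 'k) set" and x
  have "\<forall>j. \<exists>Y. P Y (x - j)" using Suc.IH unfolding P_def by blast
  then obtain Y where Y: "\<And>j. P (Y j) (x - j)" by metis
  have fin: "\<And>j. finite (Y j) \<and> card (Y j) \<le> (n + (x - j)) choose n"
    and mult: "\<And>j. mult_le_deg n (Y j) (real n / real (n + (x - j)))"
    using Y unfolding P_def by blast+
  obtain Z :: "(nat \<Rightarrow> 'k) set" where Z: "finite Z" "card Z \<le> (Suc n + x) choose Suc n" "Y 0 \<noteq> {} \<longrightarrow> Z \<noteq> {}"
    and bd: "\<forall>w. (\<forall>j\<le>x. 0 \<le> w j \<and> w j \<le> 1) \<longrightarrow> (\<Sum>j\<le>x. w j * (real n / real (n + (x - j)))) \<le> 1 \<longrightarrow>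
      0 < (\<Sum>j\<le>x. w j) \<longrightarrow> mult_le_deg (Suc n) Z (1 / (\<Sum>j\<le>x. w j))"
    using layered_union[OF inf fin mult] by (elim exE conjE) (rule that; assumption)
  have "(\<Sum>j\<le>x. layer_weight n x j * (real n / real (n + (x - j)))) \<le> 1"
    using layer_weight_kappa(1)[of n x] by (cases "n = 0") auto
  then have "mult_le_deg (Suc n) Z (1 / (real (Suc n + x) / real (Suc n)))"
    using bd[rule_format, of "layer_weight n x"] layer_weight_bounds by (simp add: layer_weight_sum del: of_nat_Suc of_nat_add)
  then show ?case using Z(1-3) Y[of 0] unfolding P_def by (intro exI[of _ Z]) simp
qed

text \<open>In the last step the constraint \<open>\<Sum>\<^sub>j w\<^sub>j \<kappa>\<^sub>j \<le> 1\<close> holds strictly, which leaves room to enlarge the weight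
of the fractional layer and with it the total.\<close>

lemma ex_points_mult_less_deg:
  assumes inf: "infinite (UNIV :: 'k::field set)" and n: "n \<ge> 1" and x: "x \<ge> 2"
  shows "\<exists>(Y :: (nat \<Rightarrow> 'k) set) c. finite Y \<and> Y \<noteq> {} \<and> card Y \<le> (Suc n + x) choose Suc n \<and>
    c > real (Suc n + x) / real (Suc n) \<and> mult_le_deg (Suc n) Y (1 / c)"
proof -
  define P where "P Y x \<longleftrightarrow> finite Y \<and> Y \<noteq> {} \<and> card Y \<le> (n + x) choose n \<and>
    mult_le_deg n Y (real n / real (n + x))" for Y :: "(nat \<Rightarrow> 'k) set" and x
  have "\<forall>j. \<exists>Y. P Y (x - j)" using ex_points_mult_le_deg[OF inf] unfolding P_def by blast
  then obtain Y where Y: "\<And>j. P (Y j) (x - j)" by metis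
  have fin: "\<And>j. finite (Y j) \<and> card (Y j) \<le> (n + (x - j)) choose n"
    and mult: "\<And>j. mult_le_deg n (Y j) (real n / real (n + (x - j)))"
    using Y unfolding P_def by blast+
  obtain Z :: "(nat \<Rightarrow> 'k) set" where Z: "finite Z" "card Z \<le> (Suc n + x) choose Suc n" "Y 0 \<noteq> {} \<longrightarrow> Z \<noteq> {}"
    and bd: "\<forall>w. (\<forall>j\<le>x. 0 \<le> w j \<and> w j \<le> 1) \<longrightarrow> (\<Sum>j\<le>x. w j * (real n / real (n + (x - j)))) \<le> 1 \<longrightarrow>
      0 < (\<Sum>j\<le>x. w j) \<longrightarrow> mult_le_deg (Suc n) Z (1 / (\<Sum>j\<le>x. w j))"
    using layered_union[OF inf fin mult] by (elim exE conjE) (rule that; assumption)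
  define r where "r = (Suc n + x) div Suc n"
  have rx: "r \<le> x" using layer_index_le n x by (simp add: r_def)
  define \<theta> where "\<theta> = layer_weight n x r"
  have "real ((Suc n + x) mod Suc n) < real (Suc n)"
    by (intro of_nat_less_iff[THEN iffD2] mod_less_divisor) simp
  then have th: "\<theta> < 1" "0 \<le> \<theta>"
    by (auto simp: \<theta>_def layer_weight_def r_def Let_def)
  define S where "S = (\<Sum>j\<le>x. layer_weight n x j * (real n / real (n + (x - j))))"
  have S1: "S < 1" using layer_weight_kappa(2)[OF n x] by (simp add: S_def)
  \<comment> \<open>\<open>1 - \<theta>\<close> keeps the weight of layer \<open>r\<close> at most \<open>1\<close>; \<open>1 - S\<close> is the slack, and \<open>\<kappa>\<^sub>r \<le> 1\<close>\<close>
  define \<delta> where "\<delta> = min (1 - \<theta>) (1 - S)"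
  have d: "\<delta> > 0" "\<delta> \<le> 1 - \<theta>" "\<delta> \<le> 1 - S" using S1 th by (auto simp: \<delta>_def)
  define w where "w j = layer_weight n x j + (if j = r then \<delta> else 0)" for j
  have sum: "(\<Sum>j\<le>x. w j) = real (Suc n + x) / real (Suc n) + \<delta>"
    using rx by (simp add: w_def sum.distrib layer_weight_sum del: of_nat_Suc of_nat_add)
  have "mult_le_deg (Suc n) Z (1 / (\<Sum>j\<le>x. w j))"
  proof (rule bd[rule_format, of w])
    fix j show "0 \<le> w j \<and> w j \<le> 1" using layer_weight_bounds[of n x j] d by (auto simp: w_def \<theta>_def)
  next
    have k: "real n / real (n + (x - r)) \<le> 1" using n by (auto simp: divide_le_eq)
    have "(\<Sum>j\<le>x. w j * (real n / real (n + (x - j)))) =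
        S + (\<Sum>j\<le>x. if j = r then \<delta> * (real n / real (n + (x - j))) else 0)"
      unfolding S_def sum.distrib[symmetric] w_def by (intro sum.cong) (auto simp: distrib_right add_divide_distrib)
    also have "\<dots> = S + \<delta> * (real n / real (n + (x - r)))" using rx by simp
    also have "\<dots> \<le> S + \<delta>" using d k by (intro add_left_mono mult_left_le) auto
    finally show "(\<Sum>j\<le>x. w j * (real n / real (n + (x - j)))) \<le> 1" using d by simp
  next
    show "0 < (\<Sum>j\<le>x. w j)" unfolding sum using d by (intro add_pos_pos) auto
  qed
  then show ?thesis using Z Y[of 0] d unfolding P_def
    by (intro exI[of _ Z] exI[of _ "real (Suc n + x) / real (Suc n) + \<delta>"]) (simp add: sum del: of_nat_Suc of_nat_add)
qed

section \<open>Valuation rings with a non-invertible prime\<close>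

definition is_subring :: "'k::comm_ring_1 set \<Rightarrow> bool" where
  "is_subring A \<longleftrightarrow> 1 \<in> A \<and> (\<forall>x\<in>A. \<forall>y\<in>A. x - y \<in> A \<and> x * y \<in> A)"

lemma is_subringD:
  assumes "is_subring A"
  shows "0 \<in> A" "1 \<in> A" "\<And>x. x \<in> A \<Longrightarrow> - x \<in> A"
    "\<And>x y. x \<in> A \<Longrightarrow> y \<in> A \<Longrightarrow> x + y \<in> A"
    "\<And>x y. x \<in> A \<Longrightarrow> y \<in> A \<Longrightarrow> x - y \<in> A"
    "\<And>x y. x \<in> A \<Longrightarrow> y \<in> A \<Longrightarrow> x * y \<in> A"
proof -
  show 1: "1 \<in> A" and d: "\<And>x y. x \<in> A \<Longrightarrow> y \<in> A \<Longrightarrow> x - y \<in> A"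
    and "\<And>x y. x \<in> A \<Longrightarrow> y \<in> A \<Longrightarrow> x * y \<in> A"
    using assms by (auto simp: is_subring_def)
  show 0: "0 \<in> A" using d[OF 1 1] by simp
  show neg: "- x \<in> A" if "x \<in> A" for x using d[OF 0 that] by simp
  show "x + y \<in> A" if "x \<in> A" "y \<in> A" for x y using d[OF that(1) neg[OF that(2)]] by simp
qed

lemma is_subring_sum:
  assumes "is_subring A" "\<And>i. i \<in> I \<Longrightarrow> f i \<in> A" shows "sum f I \<in> A"
  using assms(2) by (induction I rule: infinite_finite_induct) (auto intro: is_subringD[OF assms(1)])

lemma is_subring_prod:
  assumes "is_subring A" "\<And>i. i \<in> I \<Longrightarrow> f i \<in> A" shows "prod f I \<in> A"
  using assms(2) by (induction I rule: infinite_finite_induct) (auto intro: is_subringD[OF assms(1)])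

lemma is_subring_power:
  assumes "is_subring A" "x \<in> A" shows "x ^ n \<in> A"
  using assms(2) by (induction n) (auto intro: is_subringD[OF assms(1)])

lemma is_subring_of_nat:
  assumes "is_subring A" shows "of_nat n \<in> A"
  by (induction n) (auto intro: is_subringD[OF assms(1)])

definition adjoin :: "'k::field set \<Rightarrow> 'k \<Rightarrow> 'k set" where
  "adjoin A x = {poly p x | p. \<forall>i. coeff p i \<in> A}"

lemma is_subring_adjoin:
  assumes "is_subring A" shows "is_subring (adjoin A x)"
  unfolding is_subring_def
proof (intro conjI ballI)
  show "1 \<in> adjoin A x" unfolding adjoin_def
    by (rule CollectI, rule exI[of _ 1])
       (auto simp: coeff_1 intro: is_subringD[OF assms])
next
  fix u v assume "u \<in> adjoin A x" "v \<in> adjoin A x"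
  then obtain p q where p: "u = poly p x" "\<forall>i. coeff p i \<in> A" and q: "v = poly q x" "\<forall>i. coeff q i \<in> A"
    by (auto simp: adjoin_def)
  show "u - v \<in> adjoin A x" unfolding adjoin_def using p q
    by (intro CollectI exI[of _ "p - q"]) (auto intro: is_subringD[OF assms])
  show "u * v \<in> adjoin A x" unfolding adjoin_def using p q
    by (intro CollectI exI[of _ "p * q"])
       (auto simp: coeff_mult intro!: is_subring_sum[OF assms] is_subringD(6)[OF assms])
qed

lemma adjoin_supset: assumes "is_subring A" shows "A \<subseteq> adjoin A x" "x \<in> adjoin A x"
proof -
  show "A \<subseteq> adjoin A x"
  proof
    fix a assume "a \<in> A"
    then show "a \<in> adjoin A x" unfolding adjoin_def
      by (intro CollectI exI[of _ "[:a:]"]) (auto simp: coeff_pCons is_subringD[OF assms] split: nat.split)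
  qed
  show "x \<in> adjoin A x" unfolding adjoin_def
    by (intro CollectI exI[of _ "[:0,1:]"]) (auto simp: coeff_pCons is_subringD[OF assms] split: nat.split)
qed

definition localize_at :: "'k::field set \<Rightarrow> 'k \<Rightarrow> 'k set" where
  "localize_at A b = {c / b ^ l | c l. c \<in> A}"

lemma is_subring_localize:
  assumes A: "is_subring A" and b: "b \<in> A" "b \<noteq> 0" shows "is_subring (localize_at A b)"
  unfolding is_subring_def
proof (intro conjI ballI)
  show "1 \<in> localize_at A b" unfolding localize_at_def
    by (intro CollectI exI[of _ 1] exI[of _ 0]) (auto intro: is_subringD[OF A])
next
  fix u v assume "u \<in> localize_at A b" "v \<in> localize_at A b"
  then obtain c l d m where u: "u = c / b ^ l" "c \<in> A" and v: "v = d / b ^ m" "d \<in> A"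
    by (auto simp: localize_at_def)
  have "u - v = (c * b ^ m - d * b ^ l) / b ^ (l + m)" unfolding u(1) v(1) using b(2)
    by (simp add: field_simps power_add)
  moreover have "c * b ^ m - d * b ^ l \<in> A"
    using u v b by (auto intro!: is_subringD(5,6)[OF A] is_subring_power[OF A])
  ultimately show "u - v \<in> localize_at A b" unfolding localize_at_def by blast
  have "u * v = (c * d) / b ^ (l + m)" unfolding u(1) v(1) by (simp add: power_add)
  moreover have "c * d \<in> A" using u v by (auto intro!: is_subringD(6)[OF A])
  ultimately show "u * v \<in> localize_at A b" unfolding localize_at_def by blast
qed

lemma localize_supset: assumes A: "is_subring A" shows "A \<subseteq> localize_at A b" "1 / b \<in> localize_at A b"
proof -
  show "A \<subseteq> localize_at A b"
  proof
    fix a assume "a \<in> A"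
    then show "a \<in> localize_at A b" unfolding localize_at_def
      by (intro CollectI exI[of _ a] exI[of _ 0]) simp
  qed
  show "1 / b \<in> localize_at A b" unfolding localize_at_def
    by (intro CollectI exI[of _ 1] exI[of _ 1]) (simp add: is_subringD[OF A])
qed

text \<open>The field itself is allowed: this is the trivial valuation.\<close>

definition valuation_subring :: "'k::field set \<Rightarrow> bool" where
  "valuation_subring A \<longleftrightarrow> is_subring A \<and> (\<forall>x. x \<in> A \<or> 1 / x \<in> A)"

context
  fixes A :: "'k::field set" and \<pi> :: 'k
  assumes A: "is_subring A" and piA: "\<pi> \<in> A" and nu: "\<And>c. c \<in> A \<Longrightarrow> \<pi> * c \<noteq> 1"
    and mx: "\<And>B. is_subring B \<Longrightarrow> A \<subseteq> B \<Longrightarrow> (\<And>c. c \<in> B \<Longrightarrow> \<pi> * c \<noteq> 1) \<Longrightarrow> B = A"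
begin

text \<open>The next lemmas are Chevalley's argument that a subring that is maximal among those in which \<open>\<pi>\<close> is not
invertible is a valuation ring. An element \<open>u\<close> congruent to \<open>1\<close> modulo \<open>\<pi>\<close> has its inverse in \<open>A\<close>, because
all powers of \<open>u\<close> are congruent to \<open>1\<close>, so inverting \<open>u\<close> does not make \<open>\<pi>\<close> invertible.\<close>

lemma maximal_local:
  assumes "b \<in> A" shows "1 / (1 - \<pi> * b) \<in> A"
proof -
  define u where "u = 1 - \<pi> * b"
  have u0: "u \<noteq> 0" using nu[OF assms] by (auto simp: u_def)
  have uA: "u \<in> A" unfolding u_def by (intro is_subringD[OF A] piA assms)
  have pow: "\<exists>e\<in>A. u ^ l = 1 - \<pi> * e" for l
  proof (induction l)
    case 0 then show ?case by (intro bexI[of _ 0]) (auto intro: is_subringD[OF A])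
  next
    case (Suc l)
    then obtain e where e: "e \<in> A" "u ^ l = 1 - \<pi> * e" by blast
    have "u ^ Suc l = (1 - \<pi> * b) * (1 - \<pi> * e)" using e by (simp add: u_def)
    then have "u ^ Suc l = 1 - \<pi> * (b + e - \<pi> * (b * e))" by (simp add: algebra_simps)
    moreover have "b + e - \<pi> * (b * e) \<in> A" using e assms piA by (intro is_subringD[OF A]) auto
    ultimately show ?case by blast
  qed
  have "localize_at A u = A"
  proof (rule mx)
    show "is_subring (localize_at A u)" by (rule is_subring_localize[OF A uA u0])
    show "A \<subseteq> localize_at A u" by (rule localize_supset[OF A])
    fix c assume "c \<in> localize_at A u"
    then obtain d l where d: "d \<in> A" "c = d / u ^ l" by (auto simp: localize_at_def)
    obtain e where e: "e \<in> A" "u ^ l = 1 - \<pi> * e" using pow by blast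
    show "\<pi> * c \<noteq> 1"
    proof
      assume "\<pi> * c = 1"
      then have "\<pi> * d = u ^ l" using d u0 by (simp add: field_simps)
      then have "\<pi> * (d + e) = 1" using e by (simp add: algebra_simps)
      then show False using nu[of "d + e"] d e is_subringD(4)[OF A] by blast
    qed
  qed
  then show ?thesis using localize_supset(2)[OF A, of u] by (simp add: u_def)
qed

lemma maximal_adjoin:
  assumes "x \<notin> A" shows "\<exists>F. (\<forall>i. coeff F i \<in> A) \<and> \<pi> * poly F x = 1"
proof (rule ccontr)
  assume n: "\<not> ?thesis"
  have "adjoin A x = A"
    by (rule mx[OF is_subring_adjoin[OF A] adjoin_supset(1)[OF A]]) (use n in \<open>auto simp: adjoin_def\<close>)
  then show False using adjoin_supset(2)[OF A, of x] assms by simp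
qed

text \<open>Relations \<open>\<pi> F(x) = 1\<close> and \<open>\<pi> G(1/x) = 1\<close> cannot both have minimal degree: as \<open>1 - \<pi> G\<^sub>0\<close> is invertible, the
second one expresses \<open>1\<close>, hence \<open>x\<^sup>n\<close>, by lower powers of \<open>x\<close>, and substituting this for the leading term
of the first one lowers its degree.\<close>

lemma maximal_reduce:
  assumes F: "\<And>i. coeff F i \<in> A" "\<pi> * poly F x = 1"
    and Fmin: "\<And>H. (\<And>i. coeff H i \<in> A) \<Longrightarrow> \<pi> * poly H x = 1 \<Longrightarrow> degree F \<le> degree H"
    and G: "\<And>i. coeff G i \<in> A" "\<pi> * poly G (1 / x) = 1"
    and le: "degree G \<le> degree F" and x0: "x \<noteq> 0"
  shows False
proof -
  define n where "n = degree F"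
  define m where "m = degree G"
  define u where "u = 1 / (1 - \<pi> * coeff G 0)"
  have uA: "u \<in> A" unfolding u_def by (rule maximal_local[OF G(1)])
  have u1: "u * (1 - \<pi> * coeff G 0) = 1" unfolding u_def using nu[OF G(1)] by auto
  have n0: "n > 0"
  proof (rule ccontr)
    assume "\<not> n > 0"
    then have "degree F = 0" by (simp add: n_def)
    then have "poly F x = coeff F 0" by (simp add: poly_altdef)
    then show False using F nu[OF F(1)] by auto
  qed
  have "poly G (1 / x) = coeff G 0 + (\<Sum>j=1..m. coeff G j * (1 / x) ^ j)"
    unfolding poly_altdef m_def[symmetric] atMost_atLeast0 by (subst sum.atLeast_Suc_atMost) auto
  then have "1 - \<pi> * coeff G 0 = \<pi> * (\<Sum>j=1..m. coeff G j * (1 / x) ^ j)"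
    using G(2) by (simp add: algebra_simps)
  then have one: "1 = \<pi> * u * (\<Sum>j=1..m. coeff G j * (1 / x) ^ j)" using u1 by (simp add: mult.commute mult.left_commute mult.assoc)
  define R where "R = (\<Sum>j=1..m. monom (\<pi> * u * coeff G j * coeff F n) (n - j))"
  define H where "H = F - monom (coeff F n) n + R"
  have "poly R x = \<pi> * u * coeff F n * (\<Sum>j=1..m. coeff G j * x ^ (n - j))"
    unfolding R_def by (simp add: poly_sum poly_monom sum_distrib_left algebra_simps)
  also have "(\<Sum>j=1..m. coeff G j * x ^ (n - j)) = x ^ n * (\<Sum>j=1..m. coeff G j * (1 / x) ^ j)"
    unfolding sum_distrib_left
  proof (rule sum.cong)
    fix j assume "j \<in> {1..m}"
    then have "j \<le> n" using le by (auto simp: m_def n_def)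
    then show "coeff G j * x ^ (n - j) = x ^ n * (coeff G j * (1 / x) ^ j)"
      using x0 by (simp add: power_diff field_simps)
  qed simp
  also have "\<pi> * u * coeff F n * (x ^ n * (\<Sum>j=1..m. coeff G j * (1 / x) ^ j))
      = coeff F n * x ^ n * (\<pi> * u * (\<Sum>j=1..m. coeff G j * (1 / x) ^ j))" by (simp add: algebra_simps)
  also have "\<dots> = coeff F n * x ^ n" by (simp only: one[symmetric]) simp
  finally have "poly H x = poly F x" by (simp add: H_def poly_monom)
  moreover have cR: "coeff R i = (\<Sum>j=1..m. if n - j = i then \<pi> * u * coeff G j * coeff F n else 0)" for i
    by (simp add: R_def coeff_sum)
  have cRA: "coeff R i \<in> A" for i unfolding cR
    by (intro is_subring_sum[OF A]) (auto intro!: is_subringD(1,6)[OF A] uA piA G F)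
  have "coeff H i \<in> A" for i unfolding H_def
    using cRA[of i] F(1)[of i] by (auto simp: coeff_diff coeff_add intro!: is_subringD(1,4,5)[OF A])
  moreover have "coeff H i = 0" if "i \<ge> n" for i
  proof -
    have "coeff R i = 0" unfolding cR using that n0 by (intro sum.neutral) auto
    then show ?thesis using that by (cases "i = n") (auto simp: H_def n_def coeff_eq_0)
  qed
  then have "degree H \<le> n - 1" using n0 by (intro degree_le) auto
  then have "degree H < n" using n0 by simp
  ultimately show False using Fmin[of H] F(2) by (auto simp: n_def)
qed

lemma maximal_valuation: "valuation_subring A"
  unfolding valuation_subring_def
proof (intro conjI allI A)
  fix x
  show "x \<in> A \<or> 1 / x \<in> A"
  proof (rule ccontr)
    assume "\<not> ?thesis"
    then have x: "x \<notin> A" "1 / x \<notin> A" by auto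
    then have x0: "x \<noteq> 0" using is_subringD(1)[OF A] by auto
    define P where "P z F \<longleftrightarrow> (\<forall>i. coeff F i \<in> A) \<and> \<pi> * poly F z = 1" for z F
    have ex: "\<exists>F. P z F \<and> (\<forall>H. P z H \<longrightarrow> degree F \<le> degree H)" if z: "z \<notin> A" for z
    proof -
      obtain F where "P z F" using maximal_adjoin[OF z] P_def by auto
      then show ?thesis
        using arg_min_natI[of "P z" F degree] arg_min_nat_le[of "P z" _ degree] by blast
    qed
    obtain F where F: "P x F" "\<And>H. P x H \<Longrightarrow> degree F \<le> degree H" using ex[OF x(1)] by blast
    obtain G where G: "P (1 / x) G" "\<And>H. P (1 / x) H \<Longrightarrow> degree G \<le> degree H" using ex[OF x(2)] by blast
    show False
    proof (cases "degree G \<le> degree F")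
      case True
      then show False using maximal_reduce[of F x G] F G x0 unfolding P_def by blast
    next
      case False
      then show False using maximal_reduce[of G "1/x" F] F G x0 unfolding P_def by fastforce
    qed
  qed
qed

end

text \<open>Zorn's lemma provides the maximal subring.\<close>

lemma ex_valuation_subring:
  fixes A :: "'k::field set"
  assumes A: "is_subring A" and piA: "\<pi> \<in> A" and nu: "\<And>c. c \<in> A \<Longrightarrow> \<pi> * c \<noteq> 1"
  shows "\<exists>B. valuation_subring B \<and> A \<subseteq> B \<and> (\<forall>c\<in>B. \<pi> * c \<noteq> 1)"
proof -
  define \<A> where "\<A> = {B. is_subring B \<and> A \<subseteq> B \<and> (\<forall>c\<in>B. \<pi> * c \<noteq> 1)}"
  have "\<exists>M\<in>\<A>. \<forall>X\<in>\<A>. M \<subseteq> X \<longrightarrow> X = M"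
  proof (rule subset_Zorn)
    fix C assume C: "subset.chain \<A> C"
    show "\<exists>U\<in>\<A>. \<forall>X\<in>C. X \<subseteq> U"
    proof (cases "C = {}")
      case True
      have "A \<in> \<A>" using A nu by (auto simp: \<A>_def)
      then show ?thesis using True by blast
    next
      case False
      have sub: "X \<in> \<A>" if "X \<in> C" for X using C that by (auto simp: subset_chain_def)
      have "is_subring (\<Union>C)" unfolding is_subring_def
      proof (intro conjI ballI)
        show "1 \<in> \<Union>C" using False sub by (auto simp: \<A>_def is_subring_def)
        fix u v assume "u \<in> \<Union>C" "v \<in> \<Union>C"
        then obtain X Y where XY: "X \<in> C" "Y \<in> C" "u \<in> X" "v \<in> Y" by auto
        then have "X \<subseteq> Y \<or> Y \<subseteq> X" using C by (auto simp: subset_chain_def)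
        then obtain Z where Z: "Z \<in> C" "u \<in> Z" "v \<in> Z" using XY by blast
        then have "is_subring Z" using sub by (auto simp: \<A>_def)
        then have "u - v \<in> Z" "u * v \<in> Z" using Z by (auto intro: is_subringD)
        then show "u - v \<in> \<Union>C" "u * v \<in> \<Union>C" using Z by auto
      qed
      then have "\<Union>C \<in> \<A>" using False sub by (fastforce simp: \<A>_def)
      then show ?thesis by blast
    qed
  qed
  then obtain M where M: "M \<in> \<A>" "\<And>X. X \<in> \<A> \<Longrightarrow> M \<subseteq> X \<Longrightarrow> X = M" by blast
  have "valuation_subring M"
  proof (rule maximal_valuation[where \<pi> = \<pi>])
    show "is_subring M" "\<pi> \<in> M" "\<And>c. c \<in> M \<Longrightarrow> \<pi> * c \<noteq> 1" using M(1) piA by (auto simp: \<A>_def)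
    fix B assume "is_subring B" "M \<subseteq> B" "\<And>c. c \<in> B \<Longrightarrow> \<pi> * c \<noteq> 1"
    then have "B \<in> \<A>" using M(1) by (auto simp: \<A>_def)
    then show "B = M" using M(2) \<open>M \<subseteq> B\<close> by blast
  qed
  then show ?thesis using M(1) by (auto simp: \<A>_def)
qed

text \<open>Valuation rings are integrally closed: if \<open>y\<close> were not in \<open>A\<close>, then \<open>1 / y\<close> would be, and dividing the
equation by \<open>y\<^sup>n\<^sup>-\<^sup>1\<close> expresses \<open>y\<close> by powers of \<open>1 / y\<close>.\<close>

lemma valuation_subring_root:
  assumes V: "valuation_subring A" and P: "\<And>i. coeff P i \<in> A" "P \<noteq> 0" "1 / lead_coeff P \<in> A" "poly P y = 0"
  shows "y \<in> A"
proof (rule ccontr)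
  assume y: "y \<notin> A"
  have A: "is_subring A" using V by (simp add: valuation_subring_def)
  have yi: "1 / y \<in> A" using V y by (auto simp: valuation_subring_def)
  have y0: "y \<noteq> 0" using y is_subringD(1)[OF A] by auto
  define n where "n = degree P"
  have n0: "n \<noteq> 0"
  proof
    assume "n = 0"
    then have "poly P y = lead_coeff P" by (simp add: poly_altdef n_def)
    then show False using P by simp
  qed
  have "0 = (\<Sum>i<n. coeff P i * y ^ i) + lead_coeff P * y ^ n"
    using P(4) by (simp add: poly_altdef n_def lessThan_Suc_atMost[symmetric])
  then have "lead_coeff P * y ^ n = - (\<Sum>i<n. coeff P i * y ^ i)" by (simp add: eq_neg_iff_add_eq_0 add.commute)
  then have "lead_coeff P * y ^ n * (1 / y) ^ (n - 1) = - (\<Sum>i<n. coeff P i * y ^ i * (1 / y) ^ (n - 1))"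
    by (simp add: sum_distrib_right)
  also have "lead_coeff P * y ^ n * (1 / y) ^ (n - 1) = lead_coeff P * y"
    using n0 y0 by (cases n) (simp_all add: field_simps)
  also have "(\<Sum>i<n. coeff P i * y ^ i * (1 / y) ^ (n - 1)) = (\<Sum>i<n. coeff P i * (1 / y) ^ (n - 1 - i))"
  proof (rule sum.cong)
    fix i assume "i \<in> {..<n}"
    then have "(1 / y) ^ (n - 1) = (1 / y) ^ (n - 1 - i) * (1 / y) ^ i" by (simp flip: power_add)
    then show "coeff P i * y ^ i * (1 / y) ^ (n - 1) = coeff P i * (1 / y) ^ (n - 1 - i)"
      using y0 by (simp add: field_simps)
  qed simp
  finally have "y = (1 / lead_coeff P) * (- (\<Sum>i<n. coeff P i * (1 / y) ^ (n - 1 - i)))"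
    using P(2) by (simp add: field_simps)
  also have "\<dots> \<in> A"
    by (intro is_subringD(3,6)[OF A] P(3) is_subring_sum[OF A] is_subring_power[OF A] P(1) yi)
  finally show False using y by simp
qed

text \<open>After inverting a single nonzero element, all but finitely many primes are still not invertible. The
condition \<open>b\<^sup>l = p c\<close> with \<open>c \<in> A\<close> says that \<open>p\<close> is invertible in \<open>A[1/b]\<close>.\<close>

definition few_inverted :: "'k::field set \<Rightarrow> bool" where
  "few_inverted A \<longleftrightarrow> (\<forall>b\<in>A. b \<noteq> 0 \<longrightarrow> finite {p::nat. prime p \<and> (\<exists>l. \<exists>c\<in>A. b ^ l = of_nat p * c)})"

lemma few_inverted_int:
  assumes "CHAR('k::field) = 0" shows "few_inverted (range of_int :: 'k set)"
  unfolding few_inverted_def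
proof (intro ballI impI)
  fix b :: 'k assume "b \<in> range of_int" "b \<noteq> 0"
  then obtain i where i: "b = of_int i" "i \<noteq> 0" by (metis imageE of_int_0)
  have inj: "u = v" if "(of_int u :: 'k) = of_int v" for u v
  proof -
    have "(of_int (u - v) :: 'k) = 0" using that by simp
    then show ?thesis using assms by (simp add: of_int_eq_0_iff_char_dvd del: of_int_diff)
  qed
  have "{p::nat. prime p \<and> (\<exists>l. \<exists>c\<in>range of_int. b ^ l = of_nat p * c)} \<subseteq> {p. p dvd nat \<bar>i\<bar>}"
  proof safe
    fix p l and x :: int assume p: "prime (p::nat)" and e: "b ^ l = of_nat p * of_int x"
    then have "(of_int (i ^ l) :: 'k) = of_int (int p * x)" by (simp add: i)
    then have "i ^ l = int p * x" by (rule inj)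
    then have "int p dvd i ^ l" by simp
    then have "int p dvd i" using p by (intro prime_dvd_power_int[of "int p" i l]) auto
    then show "p dvd nat \<bar>i\<bar>" by (simp add: nat_abs_dvd_iff[symmetric] dvd_nat_abs_iff)
  qed
  moreover have "finite {p. p dvd nat \<bar>i\<bar>}" using i by (intro finite_divisors_nat) auto
  ultimately show "finite {p::nat. prime p \<and> (\<exists>l. \<exists>c\<in>range of_int. b ^ l = of_nat p * c)}"
    by (rule finite_subset)
qed

text \<open>For transcendental \<open>x\<close> a relation \<open>b\<^sup>l = p c\<close> is an identity of polynomials, and comparing the coefficients
of highest degree gives such a relation for the leading coefficient of \<open>b\<close>.\<close>

lemma few_inverted_adjoin:
  assumes A: "is_subring A" and f: "few_inverted A"
    and tr: "\<And>P. (\<And>i. coeff P i \<in> A) \<Longrightarrow> poly P x = 0 \<Longrightarrow> P = 0"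
  shows "few_inverted (adjoin A x)"
  unfolding few_inverted_def
proof (intro ballI impI)
  fix b assume "b \<in> adjoin A x" "b \<noteq> 0"
  then obtain B where B: "b = poly B x" "\<And>i. coeff B i \<in> A" by (auto simp: adjoin_def)
  with \<open>b \<noteq> 0\<close> have B0: "lead_coeff B \<noteq> 0" by auto
  have "{p::nat. prime p \<and> (\<exists>l. \<exists>c\<in>adjoin A x. b ^ l = of_nat p * c)}
    \<subseteq> {p::nat. prime p \<and> (\<exists>l. \<exists>c\<in>A. lead_coeff B ^ l = of_nat p * c)}"
  proof safe
    fix p l c assume "c \<in> adjoin A x" and e: "b ^ l = of_nat p * c"
    then obtain C where C: "c = poly C x" "\<And>i. coeff C i \<in> A" by (auto simp: adjoin_def)
    have BlA: "coeff (B ^ l) i \<in> A" for i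
    proof (induction l arbitrary: i)
      case 0 then show ?case by (auto simp: coeff_1 is_subringD[OF A])
    next
      case (Suc l) then show ?case
        by (auto simp: coeff_mult intro!: is_subring_sum[OF A] is_subringD(6)[OF A] B)
    qed
    have "B ^ l - smult (of_nat p) C = 0"
      by (rule tr) (use BlA e B C in \<open>auto intro!: is_subringD(5,6)[OF A] is_subring_of_nat[OF A]\<close>)
    then have "coeff (B ^ l) (degree (B ^ l)) = coeff (smult (of_nat p) C) (degree (B ^ l))" by simp
    then have "lead_coeff B ^ l = of_nat p * coeff C (degree (B ^ l))" by (simp add: lead_coeff_power)
    then show "\<exists>l. \<exists>c\<in>A. lead_coeff B ^ l = of_nat p * c" using C by blast
  qed
  moreover have "finite {p::nat. prime p \<and> (\<exists>l. \<exists>c\<in>A. lead_coeff B ^ l = of_nat p * c)}"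
    using f B0 B(2) by (auto simp: few_inverted_def)
  ultimately show "finite {p::nat. prime p \<and> (\<exists>l. \<exists>c\<in>adjoin A x. b ^ l = of_nat p * c)}"
    by (rule finite_subset)
qed

text \<open>Adjoin to the integers a largest possible subset \<open>T\<close> of \<open>F\<close> such that all but finitely many primes survive
as above. The elements of \<open>F\<close> are then algebraic over the resulting ring \<open>A\<close>. Invert the leading
coefficients of their equations, and let \<open>p\<close> be a prime that stays non-invertible. A valuation ring that
contains this ring and in which \<open>p\<close> is not invertible contains \<open>F\<close>, since it is integrally closed.\<close>

lemma ex_valuation_subring_char_0:
  fixes F :: "'k::field set"
  assumes "finite F" and char: "CHAR('k) = 0"
  shows "\<exists>(p::nat) B. prime p \<and> valuation_subring B \<and> F \<subseteq> B \<and> (\<forall>c\<in>B. of_nat p * c \<noteq> 1)"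
proof -
  define good where "good T A \<longleftrightarrow> T \<subseteq> F \<and> is_subring A \<and> T \<subseteq> A \<and> few_inverted A" for T A
  have "is_subring (range of_int :: 'k set)" unfolding is_subring_def
  proof (intro conjI ballI)
    show "1 \<in> (range of_int :: 'k set)" using of_int_1 by (metis rangeI)
    fix x y :: 'k assume "x \<in> range of_int" "y \<in> range of_int"
    then obtain i j where "x = of_int i" "y = of_int j" by blast
    then show "x - y \<in> range of_int" "x * y \<in> range of_int"
      by (simp_all flip: of_int_diff of_int_mult)
  qed
  then have "good {} (range of_int)" using few_inverted_int[OF char] by (auto simp: good_def)
  then have ex: "\<exists>T. \<exists>A. good T A" by blast
  have bd: "\<forall>T. (\<exists>A. good T A) \<longrightarrow> card T < Suc (card F)"
    using assms(1) by (auto simp: good_def less_Suc_eq_le card_mono)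
  obtain T0 where "\<exists>A. good T0 A" using ex by blast
  from ex_has_greatest_nat[of "\<lambda>T. \<exists>A. good T A", OF this bd]
  obtain T where T: "\<exists>A. good T A" "\<And>T'. \<exists>A. good T' A \<Longrightarrow> card T' \<le> card T" by blast
  then obtain A where A: "is_subring A" "T \<subseteq> A" "few_inverted A" "T \<subseteq> F" by (auto simp: good_def)
  have "\<exists>P. P \<noteq> 0 \<and> (\<forall>i. coeff P i \<in> A) \<and> poly P y = 0" if y: "y \<in> F" for y
  proof (cases "y \<in> T")
    case True
    then show ?thesis using A
      by (intro exI[of _ "[:- y, 1:]"]) (auto simp: coeff_pCons is_subringD[OF A(1)] split: nat.split)
  next
    case False
    show ?thesis
    proof (rule ccontr)
      assume "\<not> ?thesis"
      then have "few_inverted (adjoin A y)" by (intro few_inverted_adjoin A) blast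
      then have "good (insert y T) (adjoin A y)"
        using A y adjoin_supset[OF A(1), of y] is_subring_adjoin[OF A(1)] by (auto simp: good_def)
      then have "card (insert y T) \<le> card T" using T(2) by blast
      then show False using False finite_subset[OF A(4) assms(1)] by simp
    qed
  qed
  then obtain P where P: "\<And>y. y \<in> F \<Longrightarrow> P y \<noteq> 0 \<and> (\<forall>i. coeff (P y) i \<in> A) \<and> poly (P y) y = 0" by metis
  define a where "a = (\<Prod>y\<in>F. lead_coeff (P y))"
  have a: "a \<in> A" "a \<noteq> 0" using P assms(1) by (auto simp: a_def intro!: is_subring_prod[OF A(1)])
  then have "finite {p::nat. prime p \<and> (\<exists>l. \<exists>c\<in>A. a ^ l = of_nat p * c)}"
    using A(3) by (simp add: few_inverted_def)
  then have "{p::nat. prime p} \<noteq> {p. prime p \<and> (\<exists>l. \<exists>c\<in>A. a ^ l = of_nat p * c)}"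
    using primes_infinite by metis
  then obtain p :: nat where p: "prime p" "\<And>l c. c \<in> A \<Longrightarrow> a ^ l \<noteq> of_nat p * c" by blast
  define A' where "A' = localize_at A a"
  have A': "is_subring A'" "A \<subseteq> A'" "1 / a \<in> A'"
    using is_subring_localize[OF A(1) a] localize_supset[OF A(1)] by (auto simp: A'_def)
  have "\<exists>B. valuation_subring B \<and> A' \<subseteq> B \<and> (\<forall>c\<in>B. of_nat p * c \<noteq> 1)"
  proof (rule ex_valuation_subring[OF A'(1) is_subring_of_nat[OF A'(1)]])
    fix c assume "c \<in> A'"
    then obtain d l where d: "d \<in> A" "c = d / a ^ l" by (auto simp: A'_def localize_at_def)
    show "of_nat p * c \<noteq> 1" using p(2)[OF d(1), of l] a d(2) by (auto simp: field_simps)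
  qed
  then obtain B where B: "valuation_subring B" "A' \<subseteq> B" "\<forall>c\<in>B. of_nat p * c \<noteq> 1" by blast
  have sB: "is_subring B" using B(1) by (simp add: valuation_subring_def)
  have "F \<subseteq> B"
  proof
    fix y assume y: "y \<in> F"
    have "a = lead_coeff (P y) * (\<Prod>y\<in>F - {y}. lead_coeff (P y))" unfolding a_def
      by (rule prod.remove[OF assms(1) y])
    then have "1 / lead_coeff (P y) = (1 / a) * (\<Prod>y\<in>F - {y}. lead_coeff (P y))" using a(2) by auto
    also have "\<dots> \<in> B"
      using A' B(2) P by (intro is_subringD(6)[OF sB] is_subring_prod[OF sB]) auto
    finally have inv: "1 / lead_coeff (P y) \<in> B" .
    show "y \<in> B"
    proof (rule valuation_subring_root[OF B(1) _ _ inv])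
      show "coeff (P y) i \<in> B" for i using P[OF y] A'(2) B(2) by blast
    qed (use P[OF y] in auto)
  qed
  then show ?thesis using p B by blast
qed

text \<open>In positive characteristic \<open>p\<close> the whole field will do, since \<open>p = 0\<close> is not invertible in it.\<close>

lemma ex_valuation_subring_prime:
  fixes F :: "'k::field set"
  assumes "finite F"
  shows "\<exists>(p::nat) B. prime p \<and> valuation_subring B \<and> F \<subseteq> B \<and> (\<forall>c\<in>B. of_nat p * c \<noteq> 1)"
proof (cases "CHAR('k) = 0")
  case True
  then show ?thesis using ex_valuation_subring_char_0[OF assms] by blast
next
  case False
  then have "prime CHAR('k)" by (intro prime_CHAR_semidom) auto
  then show ?thesis
    by (intro exI[of _ "CHAR('k)"] exI[of _ UNIV]) (auto simp: valuation_subring_def is_subring_def)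
qed

section \<open>Frobenius modulo a prime\<close>

definition prime_multiples :: "'r::comm_ring_1 set \<Rightarrow> nat \<Rightarrow> 'r set" where
  "prime_multiples A p = {of_nat p * c | c. c \<in> A}"

definition cong_in :: "'r::comm_ring_1 set \<Rightarrow> nat \<Rightarrow> 'r \<Rightarrow> 'r \<Rightarrow> bool" where
  "cong_in A p a b \<longleftrightarrow> a - b \<in> prime_multiples A p"

context
  fixes A :: "'r::comm_ring_1 set" and p :: nat
  assumes A: "is_subring A"
begin

lemma prime_multiples_add:
  "a \<in> prime_multiples A p \<Longrightarrow> b \<in> prime_multiples A p \<Longrightarrow> a + b \<in> prime_multiples A p"
proof -
  assume "a \<in> prime_multiples A p" "b \<in> prime_multiples A p"
  then obtain c d where "a = of_nat p * c" "b = of_nat p * d" "c \<in> A" "d \<in> A" by (auto simp: prime_multiples_def)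
  then have "a + b = of_nat p * (c + d)" "c + d \<in> A" using is_subringD(4)[OF A] by (auto simp: distrib_left)
  then show ?thesis unfolding prime_multiples_def by blast
qed

lemma prime_multiples_mult: "a \<in> A \<Longrightarrow> b \<in> prime_multiples A p \<Longrightarrow> a * b \<in> prime_multiples A p"
proof -
  assume a: "a \<in> A" and "b \<in> prime_multiples A p"
  then obtain d where d: "b = of_nat p * d" "d \<in> A" by (auto simp: prime_multiples_def)
  then have "a * b = of_nat p * (a * d)" "a * d \<in> A" using is_subringD(6)[OF A] a by (auto simp: algebra_simps)
  then show ?thesis unfolding prime_multiples_def by blast
qed

lemma prime_multiples_0: "0 \<in> prime_multiples A p"
  unfolding prime_multiples_def using is_subringD(1)[OF A] by (auto intro!: exI[of _ 0])

lemma prime_multiples_sum: "(\<And>i. i \<in> I \<Longrightarrow> f i \<in> prime_multiples A p) \<Longrightarrow> sum f I \<in> prime_multiples A p"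
  by (induction I rule: infinite_finite_induct) (auto simp: prime_multiples_0 prime_multiples_add)

lemma prime_multiples_prod:
  assumes "finite I" "\<And>i. i \<in> I \<Longrightarrow> f i \<in> A" "j \<in> I" "f j \<in> prime_multiples A p"
  shows "prod f I \<in> prime_multiples A p"
proof -
  have "prod f I = prod f (I - {j}) * f j" using prod.remove[OF assms(1,3), of f] by (simp add: mult.commute)
  also have "\<dots> \<in> prime_multiples A p"
    by (intro prime_multiples_mult is_subring_prod[OF A] assms(4)) (use assms(2) in auto)
  finally show ?thesis .
qed

lemma cong_in_refl: "cong_in A p a a"
  by (simp add: cong_in_def prime_multiples_0)

lemma cong_in_sym: "cong_in A p a b \<Longrightarrow> cong_in A p b a"
proof -
  assume "cong_in A p a b"
  then have "(- 1) * (a - b) \<in> prime_multiples A p"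
    unfolding cong_in_def by (intro prime_multiples_mult is_subringD(2,3)[OF A])
  then show ?thesis by (simp add: cong_in_def)
qed

lemma cong_in_trans: "cong_in A p a b \<Longrightarrow> cong_in A p b c \<Longrightarrow> cong_in A p a c"
  unfolding cong_in_def using prime_multiples_add[of "a - b" "b - c"] by simp

lemma cong_in_add: "cong_in A p a b \<Longrightarrow> cong_in A p c d \<Longrightarrow> cong_in A p (a + c) (b + d)"
  unfolding cong_in_def using prime_multiples_add[of "a - b" "c - d"] by (simp add: algebra_simps)

lemma cong_in_mult:
  assumes "cong_in A p a b" "cong_in A p c d" "b \<in> A" "c \<in> A" shows "cong_in A p (a * c) (b * d)"
proof -
  have "c * (a - b) + b * (c - d) \<in> prime_multiples A p"
    using assms unfolding cong_in_def by (intro prime_multiples_add prime_multiples_mult)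
  then show ?thesis by (simp add: cong_in_def algebra_simps)
qed

lemma cong_in_sum: "(\<And>i. i \<in> I \<Longrightarrow> cong_in A p (f i) (g i)) \<Longrightarrow> cong_in A p (sum f I) (sum g I)"
  by (induction I rule: infinite_finite_induct) (auto simp: cong_in_refl cong_in_add)

lemma cong_in_prod:
  assumes "\<And>i. i \<in> I \<Longrightarrow> cong_in A p (f i) (g i)" "\<And>i. i \<in> I \<Longrightarrow> f i \<in> A" "\<And>i. i \<in> I \<Longrightarrow> g i \<in> A"
  shows "cong_in A p (prod f I) (prod g I)"
  using assms
  by (induction I rule: infinite_finite_induct) (auto simp: cong_in_refl intro!: cong_in_mult is_subring_prod[OF A])

lemma cong_in_power:
  assumes "cong_in A p a b" "a \<in> A" "b \<in> A" shows "cong_in A p (a ^ n) (b ^ n)"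
  using assms by (induction n) (auto simp: cong_in_refl intro!: cong_in_mult is_subring_power[OF A])

text \<open>The Frobenius map is additive modulo \<open>p\<close>: the inner binomial coefficients are divisible by \<open>p\<close>.\<close>

lemma cong_in_add_power_prime:
  assumes p: "prime p" and u: "u \<in> A" "v \<in> A"
  shows "cong_in A p ((u + v) ^ p) (u ^ p + v ^ p)"
proof -
  have p0: "p > 0" using p prime_gt_0_nat by blast
  have "(u + v) ^ p = (\<Sum>k\<le>p. of_nat (p choose k) * u ^ k * v ^ (p - k))" by (rule binomial_ring)
  also have "\<dots> = (\<Sum>k\<in>{0, p}. of_nat (p choose k) * u ^ k * v ^ (p - k))
      + (\<Sum>k\<in>{..p} - {0, p}. of_nat (p choose k) * u ^ k * v ^ (p - k))"
    by (subst add.commute, rule sum.subset_diff) auto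
  also have "(\<Sum>k\<in>{0, p}. of_nat (p choose k) * u ^ k * v ^ (p - k)) = u ^ p + v ^ p"
    using p0 by (simp add: add.commute)
  finally have "(u + v) ^ p - (u ^ p + v ^ p) = (\<Sum>k\<in>{..p} - {0, p}. of_nat (p choose k) * u ^ k * v ^ (p - k))"
    by simp
  moreover have "(\<Sum>k\<in>{..p} - {0, p}. of_nat (p choose k) * u ^ k * v ^ (p - k)) \<in> prime_multiples A p"
  proof (rule prime_multiples_sum)
    fix k assume "k \<in> {..p} - {0, p}"
    then have "p dvd p choose k" by (intro dvd_choose_prime p) auto
    then obtain m where m: "p choose k = p * m" by blast
    have "of_nat (p choose k) * u ^ k * v ^ (p - k) = of_nat p * (of_nat m * u ^ k * v ^ (p - k))"
      by (simp add: m mult.assoc)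
    moreover have "of_nat m * u ^ k * v ^ (p - k) \<in> A"
      by (intro is_subringD(6)[OF A] is_subring_of_nat[OF A] is_subring_power[OF A] u)
    ultimately show "of_nat (p choose k) * u ^ k * v ^ (p - k) \<in> prime_multiples A p"
      unfolding prime_multiples_def by blast
  qed
  ultimately show ?thesis by (simp add: cong_in_def)
qed

lemma cong_in_add_power:
  assumes p: "prime p" and u: "u \<in> A" "v \<in> A"
  shows "cong_in A p ((u + v) ^ (p ^ e)) (u ^ (p ^ e) + v ^ (p ^ e))"
proof (induction e)
  case 0
  then show ?case by (simp add: cong_in_refl)
next
  case (Suc e)
  have uv: "u ^ (p ^ e) \<in> A" "v ^ (p ^ e) \<in> A" "u + v \<in> A" by (intro is_subring_power[OF A] is_subringD(4)[OF A] u)+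
  have "cong_in A p (((u + v) ^ (p ^ e)) ^ p) ((u ^ (p ^ e) + v ^ (p ^ e)) ^ p)"
    by (intro cong_in_power Suc is_subring_power[OF A] is_subringD(4)[OF A] uv u)
  from cong_in_trans[OF this cong_in_add_power_prime[OF p uv(1,2)]]
  show ?case by (simp add: power_mult[symmetric] mult.commute)
qed

lemma cong_in_sum_power:
  assumes p: "prime p" and f: "\<And>i. i \<in> I \<Longrightarrow> f i \<in> A" "finite I"
  shows "cong_in A p ((\<Sum>i\<in>I. f i) ^ (p ^ e)) (\<Sum>i\<in>I. f i ^ (p ^ e))"
  using f(2,1)
proof (induction I rule: finite_induct)
  case empty
  have "p ^ e > 0" using p prime_gt_0_nat by simp
  then have "(0::'r) ^ (p ^ e) = 0" by (rule zero_power)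
  then show ?case by (simp add: cong_in_refl)
next
  case (insert i I)
  have c1: "cong_in A p ((f i + sum f I) ^ (p ^ e)) (f i ^ (p ^ e) + sum f I ^ (p ^ e))"
    using insert by (intro cong_in_add_power p is_subring_sum[OF A]) auto
  have c2: "cong_in A p (f i ^ (p ^ e) + sum f I ^ (p ^ e)) (f i ^ (p ^ e) + (\<Sum>i\<in>I. f i ^ (p ^ e)))"
    using insert by (intro cong_in_add cong_in_refl) auto
  show ?case using cong_in_trans[OF c1 c2] insert(1,2) by simp
qed

text \<open>A number \<open>n\<close> is a sum of \<open>n\<close> ones.\<close>

lemma cong_in_of_nat_power:
  assumes p: "prime p" shows "cong_in A p (of_nat n ^ (p ^ e)) (of_nat n)"
  using cong_in_sum_power[OF p, of "{..<n}" "\<lambda>_. 1" e] is_subringD(2)[OF A] by simp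

text \<open>Additivity applied to \<open>z + (- z) = 0\<close> treats \<open>p = 2\<close> and odd primes alike.\<close>

lemma cong_in_minus_power:
  assumes p: "prime p" and z: "z \<in> A" shows "cong_in A p ((- z) ^ (p ^ e)) (- (z ^ (p ^ e)))"
proof -
  have "p ^ e > 0" using p prime_gt_0_nat by simp
  then have "(0::'r) ^ (p ^ e) = 0" by (rule zero_power)
  moreover have "cong_in A p ((z + - z) ^ (p ^ e)) (z ^ (p ^ e) + (- z) ^ (p ^ e))"
    by (intro cong_in_add_power p z is_subringD(3)[OF A])
  ultimately have "cong_in A p 0 (z ^ (p ^ e) + (- z) ^ (p ^ e))" by simp
  from cong_in_sym[OF this] show ?thesis by (simp add: cong_in_def algebra_simps)
qed

end

lemma is_subring_coeffs:
  assumes A: "is_subring A" shows "is_subring {P :: 'k::field poly. \<forall>i. coeff P i \<in> A}"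
  unfolding is_subring_def
  by (auto simp: coeff_1 coeff_mult intro!: is_subringD[OF A] is_subring_sum[OF A] is_subringD(6)[OF A])

text \<open>The value at \<open>w\<close> of the Hasse derivative of order \<open>a\<close> of the polynomial
  \<open>\<Sum>\<^sub>\<mu> P\<^sub>q\<^sub>\<mu>\<^sub>+\<^sub>\<nu> X\<^sup>\<mu>\<close> formed by the coefficients of \<open>P\<close> in the residue class of \<open>\<nu>\<close> modulo \<open>q\<close>.\<close>

definition section_deriv :: "nat \<Rightarrow> nat \<Rightarrow> nat \<Rightarrow> 'k::field \<Rightarrow> nat \<Rightarrow> 'k poly \<Rightarrow> 'k" where
  "section_deriv q \<nu> K w a P = (\<Sum>\<mu>\<le>K. coeff P (q * \<mu> + \<nu>) * (of_nat (\<mu> choose a) * w ^ (\<mu> - a)))"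

text \<open>The coefficients of \<open>(X\<^sup>q - w) V\<close> in a residue class modulo \<open>q\<close> are those of \<open>X - w\<close> times the section of
\<open>V\<close>, and multiplication by \<open>X - w\<close> shifts Taylor coefficients at \<open>w\<close> by one. The bound \<open>K\<close> on the degree
ensures that no coefficient is lost by truncating the sum.\<close>

lemma section_deriv_step:
  assumes q: "q > 0" and \<nu>: "\<nu> < q" and K: "degree ((monom 1 q - [:w:]) * V) \<le> K"
  shows "section_deriv q \<nu> K w 0 ((monom 1 q - [:w:]) * V) = 0"
    "section_deriv q \<nu> K w (Suc a) ((monom 1 q - [:w:]) * V) = section_deriv q \<nu> K w a V"
proof -
  define v where "v \<mu> = coeff V (q * \<mu> + \<nu>)" for \<mu>
  have vK: "v K = 0"
  proof (cases "V = 0")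
    case False
    have dq: "degree (monom 1 q - [:w:]) = q"
    proof (rule antisym)
      show "degree (monom 1 q - [:w:]) \<le> q" by (intro degree_diff_le) (auto simp: degree_monom_le)
      show "q \<le> degree (monom 1 q - [:w:])" using q by (intro le_degree) (auto simp: coeff_pCons split: nat.split)
    qed
    then have "monom 1 q - [:w:] \<noteq> 0" using q by auto
    then have "degree ((monom 1 q - [:w:]) * V) = q + degree V" using False dq by (simp add: degree_mult_eq)
    then have "degree V < K" using K q by linarith
    moreover have "K \<le> q * K + \<nu>" using q by (cases q) auto
    ultimately show ?thesis unfolding v_def by (intro coeff_eq_0) simp
  qed (simp add: v_def)
  have c: "coeff ((monom 1 q - [:w:]) * V) (q * \<mu> + \<nu>) = (if \<mu> = 0 then 0 else v (\<mu> - 1)) - w * v \<mu>" for \<mu>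
  proof (cases \<mu>)
    case 0
    then show ?thesis using \<nu> by (simp add: left_diff_distrib coeff_monom_mult v_def)
  next
    case (Suc m)
    then have "q * \<mu> + \<nu> - q = q * m + \<nu>" by simp
    then show ?thesis using Suc by (simp add: left_diff_distrib coeff_monom_mult v_def)
  qed
  have main: "section_deriv q \<nu> K w b ((monom 1 q - [:w:]) * V) =
      (\<Sum>\<mu>\<le>K. v \<mu> * (of_nat (Suc \<mu> choose b) * w ^ (Suc \<mu> - b) - w * (of_nat (\<mu> choose b) * w ^ (\<mu> - b))))" for b
  proof -
    let ?g = "\<lambda>\<mu>. of_nat (\<mu> choose b) * w ^ (\<mu> - b)"
    have "section_deriv q \<nu> K w b ((monom 1 q - [:w:]) * V)
        = (\<Sum>\<mu>\<le>K. (if \<mu> = 0 then 0 else v (\<mu> - 1)) * ?g \<mu>) - (\<Sum>\<mu>\<le>K. v \<mu> * (w * ?g \<mu>))"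
      unfolding section_deriv_def c sum_subtractf[symmetric]
      by (intro sum.cong refl) (simp only: left_diff_distrib mult.assoc mult.left_commute[of w])
    also have "(\<Sum>\<mu>\<le>K. (if \<mu> = 0 then 0 else v (\<mu> - 1)) * ?g \<mu>) = (\<Sum>\<mu><K. v \<mu> * ?g (Suc \<mu>))"
      by (simp add: sum.atMost_shift del: binomial_Suc_Suc)
    also have "\<dots> = (\<Sum>\<mu>\<le>K. v \<mu> * ?g (Suc \<mu>))" using vK by (simp add: lessThan_Suc_atMost[symmetric] del: binomial_Suc_Suc)
    finally show ?thesis by (simp add: sum_subtractf right_diff_distrib del: binomial_Suc_Suc)
  qed
  show "section_deriv q \<nu> K w 0 ((monom 1 q - [:w:]) * V) = 0" unfolding main by simp
  show "section_deriv q \<nu> K w (Suc a) ((monom 1 q - [:w:]) * V) = section_deriv q \<nu> K w a V"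
    unfolding main unfolding section_deriv_def
  proof (intro sum.cong refl)
    fix \<mu>
    have "of_nat (Suc \<mu> choose Suc a) * w ^ (Suc \<mu> - Suc a) - w * (of_nat (\<mu> choose Suc a) * w ^ (\<mu> - Suc a))
        = of_nat (\<mu> choose a) * w ^ (\<mu> - a)"
    proof (cases "\<mu> < Suc a")
      case True
      then show ?thesis by (simp add: binomial_eq_0)
    next
      case False
      then have "w * w ^ (\<mu> - Suc a) = w ^ (\<mu> - a)" by (metis Suc_diff_Suc not_less_eq power_Suc linorder_neqE_nat less_SucI)
      then show ?thesis by (simp add: distrib_right mult.left_commute)
    qed
    then show "v \<mu> * (of_nat (Suc \<mu> choose Suc a) * w ^ (Suc \<mu> - Suc a) - w * (of_nat (\<mu> choose Suc a) * w ^ (\<mu> - Suc a)))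
      = coeff V (q * \<mu> + \<nu>) * (of_nat (\<mu> choose a) * w ^ (\<mu> - a))" by (simp only: v_def)
  qed
qed

lemma section_deriv_power:
  assumes q: "q > 0" and \<nu>: "\<nu> < q" and K: "degree ((monom 1 q - [:w:]) ^ Suc a * V) \<le> K"
  shows "section_deriv q \<nu> K w a ((monom 1 q - [:w:]) ^ Suc a * V) = 0"
  using K
proof (induction a)
  case 0
  then show ?case using section_deriv_step(1)[OF q \<nu>, of w V K] by simp
next
  case (Suc a)
  let ?P = "monom 1 q - [:w:]"
  have e: "?P ^ Suc (Suc a) * V = ?P * (?P ^ Suc a * V)" by (simp add: mult.assoc)
  have "degree (?P ^ Suc a * V) \<le> K"
  proof (cases "?P ^ Suc a * V = 0")
    case False
    have "?P \<noteq> 0"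
    proof
      assume "?P = 0"
      then have "coeff ?P q = 0" by simp
      then show False using q by (auto simp: coeff_pCons split: nat.splits)
    qed
    then have "degree (?P ^ Suc (Suc a) * V) = degree ?P + degree (?P ^ Suc a * V)"
      unfolding e using False by (rule degree_mult_eq)
    then show ?thesis using Suc.prems by simp
  next
    case True then show ?thesis by (metis degree_0 le0)
  qed
  then show ?case using section_deriv_step(2)[OF q \<nu>, of w "?P ^ Suc a * V" K a] Suc.prems Suc.IH unfolding e by simp
qed

text \<open>The one-dimensional heart of the Frobenius argument: for \<open>n \<ge> q (a + 1)\<close> the polynomial \<open>(X - z)\<^sup>n\<close> is
congruent modulo \<open>p\<close> to a multiple of \<open>(X\<^sup>q - z\<^sup>q)\<^sup>a\<^sup>+\<^sup>1\<close>, so the sections of \<open>(X - z)\<^sup>n\<close> vanish modulo \<open>p\<close> to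
order \<open>a + 1\<close> at \<open>z\<^sup>q\<close>.\<close>

lemma section_deriv_linear_power:
  fixes A :: "'k::field set"
  assumes A: "is_subring A" and p: "prime p" and z: "z \<in> A" and q: "q = p ^ e" and \<nu>: "\<nu> < q"
    and n: "n \<ge> q * Suc a" and K: "n \<le> K"
  shows "(\<Sum>\<mu>\<le>K. of_nat (n choose (q * \<mu> + \<nu>)) * (- z) ^ (n - (q * \<mu> + \<nu>)) *
      (of_nat (\<mu> choose a) * (z ^ q) ^ (\<mu> - a))) \<in> prime_multiples A p"
proof -
  define S where "S = {P :: 'k poly. \<forall>i. coeff P i \<in> A}"
  have S: "is_subring S" unfolding S_def by (rule is_subring_coeffs[OF A])
  have q0: "q > 0" using q p prime_gt_0_nat by simp
  define X where "X = (monom 1 1 :: 'k poly)"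
  have XS: "X \<in> S" by (auto simp: X_def S_def is_subringD[OF A])
  have cS: "[:c:] \<in> S" if "c \<in> A" for c using that by (auto simp: S_def coeff_pCons is_subringD[OF A] split: nat.split)
  have cpow: "[:c:] ^ m = [:c ^ m:]" for c :: 'k and m by (simp add: poly_const_pow)
  have Xq: "X ^ q = monom 1 q" by (simp add: X_def monom_power)
  have zq: "z ^ q \<in> A" by (intro is_subring_power[OF A] z)
  have c1: "cong_in S p ((X + [:- z:]) ^ q) (X ^ q + [:- z:] ^ q)"
    unfolding q by (intro cong_in_add_power[OF S p] XS cS is_subringD(3)[OF A] z)
  have "cong_in S p ((- [:z:]) ^ q) (- ([:z:] ^ q))"
    unfolding q by (intro cong_in_minus_power[OF S p] cS z)
  then have "cong_in S p (X ^ q + (- [:z:]) ^ q) (X ^ q + - ([:z:] ^ q))"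
    by (intro cong_in_add[OF S] cong_in_refl[OF S])
  moreover have "X ^ q + - ([:z:] ^ q) = X ^ q - [:z ^ q:]" "- [:z:] = [:- z:]"
    by (simp_all only: cpow diff_conv_add_uminus minus_pCons minus_zero)
  ultimately have c2: "cong_in S p (X ^ q + [:- z:] ^ q) (X ^ q - [:z ^ q:])" by (simp only:)
  have XqS: "X ^ q - [:z ^ q:] \<in> S" by (intro is_subringD(5)[OF S] is_subring_power[OF S] XS cS zq)
  have XzS: "X + [:- z:] \<in> S" by (intro is_subringD(4)[OF S] XS cS is_subringD(3)[OF A] z)
  define W where "W = (X + [:- z:]) ^ (n - q * Suc a)"
  have WS: "W \<in> S" unfolding W_def by (intro is_subring_power[OF S] XzS)
  have "cong_in S p (((X + [:- z:]) ^ q) ^ Suc a * W) ((X ^ q - [:z ^ q:]) ^ Suc a * W)"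
    by (intro cong_in_mult[OF S] cong_in_power[OF S] cong_in_trans[OF S c1 c2] cong_in_refl[OF S] is_subring_power[OF S] XqS XzS WS)
  then have "cong_in S p ((X + [:- z:]) ^ n) ((monom 1 q - [:z ^ q:]) ^ Suc a * W)"
    using n by (simp only: Xq W_def power_mult[symmetric] power_add[symmetric] le_add_diff_inverse)
  then obtain R where R: "R \<in> S" "(X + [:- z:]) ^ n = (monom 1 q - [:z ^ q:]) ^ Suc a * W + of_nat p * R"
    by (auto simp: cong_in_def prime_multiples_def algebra_simps)
  have dXz: "degree (X + [:- z:]) = 1" by (simp add: X_def monom_altdef)
  have dW: "degree W \<le> n - q * Suc a"
    unfolding W_def using degree_power_le[of "X + [:- z:]" "n - q * Suc a"] unfolding dXz by simp
  have "degree ((monom 1 q - [:z ^ q:]) ^ Suc a * W) \<le> K"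
  proof -
    have "degree (monom 1 q - [:z ^ q:]) \<le> q" by (intro degree_diff_le) (auto simp: degree_monom_le)
    then have "degree ((monom 1 q - [:z ^ q:]) ^ Suc a) \<le> q * Suc a"
      using degree_power_le[of "monom 1 q - [:z ^ q:]" "Suc a"] mult_le_mono1 order_trans by blast
    then have "degree ((monom 1 q - [:z ^ q:]) ^ Suc a * W) \<le> q * Suc a + (n - q * Suc a)"
      using degree_mult_le[of "(monom 1 q - [:z ^ q:]) ^ Suc a" W] dW by linarith
    then show ?thesis using n K by linarith
  qed
  then have z0: "section_deriv q \<nu> K (z ^ q) a ((monom 1 q - [:z ^ q:]) ^ Suc a * W) = 0"
    by (rule section_deriv_power[OF q0 \<nu>])
  have co: "coeff ((X + [:- z:]) ^ n) k = of_nat (n choose k) * (- z) ^ (n - k)" for k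
  proof -
    have "(X + [:- z:]) ^ n = (\<Sum>j\<le>n. monom (of_nat (n choose j) * (- z) ^ (n - j)) j)"
      unfolding binomial_ring X_def
      by (intro sum.cong refl) (simp add: monom_power cpow of_nat_poly smult_monom mult.commute)
    then show ?thesis by (auto simp: coeff_sum binomial_eq_0)
  qed
  have "(\<Sum>\<mu>\<le>K. of_nat (n choose (q * \<mu> + \<nu>)) * (- z) ^ (n - (q * \<mu> + \<nu>)) *
      (of_nat (\<mu> choose a) * (z ^ q) ^ (\<mu> - a))) = section_deriv q \<nu> K (z ^ q) a ((X + [:- z:]) ^ n)"
    unfolding section_deriv_def co by simp
  also have "\<dots> = section_deriv q \<nu> K (z ^ q) a ((monom 1 q - [:z ^ q:]) ^ Suc a * W)
      + section_deriv q \<nu> K (z ^ q) a (of_nat p * R)"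
    unfolding R(2) section_deriv_def by (simp add: distrib_right sum.distrib)
  also have "\<dots> = section_deriv q \<nu> K (z ^ q) a (of_nat p * R)" by (simp only: z0 add_0_left)
  also have "\<dots> = of_nat p * section_deriv q \<nu> K (z ^ q) a R"
    unfolding section_deriv_def by (simp add: sum_distrib_left mult.assoc of_nat_poly)
  also have "\<dots> \<in> prime_multiples A p"
  proof -
    have "section_deriv q \<nu> K (z ^ q) a R \<in> A" unfolding section_deriv_def
      using R(1) by (intro is_subring_sum[OF A] is_subringD(6)[OF A] is_subring_of_nat[OF A] is_subring_power[OF A] zq)
        (auto simp: S_def)
    then show ?thesis unfolding prime_multiples_def by blast
  qed
  finally show ?thesis .
qed

section \<open>Jets in terms of coefficients\<close>

text \<open>The coefficient of \<open>x\<^sup>\<alpha>\<close> in \<open>(x + y)\<^sup>\<mu>\<close>.\<close>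

definition jet :: "nat \<Rightarrow> (nat \<Rightarrow> 'k::field) \<Rightarrow> (nat \<Rightarrow> nat) \<Rightarrow> (nat \<Rightarrow> nat) \<Rightarrow> 'k" where
  "jet N y \<mu> \<alpha> = (\<Prod>i\<in>{1..N}. of_nat (\<mu> i choose \<alpha> i) * y i ^ (\<mu> i - \<alpha> i))"

text \<open>Exponent vectors are functions that are undefined outside \<open>{1..N}\<close>. In this form, products over the
coordinates of sums over the exponents can be multiplied out.\<close>

definition exps :: "nat \<Rightarrow> nat \<Rightarrow> (nat \<Rightarrow> nat) set" where
  "exps N K = {1..N} \<rightarrow>\<^sub>E {..K}"

definition size_exp :: "nat \<Rightarrow> (nat \<Rightarrow> nat) \<Rightarrow> nat" where
  "size_exp N \<mu> = (\<Sum>i\<in>{1..N}. \<mu> i)"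

lemma finite_exps [simp]: "finite (exps N K)"
  by (simp add: exps_def finite_PiE)

lemma jet_in:
  assumes "is_subring A" "\<And>i. i \<in> {1..N} \<Longrightarrow> y i \<in> A" shows "jet N y \<mu> \<alpha> \<in> A"
  unfolding jet_def
  by (intro is_subring_prod[OF assms(1)] is_subringD(6)[OF assms(1)] is_subring_of_nat[OF assms(1)]
      is_subring_power[OF assms(1)] assms(2))

text \<open>Here \<open>F\<close> are the coefficients of a polynomial of degree less than \<open>q b\<close> and \<open>E j\<close> those of its expansion
at the point \<open>y j\<close>, which start in degree \<open>q (M + N)\<close>; the matrix \<open>c\<close> is a left inverse of the map from
polynomials of degree less than \<open>b\<close> to jets of order less than \<open>M\<close>.

Fix a residue class \<open>\<nu>\<close> of exponents modulo \<open>q\<close> and consider the section \<open>\<Sum>\<^sub>\<mu> F(q \<mu> + \<nu>) x\<^sup>\<mu>\<close>. A monomial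
\<open>(x - y)\<^sup>\<gamma>\<close> with \<open>|\<gamma>| \<ge> q (M + N)\<close> and an exponent \<open>\<alpha>\<close> with \<open>|\<alpha>| < M\<close> have \<open>\<gamma>\<^sub>i \<ge> q (\<alpha>\<^sub>i + 1)\<close> for some \<open>i\<close>; this is
where the \<open>N\<close> in \<open>M + N\<close> is needed. By the one-variable case, the section vanishes modulo \<open>p\<close> to order \<open>M\<close>
at the points whose coordinates are the \<open>q\<close>-th powers of those of \<open>y j\<close>. Modulo \<open>p\<close>, the \<open>q\<close>-th powers of
the entries of \<open>c\<close> are a left inverse of the jets at these points, because raising to the power \<open>q\<close> is
additive. As the section has degree less than \<open>b\<close>, its coefficients vanish modulo \<open>p\<close>.\<close>

lemma frobenius_descent:
  fixes A :: "'k::field set" and J :: "'j set"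
  assumes A: "is_subring A" and p: "prime p" and q: "q = p ^ e" and J: "finite J"
    and y: "\<And>j i. j \<in> J \<Longrightarrow> i \<in> {1..N} \<Longrightarrow> y j i \<in> A"
    and S: "finite S" "\<And>\<alpha>. \<alpha> \<in> S \<Longrightarrow> size_exp N \<alpha> < M"
    and cA: "\<And>\<mu> j \<alpha>. \<mu> \<in> exps N b \<Longrightarrow> j \<in> J \<Longrightarrow> \<alpha> \<in> S \<Longrightarrow> c \<mu> j \<alpha> \<in> A"
    and inv: "\<And>\<mu> \<mu>'. \<mu> \<in> exps N b \<Longrightarrow> \<mu>' \<in> exps N b \<Longrightarrow> size_exp N \<mu> < b \<Longrightarrow> size_exp N \<mu>' < b \<Longrightarrow>
      (\<Sum>j\<in>J. \<Sum>\<alpha>\<in>S. c \<mu> j \<alpha> * jet N (y j) \<mu>' \<alpha>) = (if \<mu> = \<mu>' then 1 else 0)"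
    and EA: "\<And>j \<gamma>. j \<in> J \<Longrightarrow> \<gamma> \<in> exps N K \<Longrightarrow> E j \<gamma> \<in> A"
    and E: "\<And>j \<gamma>. j \<in> J \<Longrightarrow> \<gamma> \<in> exps N K \<Longrightarrow> size_exp N \<gamma> < q * (M + N) \<Longrightarrow> E j \<gamma> = 0"
    and F: "\<And>j \<xi>. j \<in> J \<Longrightarrow> F \<xi> = (\<Sum>\<gamma>\<in>exps N K. E j \<gamma> * jet N (\<lambda>i. - y j i) \<gamma> \<xi>)"
    and FA: "\<And>\<xi>. F \<xi> \<in> A"
    and Fdeg: "\<And>\<xi>. size_exp N \<xi> \<ge> q * b \<Longrightarrow> F \<xi> = 0" and J0: "J \<noteq> {}" and bK: "b \<le> K"
  shows "F \<xi> \<in> prime_multiples A p"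
proof (cases "size_exp N \<xi> \<ge> q * b")
  case True
  then show ?thesis using Fdeg prime_multiples_0[OF A] by simp
next
  case False
  have q0: "q > 0" using q p prime_gt_0_nat by simp
  define \<nu> where "\<nu> i = \<xi> i mod q" for i
  define \<mu>0 where "\<mu>0 = restrict (\<lambda>i. \<xi> i div q) {1..N}"
  define up where "up \<mu> = (\<lambda>i. q * \<mu> i + \<nu> i)" for \<mu> :: "nat \<Rightarrow> nat"
  have \<nu>q: "\<nu> i < q" for i using q0 by (simp add: \<nu>_def)
  have F_cong: "F \<zeta> = F \<zeta>'" if "\<And>i. i \<in> {1..N} \<Longrightarrow> \<zeta> i = \<zeta>' i" for \<zeta> \<zeta>'
  proof -
    obtain j where j: "j \<in> J" using J0 by blast
    have "jet N (\<lambda>i. - y j i) \<gamma> \<zeta> = jet N (\<lambda>i. - y j i) \<gamma> \<zeta>'" for \<gamma>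
      unfolding jet_def using that by (intro prod.cong) auto
    then show ?thesis by (simp add: F[OF j])
  qed
  have size_up: "size_exp N (up \<mu>) \<ge> q * size_exp N \<mu>" for \<mu>
    by (simp add: size_exp_def up_def sum_distrib_left sum.distrib)
  have up0: "F (up \<mu>0) = F \<xi>" by (rule F_cong) (simp add: up_def \<mu>0_def \<nu>_def)
  have "size_exp N (up \<mu>0) = size_exp N \<xi>" unfolding size_exp_def by (intro sum.cong) (auto simp: up_def \<mu>0_def \<nu>_def)
  then have s0: "size_exp N \<mu>0 < b" using size_up[of \<mu>0] False q0 by (metis nat_mult_less_cancel1 le_less_trans not_le)
  have small: "\<mu> \<in> exps N b" if "\<mu> \<in> exps N L" "size_exp N \<mu> < b" for \<mu> L
  proof -
    have "\<mu> i \<le> b" if i: "i \<in> {1..N}" for i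
    proof -
      have "\<mu> i \<le> size_exp N \<mu>" unfolding size_exp_def using i by (intro member_le_sum) auto
      then show ?thesis using \<open>size_exp N \<mu> < b\<close> by simp
    qed
    then show ?thesis using that(1) by (auto simp: exps_def PiE_def extensional_def Pi_def)
  qed
  have "\<mu>0 i \<le> size_exp N \<mu>0" if "i \<in> {1..N}" for i
    unfolding size_exp_def using that by (intro member_le_sum) auto
  then have m0: "\<mu>0 \<in> exps N b" using s0 by (force simp: exps_def \<mu>0_def intro!: restrict_PiE)
  \<comment> \<open>the left inverse, raised to the power \<open>q\<close>\<close>
  have inv_q: "cong_in A p (\<Sum>j\<in>J. \<Sum>\<alpha>\<in>S. c \<mu>0 j \<alpha> ^ q * jet N (\<lambda>i. y j i ^ q) \<mu> \<alpha>) (if \<mu>0 = \<mu> then 1 else 0)"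
    if mu: "\<mu> \<in> exps N b" "size_exp N \<mu> < b" for \<mu>
  proof -
    have cj: "cong_in A p (c \<mu>0 j \<alpha> ^ q * jet N (\<lambda>i. y j i ^ q) \<mu> \<alpha>) ((c \<mu>0 j \<alpha> * jet N (y j) \<mu> \<alpha>) ^ q)"
      if j: "j \<in> J" and \<alpha>: "\<alpha> \<in> S" for j \<alpha>
    proof -
      have "cong_in A p ((\<Prod>i\<in>{1..N}. (of_nat (\<mu> i choose \<alpha> i) * y j i ^ (\<mu> i - \<alpha> i)) ^ q))
          (\<Prod>i\<in>{1..N}. of_nat (\<mu> i choose \<alpha> i) * (y j i ^ q) ^ (\<mu> i - \<alpha> i))"
      proof (rule cong_in_prod[OF A])
        fix i assume i: "i \<in> {1..N}"
        have "cong_in A p (of_nat (\<mu> i choose \<alpha> i) ^ q * (y j i ^ q) ^ (\<mu> i - \<alpha> i))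
            (of_nat (\<mu> i choose \<alpha> i) * (y j i ^ q) ^ (\<mu> i - \<alpha> i))"
          unfolding q by (intro cong_in_mult[OF A] cong_in_of_nat_power[OF A p] cong_in_refl[OF A]
              is_subring_of_nat[OF A] is_subring_power[OF A] y[OF j i])
        then show "cong_in A p ((of_nat (\<mu> i choose \<alpha> i) * y j i ^ (\<mu> i - \<alpha> i)) ^ q)
            (of_nat (\<mu> i choose \<alpha> i) * (y j i ^ q) ^ (\<mu> i - \<alpha> i))"
          by (simp add: power_mult_distrib power_mult[symmetric] mult.commute)
      qed (auto intro!: is_subringD(6)[OF A] is_subring_of_nat[OF A] is_subring_power[OF A] y j)
      then have "cong_in A p (jet N (y j) \<mu> \<alpha> ^ q) (jet N (\<lambda>i. y j i ^ q) \<mu> \<alpha>)"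
        by (simp add: jet_def prod_power_distrib)
      then have "cong_in A p (c \<mu>0 j \<alpha> ^ q * jet N (y j) \<mu> \<alpha> ^ q) (c \<mu>0 j \<alpha> ^ q * jet N (\<lambda>i. y j i ^ q) \<mu> \<alpha>)"
        by (intro cong_in_mult[OF A] cong_in_refl[OF A] is_subring_power[OF A] jet_in[OF A] cA m0 j \<alpha> y)
      then show ?thesis by (simp add: power_mult_distrib cong_in_sym[OF A])
    qed
    have in_A: "c \<mu>0 j \<alpha> * jet N (y j) \<mu> \<alpha> \<in> A" if "j \<in> J" "\<alpha> \<in> S" for j \<alpha>
      using that by (intro is_subringD(6)[OF A] jet_in[OF A] cA m0 y)
    have c1: "cong_in A p (\<Sum>x\<in>J \<times> S. (case x of (j, \<alpha>) \<Rightarrow> c \<mu>0 j \<alpha> ^ q * jet N (\<lambda>i. y j i ^ q) \<mu> \<alpha>))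
        (\<Sum>x\<in>J \<times> S. (case x of (j, \<alpha>) \<Rightarrow> c \<mu>0 j \<alpha> * jet N (y j) \<mu> \<alpha>) ^ q)"
      by (intro cong_in_sum[OF A]) (auto intro: cj)
    have c2: "cong_in A p (\<Sum>x\<in>J \<times> S. (case x of (j, \<alpha>) \<Rightarrow> c \<mu>0 j \<alpha> * jet N (y j) \<mu> \<alpha>) ^ q)
        ((\<Sum>x\<in>J \<times> S. (case x of (j, \<alpha>) \<Rightarrow> c \<mu>0 j \<alpha> * jet N (y j) \<mu> \<alpha>)) ^ q)"
      unfolding q by (rule cong_in_sym[OF A], rule cong_in_sum_power[OF A p]) (use J S in_A in auto)
    have c3: "(\<Sum>x\<in>J \<times> S. (case x of (j, \<alpha>) \<Rightarrow> c \<mu>0 j \<alpha> * jet N (y j) \<mu> \<alpha>)) ^ q = (if \<mu>0 = \<mu> then 1 else 0)"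
      using inv[OF m0 mu(1) s0 mu(2)] q0 by (simp add: sum.cartesian_product power_0_left)
    show ?thesis using cong_in_trans[OF A c1 c2] unfolding c3 by (simp add: sum.cartesian_product)
  qed
  \<comment> \<open>the jets of the section at the points with coordinates raised to the power \<open>q\<close>\<close>
  define h where "h j \<alpha> = (\<Sum>\<mu>\<in>exps N K. F (up \<mu>) * jet N (\<lambda>i. y j i ^ q) \<mu> \<alpha>)" for j \<alpha>
  have h0: "h j \<alpha> \<in> prime_multiples A p" if j: "j \<in> J" and \<alpha>: "\<alpha> \<in> S" for j \<alpha>
  proof -
    \<comment> \<open>the jet of the section of \<open>(x - y j)\<^sup>\<gamma>\<close>; it factors over the coordinates\<close>
    define T where "T \<gamma> = (\<Prod>i\<in>{1..N}. \<Sum>m\<le>K. (of_nat (\<gamma> i choose (q * m + \<nu> i)) * (- y j i) ^ (\<gamma> i - (q * m + \<nu> i))) *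
      (of_nat (m choose \<alpha> i) * (y j i ^ q) ^ (m - \<alpha> i)))" for \<gamma> :: "nat \<Rightarrow> nat"
    have T: "T \<gamma> = (\<Sum>\<mu>\<in>exps N K. jet N (\<lambda>i. - y j i) \<gamma> (up \<mu>) * jet N (\<lambda>i. y j i ^ q) \<mu> \<alpha>)" for \<gamma>
      unfolding T_def exps_def jet_def up_def prod.distrib[symmetric]
      by (rule prod_sum_PiE) simp_all
    have "h j \<alpha> = (\<Sum>\<mu>\<in>exps N K. \<Sum>\<gamma>\<in>exps N K. E j \<gamma> *
        (jet N (\<lambda>i. - y j i) \<gamma> (up \<mu>) * jet N (\<lambda>i. y j i ^ q) \<mu> \<alpha>))"
      unfolding h_def by (simp add: F[OF j] sum_distrib_right mult.assoc)
    also have "\<dots> = (\<Sum>\<gamma>\<in>exps N K. E j \<gamma> * (\<Sum>\<mu>\<in>exps N K. jet N (\<lambda>i. - y j i) \<gamma> (up \<mu>) * jet N (\<lambda>i. y j i ^ q) \<mu> \<alpha>))"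
      by (subst sum.swap) (simp add: sum_distrib_left)
    also have "\<dots> = (\<Sum>\<gamma>\<in>exps N K. E j \<gamma> * T \<gamma>)"
      by (simp only: T)
    also have "\<dots> \<in> prime_multiples A p"
    proof (rule prime_multiples_sum[OF A])
      fix \<gamma> assume \<gamma>: "\<gamma> \<in> exps N K"
      show "E j \<gamma> * T \<gamma> \<in> prime_multiples A p"
      proof (cases "size_exp N \<gamma> < q * (M + N)")
        case True
        then show ?thesis using E[OF j \<gamma>] prime_multiples_0[OF A] by simp
      next
        case False
        have "\<exists>i\<in>{1..N}. \<gamma> i \<ge> q * Suc (\<alpha> i)"
        proof (rule ccontr)
          assume "\<not> ?thesis"
          then have "\<gamma> i \<le> q * Suc (\<alpha> i)" if "i \<in> {1..N}" for i using that by (meson nle_le)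
          then have "size_exp N \<gamma> \<le> (\<Sum>i\<in>{1..N}. q * Suc (\<alpha> i))" unfolding size_exp_def by (intro sum_mono)
          also have "\<dots> = q * (size_exp N \<alpha> + N)" by (simp add: size_exp_def sum_distrib_left sum.distrib distrib_left)
          also have "\<dots> < q * (M + N)" using S(2)[OF \<alpha>] q0 by simp
          finally show False using False by simp
        qed
        then obtain i where i: "i \<in> {1..N}" "\<gamma> i \<ge> q * Suc (\<alpha> i)" by blast
        have "\<gamma> i \<le> K" using \<gamma> i(1) by (auto simp: exps_def)
        then have si: "(\<Sum>m\<le>K. (of_nat (\<gamma> i choose (q * m + \<nu> i)) * (- y j i) ^ (\<gamma> i - (q * m + \<nu> i))) *
            (of_nat (m choose \<alpha> i) * (y j i ^ q) ^ (m - \<alpha> i))) \<in> prime_multiples A p"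
          using section_deriv_linear_power[OF A p y[OF j i(1)] q \<nu>q i(2)] by simp
        have "T \<gamma> \<in> prime_multiples A p" unfolding T_def
        proof (rule prime_multiples_prod[OF A, where j = i])
          fix i' assume "i' \<in> {1..N}"
          then show "(\<Sum>m\<le>K. (of_nat (\<gamma> i' choose (q * m + \<nu> i')) * (- y j i') ^ (\<gamma> i' - (q * m + \<nu> i'))) *
            (of_nat (m choose \<alpha> i') * (y j i' ^ q) ^ (m - \<alpha> i'))) \<in> A"
            by (intro is_subring_sum[OF A] is_subringD(3,6)[OF A] is_subring_of_nat[OF A] is_subring_power[OF A] y j)
        qed (use i(1) si in simp_all)
        then show ?thesis by (intro prime_multiples_mult[OF A] EA[OF j \<gamma>])
      qed
    qed
    finally show ?thesis .
  qed
  have "(\<Sum>j\<in>J. \<Sum>\<alpha>\<in>S. c \<mu>0 j \<alpha> ^ q * h j \<alpha>) \<in> prime_multiples A p"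
    by (intro prime_multiples_sum[OF A] prime_multiples_mult[OF A] is_subring_power[OF A] cA m0 h0)
  moreover have "(\<Sum>j\<in>J. \<Sum>\<alpha>\<in>S. c \<mu>0 j \<alpha> ^ q * h j \<alpha>) =
     (\<Sum>\<mu>\<in>exps N K. F (up \<mu>) * (\<Sum>j\<in>J. \<Sum>\<alpha>\<in>S. c \<mu>0 j \<alpha> ^ q * jet N (\<lambda>i. y j i ^ q) \<mu> \<alpha>))"
  proof -
    have "(\<Sum>j\<in>J. \<Sum>\<alpha>\<in>S. c \<mu>0 j \<alpha> ^ q * h j \<alpha>) =
        (\<Sum>j\<in>J. \<Sum>\<alpha>\<in>S. \<Sum>\<mu>\<in>exps N K. F (up \<mu>) * (c \<mu>0 j \<alpha> ^ q * jet N (\<lambda>i. y j i ^ q) \<mu> \<alpha>))"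
      unfolding h_def by (simp add: sum_distrib_left mult.left_commute)
    also have "\<dots> = (\<Sum>j\<in>J. \<Sum>\<mu>\<in>exps N K. \<Sum>\<alpha>\<in>S. F (up \<mu>) * (c \<mu>0 j \<alpha> ^ q * jet N (\<lambda>i. y j i ^ q) \<mu> \<alpha>))"
      by (intro sum.cong refl sum.swap)
    also have "\<dots> = (\<Sum>\<mu>\<in>exps N K. \<Sum>j\<in>J. \<Sum>\<alpha>\<in>S. F (up \<mu>) * (c \<mu>0 j \<alpha> ^ q * jet N (\<lambda>i. y j i ^ q) \<mu> \<alpha>))"
      by (rule sum.swap)
    finally show ?thesis by (simp add: sum_distrib_left)
  qed
  moreover have "cong_in A p (\<Sum>\<mu>\<in>exps N K. F (up \<mu>) * (\<Sum>j\<in>J. \<Sum>\<alpha>\<in>S. c \<mu>0 j \<alpha> ^ q * jet N (\<lambda>i. y j i ^ q) \<mu> \<alpha>))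
     (\<Sum>\<mu>\<in>exps N K. F (up \<mu>) * (if \<mu>0 = \<mu> then 1 else 0))"
  proof (rule cong_in_sum[OF A])
    fix \<mu> assume mu: "\<mu> \<in> exps N K"
    show "cong_in A p (F (up \<mu>) * (\<Sum>j\<in>J. \<Sum>\<alpha>\<in>S. c \<mu>0 j \<alpha> ^ q * jet N (\<lambda>i. y j i ^ q) \<mu> \<alpha>))
       (F (up \<mu>) * (if \<mu>0 = \<mu> then 1 else 0))"
    proof (cases "size_exp N \<mu> < b")
      case True
      have "(\<Sum>j\<in>J. \<Sum>\<alpha>\<in>S. c \<mu>0 j \<alpha> ^ q * jet N (\<lambda>i. y j i ^ q) \<mu> \<alpha>) \<in> A"
        by (intro is_subring_sum[OF A] is_subringD(6)[OF A] is_subring_power[OF A] cA m0 jet_in[OF A] y)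
      then show ?thesis by (intro cong_in_mult[OF A] cong_in_refl[OF A] inv_q small[OF mu] True FA)
    next
      case False
      then have "q * b \<le> size_exp N (up \<mu>)" using size_up[of \<mu>] by (meson le_trans mult_le_mono2 not_less)
      then show ?thesis using Fdeg by (simp add: cong_in_refl[OF A])
    qed
  qed
  moreover have "(\<Sum>\<mu>\<in>exps N K. F (up \<mu>) * (if \<mu>0 = \<mu> then 1 else 0)) = F \<xi>"
  proof -
    have "\<mu>0 \<in> exps N K" using m0 bK by (auto simp: exps_def PiE_def Pi_def)
    then show ?thesis using up0 by (simp add: if_distrib cong: if_cong)
  qed
  ultimately have "cong_in A p (\<Sum>j\<in>J. \<Sum>\<alpha>\<in>S. c \<mu>0 j \<alpha> ^ q * h j \<alpha>) (F \<xi>)"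
    and "(\<Sum>j\<in>J. \<Sum>\<alpha>\<in>S. c \<mu>0 j \<alpha> ^ q * h j \<alpha>) \<in> prime_multiples A p" by simp_all
  then have "F \<xi> - (\<Sum>j\<in>J. \<Sum>\<alpha>\<in>S. c \<mu>0 j \<alpha> ^ q * h j \<alpha>) + (\<Sum>j\<in>J. \<Sum>\<alpha>\<in>S. c \<mu>0 j \<alpha> ^ q * h j \<alpha>) \<in> prime_multiples A p"
    using cong_in_sym[OF A] unfolding cong_in_def by (intro prime_multiples_add[OF A]) blast
  then show ?thesis by simp
qed

definition exps_monom :: "nat \<Rightarrow> (nat \<Rightarrow> nat) \<Rightarrow> (nat \<Rightarrow>\<^sub>0 nat)" where
  "exps_monom N \<kappa> = (\<Sum>i\<in>{1..N}. Poly_Mapping.single i (\<kappa> i))"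

lemma lookup_exps_monom: "Poly_Mapping.lookup (exps_monom N \<kappa>) i = (if i \<in> {1..N} then \<kappa> i else 0)"
proof -
  have "Poly_Mapping.lookup (exps_monom N \<kappa>) i = (\<Sum>j\<in>{1..N}. if j = i then \<kappa> j else 0)"
    unfolding exps_monom_def lookup_sum by (intro sum.cong) (auto simp: lookup_single when_def)
  then show ?thesis by simp
qed

lemma keys_exps_monom: "Poly_Mapping.keys (exps_monom N \<kappa>) \<subseteq> {1..N}"
  by (auto simp: in_keys_iff lookup_exps_monom split: if_splits)

lemma exps_monom_eq_iff: "exps_monom N \<kappa> = exps_monom N \<kappa>' \<longleftrightarrow> (\<forall>i\<in>{1..N}. \<kappa> i = \<kappa>' i)"
proof
  assume "exps_monom N \<kappa> = exps_monom N \<kappa>'"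
  then have "Poly_Mapping.lookup (exps_monom N \<kappa>) i = Poly_Mapping.lookup (exps_monom N \<kappa>') i" for i by simp
  then show "\<forall>i\<in>{1..N}. \<kappa> i = \<kappa>' i" unfolding lookup_exps_monom by (metis (full_types))
qed (auto simp: exps_monom_def intro!: sum.cong)

lemma exps_monom_surj: "Poly_Mapping.keys m \<subseteq> {1..N} \<Longrightarrow> exps_monom N (restrict (Poly_Mapping.lookup m) {1..N}) = m"
  by (rule poly_mapping_eqI) (auto simp: lookup_exps_monom in_keys_iff subset_iff)

lemma monom_degree_exps_monom: "monom_degree (exps_monom N \<kappa>) = size_exp N \<kappa>"
  by (subst monom_degree_superset[OF _ keys_exps_monom]) (auto simp: size_exp_def lookup_exps_monom)

lemma odeg_exps_monom: "odeg (exps_monom N \<kappa>) = size_exp N \<kappa>"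
proof -
  have "0 \<notin> Poly_Mapping.keys (exps_monom N \<kappa>)" using keys_exps_monom[of N \<kappa>] by auto
  then show ?thesis by (simp add: odeg_eq monom_degree_exps_monom)
qed

lemma inj_on_exps_monom: "inj_on (exps_monom N) (exps N K)"
proof (rule inj_onI)
  fix x y assume "x \<in> exps N K" "y \<in> exps N K" "exps_monom N x = exps_monom N y"
  then show "x = y" unfolding exps_monom_eq_iff exps_def by (intro PiE_ext) auto
qed

lemma var_power: "var v ^ n = (Poly_Mapping.single (Poly_Mapping.single v n) 1 :: ('v, 'k::field) mpoly)"
  by (induction n) (simp_all add: var_def mult_single flip: single_add)

lemma prod_single: "(\<Prod>i\<in>I. Poly_Mapping.single (g i) (h i)) =
    (Poly_Mapping.single (\<Sum>i\<in>I. g i) (\<Prod>i\<in>I. h i) :: ('v, 'k::field) mpoly)"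
  by (induction I rule: infinite_finite_induct) (simp_all add: mult_single)

lemma lookup_shifted_monomial:
  fixes y :: "nat \<Rightarrow> 'k::field"
  shows "Poly_Mapping.lookup (\<Prod>i\<in>{1..N}. (var i + const (y i)) ^ e i) (exps_monom N \<alpha>) = jet N y e \<alpha>"
proof -
  define C where "C i k = of_nat (e i choose k) * y i ^ (e i - k)" for i k
  define B where "B = PiE {1..N} (\<lambda>i. {..e i})"
  have finB: "finite B" unfolding B_def by (intro finite_PiE) auto
  have cp: "const a ^ n = const (a ^ n)" for a :: 'k and n by (induction n) (simp_all add: const_mult)
  have cn: "of_nat n = const (of_nat n)" for n by (simp add: const_def)
  have "(\<Prod>i\<in>{1..N}. (var i + const (y i)) ^ e i) = (\<Prod>i\<in>{1..N}. \<Sum>k\<le>e i. Poly_Mapping.single (Poly_Mapping.single i k) (C i k))"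
  proof (intro prod.cong refl)
    fix i
    have "of_nat (e i choose k) * var i ^ k * const (y i) ^ (e i - k) = Poly_Mapping.single (Poly_Mapping.single i k) (C i k)" for k
      unfolding cn cp by (simp add: var_power C_def const_def mult_single del: single_of_nat)
    then show "(var i + const (y i)) ^ e i = (\<Sum>k\<le>e i. Poly_Mapping.single (Poly_Mapping.single i k) (C i k))"
      unfolding binomial_ring by simp
  qed
  also have "\<dots> = (\<Sum>\<kappa>\<in>B. \<Prod>i\<in>{1..N}. Poly_Mapping.single (Poly_Mapping.single i (\<kappa> i)) (C i (\<kappa> i)))"
    unfolding B_def by (rule prod_sum_PiE) auto
  also have "\<dots> = (\<Sum>\<kappa>\<in>B. Poly_Mapping.single (exps_monom N \<kappa>) (\<Prod>i\<in>{1..N}. C i (\<kappa> i)))"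
    by (simp only: prod_single exps_monom_def)
  finally have "Poly_Mapping.lookup (\<Prod>i\<in>{1..N}. (var i + const (y i)) ^ e i) (exps_monom N \<alpha>)
      = (\<Sum>\<kappa>\<in>B. if exps_monom N \<kappa> = exps_monom N \<alpha> then \<Prod>i\<in>{1..N}. C i (\<kappa> i) else 0)"
    by (simp only: lookup_sum lookup_single when_def)
  also have "\<dots> = (\<Sum>\<kappa>\<in>B. if \<kappa> = restrict \<alpha> {1..N} then \<Prod>i\<in>{1..N}. C i (\<kappa> i) else 0)"
  proof (intro sum.cong refl if_cong)
    fix \<kappa> assume "\<kappa> \<in> B"
    then have "\<kappa> \<in> extensional {1..N}" by (auto simp: B_def PiE_def)
    then show "exps_monom N \<kappa> = exps_monom N \<alpha> \<longleftrightarrow> \<kappa> = restrict \<alpha> {1..N}"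
      unfolding exps_monom_eq_iff by (auto simp: extensional_def fun_eq_iff)
  qed
  also have "\<dots> = (if restrict \<alpha> {1..N} \<in> B then \<Prod>i\<in>{1..N}. C i (restrict \<alpha> {1..N} i) else 0)"
    using finB by simp
  also have "\<dots> = (if restrict \<alpha> {1..N} \<in> B then jet N y e \<alpha> else 0)"
    by (auto simp: jet_def C_def intro!: prod.cong)
  also have "\<dots> = jet N y e \<alpha>"
  proof (cases "restrict \<alpha> {1..N} \<in> B")
    case False
    then obtain i where "i \<in> {1..N}" "\<not> \<alpha> i \<le> e i" by (auto simp: B_def PiE_iff)
    then have "(\<Prod>i\<in>{1..N}. of_nat (e i choose \<alpha> i) * y i ^ (e i - \<alpha> i)) = 0"
      by (intro prod_zero) (auto simp: binomial_eq_0 intro!: bexI[of _ i])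
    then show ?thesis by (simp add: jet_def)
  qed simp
  finally show ?thesis .
qed

lemma lookup_shift:
  fixes f :: "(nat, 'k::field) mpoly"
  assumes f: "vars_in {1..N} f" "deg_le K f"
  shows "Poly_Mapping.lookup (shift y f) (exps_monom N \<alpha>) =
    (\<Sum>\<mu>\<in>exps N K. Poly_Mapping.lookup f (exps_monom N \<mu>) * jet N y \<mu> \<alpha>)"
proof -
  have sub: "Poly_Mapping.keys f \<subseteq> exps_monom N ` exps N K"
  proof
    fix m assume m: "m \<in> Poly_Mapping.keys f"
    then have k: "Poly_Mapping.keys m \<subseteq> {1..N}" using f(1) by (auto simp: vars_in_def)
    have "Poly_Mapping.lookup m i \<le> K" for i
      using lookup_le_monom_degree[of m i] f(2) m by (auto simp: deg_le_def intro: order_trans)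
    then have "restrict (Poly_Mapping.lookup m) {1..N} \<in> exps N K" by (auto simp: exps_def)
    then show "m \<in> exps_monom N ` exps N K" using exps_monom_surj[OF k] by (metis imageI)
  qed
  have mv: "monom_val (\<lambda>i. var i + const (y i)) (exps_monom N \<mu>) = (\<Prod>i\<in>{1..N}. (var i + const (y i)) ^ \<mu> i)" for \<mu>
    by (subst monom_val_superset[OF _ keys_exps_monom]) (auto simp: lookup_exps_monom intro!: prod.cong)
  have "Poly_Mapping.lookup (shift y f) (exps_monom N \<alpha>) = (\<Sum>m\<in>exps_monom N ` exps N K.
      Poly_Mapping.lookup f m * Poly_Mapping.lookup (monom_val (\<lambda>i. var i + const (y i)) m) (exps_monom N \<alpha>))"
    unfolding shift_def ev_superset[OF is_hom_const finite_imageI[OF finite_exps] sub] lookup_sum lookup_const_mult ..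
  also have "\<dots> = (\<Sum>\<mu>\<in>exps N K. Poly_Mapping.lookup f (exps_monom N \<mu>) * jet N y \<mu> \<alpha>)"
    unfolding sum.reindex[OF inj_on_exps_monom] o_def mv lookup_shifted_monomial ..
  finally show ?thesis .
qed

section \<open>A lower bound from finitely many jets\<close>

text \<open>A valuation ring orders the nonzero elements of the field by divisibility, so a finite set has an element
that divides all the others.\<close>

lemma valuation_subring_max:
  assumes V: "valuation_subring A" and U: "finite U" "U \<noteq> {}" "0 \<notin> U"
  shows "\<exists>u\<in>U. \<forall>v\<in>U. v / u \<in> A"
  using U
proof (induction U rule: finite_ne_induct)
  case (singleton x)
  then show ?case using V by (auto simp: valuation_subring_def is_subring_def)
next
  case (insert x U)
  have A: "is_subring A" using V by (simp add: valuation_subring_def)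
  obtain u where u: "u \<in> U" "\<forall>v\<in>U. v / u \<in> A" using insert by auto
  have x0: "x \<noteq> 0" "u \<noteq> 0" using insert u by auto
  have "x / u \<in> A \<or> 1 / (x / u) \<in> A" using V by (auto simp: valuation_subring_def)
  then show ?case
  proof
    assume "x / u \<in> A"
    then show ?thesis using u by auto
  next
    assume ux: "1 / (x / u) \<in> A"
    have "v / x \<in> A" if v: "v \<in> insert x U" for v
    proof (cases "v = x")
      case True then show ?thesis using x0 is_subringD(2)[OF A] by simp
    next
      case False
      then have "v / u * (1 / (x / u)) \<in> A" using u v ux by (intro is_subringD(6)[OF A]) auto
      then show ?thesis using x0 by simp
    qed
    then show ?thesis by blast
  qed
qed

text \<open>The matrix \<open>c\<close> is a left inverse of the linear map that takes a polynomial of degree less than \<open>b\<close> to its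
jets of order less than \<open>M\<close> at the points \<open>y j\<close>. A matrix of which only finitely many entries matter is
used rather than injectivity, because it can be reduced modulo a prime.\<close>

definition jets_inverse :: "nat \<Rightarrow> nat \<Rightarrow> nat \<Rightarrow> 'j set \<Rightarrow> ('j \<Rightarrow> nat \<Rightarrow> 'k::field) \<Rightarrow>
    ((nat \<Rightarrow> nat) \<Rightarrow> 'j \<Rightarrow> (nat \<Rightarrow> nat) \<Rightarrow> 'k) \<Rightarrow> bool" where
  "jets_inverse N M b J y c \<longleftrightarrow> (\<forall>\<mu>\<in>{\<mu> \<in> exps N b. size_exp N \<mu> < b}. \<forall>\<mu>'\<in>{\<mu> \<in> exps N b. size_exp N \<mu> < b}.
     (\<Sum>j\<in>J. \<Sum>\<alpha>\<in>{\<alpha> \<in> exps N M. size_exp N \<alpha> < M}. c \<mu> j \<alpha> * jet N (y j) \<mu>' \<alpha>) = (if \<mu> = \<mu>' then 1 else 0))"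

text \<open>Scaling \<open>G\<close> by a coefficient that divides all the others makes its coefficients integral and one of them
\<open>1\<close>. If the degree were smaller, descent would show that this coefficient is a multiple of \<open>p\<close>.\<close>

lemma degree_bound_power:
  fixes y :: "'j \<Rightarrow> nat \<Rightarrow> 'k::field" and G :: "(nat, 'k) mpoly"
  assumes J: "finite J" "J \<noteq> {}" and inv: "jets_inverse N M b J y c"
    and V: "valuation_subring A" and p: "prime p" and np: "\<And>a. a \<in> A \<Longrightarrow> of_nat p * a \<noteq> 1"
    and yA: "\<And>j i. j \<in> J \<Longrightarrow> i \<in> {1..N} \<Longrightarrow> y j i \<in> A"
    and cA: "\<And>\<mu> j \<alpha>. \<mu> \<in> exps N b \<Longrightarrow> j \<in> J \<Longrightarrow> \<alpha> \<in> exps N M \<Longrightarrow> c \<mu> j \<alpha> \<in> A"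
    and G: "G \<noteq> 0" "vars_in {1..N} G" "deg_le D G" "\<And>j. j \<in> J \<Longrightarrow> ord_ge (p ^ e * (M + N)) (shift (y j) G)"
  shows "p ^ e * b \<le> D"
proof (rule ccontr)
  assume "\<not> p ^ e * b \<le> D"
  then have D: "D < p ^ e * b" by simp
  have A: "is_subring A" using V by (simp add: valuation_subring_def)
  have "\<exists>u\<in>Poly_Mapping.lookup G ` Poly_Mapping.keys G. \<forall>v\<in>Poly_Mapping.lookup G ` Poly_Mapping.keys G. v / u \<in> A"
    using G(1) by (intro valuation_subring_max[OF V]) (auto simp: in_keys_iff)
  then obtain m0 where m0: "m0 \<in> Poly_Mapping.keys G"
    "\<And>m. m \<in> Poly_Mapping.keys G \<Longrightarrow> Poly_Mapping.lookup G m / Poly_Mapping.lookup G m0 \<in> A" by auto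
  define u where "u = Poly_Mapping.lookup G m0"
  have u0: "u \<noteq> 0" using m0(1) by (simp add: u_def in_keys_iff)
  define H where "H = const (1 / u) * G"
  have lH: "Poly_Mapping.lookup H m = Poly_Mapping.lookup G m / u" for m by (simp add: H_def lookup_const_mult)
  have HA: "Poly_Mapping.lookup H m \<in> A" for m
    using m0(2)[of m] is_subringD(1)[OF A] unfolding lH u_def by (cases "m \<in> Poly_Mapping.keys G") (auto simp: in_keys_iff)
  have H1: "Poly_Mapping.lookup H m0 = 1" using u0 by (simp add: lH u_def)
  have Hv: "vars_in {1..N} H" unfolding H_def by (intro vars_in_mult vars_in_const G)
  have Hd: "deg_le D H" unfolding H_def using deg_le_mult[OF deg_le_const G(3), of 0] by simp
  have Ho: "ord_ge (p ^ e * (M + N)) (shift (y j) H)" if "j \<in> J" for j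
    unfolding H_def shift_mult shift_const using ord_ge_mult[OF ord_ge_zero G(4)[OF that]] by simp
  define K where "K = max D b"
  have HK: "deg_le K H" using Hd by (rule deg_le_mono) (simp add: K_def)
  define S where "S = {\<alpha> \<in> exps N M. size_exp N \<alpha> < M}"
  have k0: "Poly_Mapping.keys m0 \<subseteq> {1..N}" using m0(1) G(2) by (auto simp: vars_in_def)
  have "Poly_Mapping.lookup H (exps_monom N (restrict (Poly_Mapping.lookup m0) {1..N})) \<in> prime_multiples A p"
  proof (rule frobenius_descent[OF A p refl J(1) yA, where S = S and M = M and b = b and c = c and K = K and e = e
        and E = "\<lambda>j \<gamma>. Poly_Mapping.lookup (shift (y j) H) (exps_monom N \<gamma>)" and F = "\<lambda>\<xi>. Poly_Mapping.lookup H (exps_monom N \<xi>)"])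
    show "finite S" by (simp add: S_def)
    show "size_exp N \<alpha> < M" if "\<alpha> \<in> S" for \<alpha> using that by (simp add: S_def)
    show "c \<mu> j \<alpha> \<in> A" if "\<mu> \<in> exps N b" "j \<in> J" "\<alpha> \<in> S" for \<mu> j \<alpha>
      using that by (intro cA) (auto simp: S_def)
    show "(\<Sum>j\<in>J. \<Sum>\<alpha>\<in>S. c \<mu> j \<alpha> * jet N (y j) \<mu>' \<alpha>) = (if \<mu> = \<mu>' then 1 else 0)"
      if "\<mu> \<in> exps N b" "\<mu>' \<in> exps N b" "size_exp N \<mu> < b" "size_exp N \<mu>' < b" for \<mu> \<mu>'
      using inv that unfolding jets_inverse_def S_def by blast
    show "Poly_Mapping.lookup (shift (y j) H) (exps_monom N \<gamma>) \<in> A" if "j \<in> J" for j \<gamma>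
      unfolding lookup_shift[OF Hv HK]
      by (intro is_subring_sum[OF A] is_subringD(6)[OF A] HA jet_in[OF A] yA that)
    show "Poly_Mapping.lookup (shift (y j) H) (exps_monom N \<gamma>) = 0" if "j \<in> J" "size_exp N \<gamma> < p ^ e * (M + N)" for j \<gamma>
    proof (rule ccontr)
      assume "Poly_Mapping.lookup (shift (y j) H) (exps_monom N \<gamma>) \<noteq> 0"
      then have "p ^ e * (M + N) \<le> odeg (exps_monom N \<gamma>)" using Ho[OF that(1)] by (auto simp: ord_ge_def in_keys_iff)
      then show False using that(2) by (simp add: odeg_exps_monom)
    qed
    show "Poly_Mapping.lookup H (exps_monom N \<xi>) =
        (\<Sum>\<gamma>\<in>exps N K. Poly_Mapping.lookup (shift (y j) H) (exps_monom N \<gamma>) * jet N (\<lambda>i. - y j i) \<gamma> \<xi>)" for j \<xi>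
      using lookup_shift[OF vars_in_shift[OF Hv] deg_le_shift[OF HK], of "\<lambda>i. - y j i" "y j" \<xi>]
      by (simp add: shift_inverse)
    show "Poly_Mapping.lookup H (exps_monom N \<xi>) \<in> A" for \<xi> by (rule HA)
    show "Poly_Mapping.lookup H (exps_monom N \<xi>) = 0" if "p ^ e * b \<le> size_exp N \<xi>" for \<xi>
    proof (rule ccontr)
      assume "Poly_Mapping.lookup H (exps_monom N \<xi>) \<noteq> 0"
      then have "monom_degree (exps_monom N \<xi>) \<le> D" using Hd by (auto simp: deg_le_def in_keys_iff)
      then show False using that D by (simp add: monom_degree_exps_monom)
    qed
    show "J \<noteq> {}" by fact
    show "b \<le> K" by (simp add: K_def)
  qed
  then have "1 \<in> prime_multiples A p" using exps_monom_surj[OF k0] H1 by simp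
  then show False using np by (auto simp: prime_multiples_def)
qed

text \<open>The power \<open>g\<^sup>t\<close>, where \<open>t\<close> is about \<open>q (M + N) / m\<close>, vanishes to order \<open>q (M + N)\<close> and so has degree at least
\<open>q b\<close>. Dividing \<open>t D \<ge> q b\<close> by \<open>q\<close> and letting \<open>q = p\<^sup>e\<close> tend to infinity removes the rounding error in \<open>t\<close>.\<close>

lemma degree_bound_of_jets_inverse:
  fixes y :: "'j \<Rightarrow> nat \<Rightarrow> 'k::field" and g :: "(nat, 'k) mpoly"
  assumes J: "finite J" "J \<noteq> {}" and inv: "jets_inverse N M b J y c"
    and g: "g \<noteq> 0" "vars_in {1..N} g" "deg_le D g" "\<And>j. j \<in> J \<Longrightarrow> ord_ge m (shift (y j) g)"
  shows "b * m \<le> D * (M + N)"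
proof (cases "m = 0")
  case False
  define Q where "Q = (\<lambda>(\<mu>, j, \<alpha>). c \<mu> j \<alpha>) ` (exps N b \<times> J \<times> exps N M) \<union> (\<lambda>(j, i). y j i) ` (J \<times> {1..N})"
  have "finite Q" unfolding Q_def using J by auto
  from ex_valuation_subring_prime[OF this] obtain p A where
    p: "prime p" and V: "valuation_subring A" and Q: "Q \<subseteq> A" and np: "\<And>a. a \<in> A \<Longrightarrow> of_nat p * a \<noteq> 1" by blast
  have yA: "y j i \<in> A" if "j \<in> J" "i \<in> {1..N}" for j i
  proof -
    have "(\<lambda>(j, i). y j i) (j, i) \<in> Q" unfolding Q_def using that by (intro UnI2 imageI) auto
    then show ?thesis using Q by auto
  qed
  have cA: "c \<mu> j \<alpha> \<in> A" if "\<mu> \<in> exps N b" "j \<in> J" "\<alpha> \<in> exps N M" for \<mu> j \<alpha>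
  proof -
    have "(\<lambda>(\<mu>, j, \<alpha>). c \<mu> j \<alpha>) (\<mu>, j, \<alpha>) \<in> Q" unfolding Q_def using that by (intro UnI1 imageI) auto
    then show ?thesis using Q by auto
  qed
  have le: "p ^ e * (b * m) \<le> (p ^ e * (M + N) + m) * D" for e
  proof -
    define t where "t = Suc (p ^ e * (M + N) div m)"
    have "t * m = m + p ^ e * (M + N) div m * m" by (simp add: t_def)
    moreover have "p ^ e * (M + N) < m + p ^ e * (M + N) div m * m"
      using False mod_less_divisor[of m "p ^ e * (M + N)"] div_mult_mod_eq[of "p ^ e * (M + N)" m] by linarith
    moreover have "p ^ e * (M + N) div m * m \<le> p ^ e * (M + N)" by simp
    ultimately have t: "p ^ e * (M + N) \<le> t * m" "t * m \<le> p ^ e * (M + N) + m" by linarith+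
    have "p ^ e * b \<le> t * D"
    proof (rule degree_bound_power[OF J inv V p np yA cA, where G = "g ^ t"])
      show "g ^ t \<noteq> 0" using g(1) by simp
      show "vars_in {1..N} (g ^ t)" by (intro vars_in_power g)
      show "deg_le (t * D) (g ^ t)" by (intro deg_le_power g)
      show "ord_ge (p ^ e * (M + N)) (shift (y j) (g ^ t))" if "j \<in> J" for j
        unfolding shift_power by (rule ord_ge_mono[OF ord_ge_power[OF g(4)[OF that]] t(1)])
    qed
    then have "p ^ e * b * m \<le> t * D * m" by (rule mult_le_mono1)
    also have "\<dots> = (t * m) * D" by simp
    also have "\<dots> \<le> (p ^ e * (M + N) + m) * D" using t(2) by (rule mult_le_mono1)
    finally show ?thesis by (simp add: mult.assoc)
  qed
  show ?thesis
  proof (rule ccontr)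
    assume "\<not> b * m \<le> D * (M + N)"
    then have "D * (M + N) + 1 \<le> b * m" by simp
    then have "p ^ e * (D * (M + N) + 1) \<le> (p ^ e * (M + N) + m) * D" for e
      using le[of e] mult_le_mono2 order_trans by blast
    then have "p ^ e \<le> m * D" for e by (simp add: algebra_simps)
    moreover have "m * D < p ^ (m * D)"
      using less_exp[of "m * D"] power_mono[of 2 p "m * D"] prime_ge_2_nat[OF p] by linarith
    ultimately show False by (meson not_le)
  qed
qed simp

section \<open>Linear algebra over an integral domain\<close>

text \<open>A homogeneous system with more unknowns than equations has a nontrivial solution;
  the elimination below never divides, so it works over any domain.\<close>

lemma ex_kernel_vector:
  fixes T :: "'a \<Rightarrow> 'b \<Rightarrow> 'r::comm_ring_1"
  assumes C: "is_subring C" and dom: "\<And>x y. x \<in> C \<Longrightarrow> y \<in> C \<Longrightarrow> x * y = 0 \<Longrightarrow> x = 0 \<or> y = 0"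
    and R: "finite R" and "finite J" "card R < card J" "\<And>r j. r \<in> R \<Longrightarrow> j \<in> J \<Longrightarrow> T r j \<in> C"
  shows "\<exists>v. (\<forall>j\<in>J. v j \<in> C) \<and> (\<exists>j\<in>J. v j \<noteq> 0) \<and> (\<forall>r\<in>R. (\<Sum>j\<in>J. T r j * v j) = 0)"
  using R assms(4-)
proof (induction R arbitrary: J T rule: finite_induct)
  case empty
  then have "J \<noteq> {}" by auto
  then show ?case by (intro exI[of _ "\<lambda>_. 1"]) (auto intro: is_subringD[OF C])
next
  case (insert r0 R)
  show ?case
  proof (cases "\<forall>j\<in>J. T r0 j = 0")
    case True
    have "\<exists>v. (\<forall>j\<in>J. v j \<in> C) \<and> (\<exists>j\<in>J. v j \<noteq> 0) \<and> (\<forall>r\<in>R. (\<Sum>j\<in>J. T r j * v j) = 0)"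
      using insert.prems insert.hyps by (intro insert.IH) auto
    then show ?thesis using True by auto
  next
    case False
    then obtain j0 where j0: "j0 \<in> J" "T r0 j0 \<noteq> 0" by blast
    define J' where "J' = J - {j0}"
    \<comment> \<open>fraction-free elimination of the unknown \<open>j0\<close> with the pivot in row \<open>r0\<close>\<close>
    define T' where "T' r j = T r0 j0 * T r j - T r j0 * T r0 j" for r j
    have "\<exists>v. (\<forall>j\<in>J'. v j \<in> C) \<and> (\<exists>j\<in>J'. v j \<noteq> 0) \<and> (\<forall>r\<in>R. (\<Sum>j\<in>J'. T' r j * v j) = 0)"
      using insert.prems insert.hyps j0
      by (intro insert.IH) (auto simp: J'_def T'_def intro!: is_subringD(5,6)[OF C])
    then obtain v where v: "\<forall>j\<in>J'. v j \<in> C" "\<exists>j\<in>J'. v j \<noteq> 0" "\<forall>r\<in>R. (\<Sum>j\<in>J'. T' r j * v j) = 0" by blast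
    define w where "w j = (if j = j0 then - (\<Sum>j\<in>J'. T r0 j * v j) else T r0 j0 * v j)" for j
    have s: "(\<Sum>j\<in>J. T r j * w j) = T r0 j0 * (\<Sum>j\<in>J'. T r j * v j) - T r j0 * (\<Sum>j\<in>J'. T r0 j * v j)" for r
    proof -
      have "(\<Sum>j\<in>J. T r j * w j) = T r j0 * w j0 + (\<Sum>j\<in>J'. T r j * w j)"
        unfolding J'_def by (rule sum.remove[OF insert.prems(1) j0(1)])
      also have "(\<Sum>j\<in>J'. T r j * w j) = (\<Sum>j\<in>J'. T r0 j0 * (T r j * v j))"
        by (intro sum.cong) (auto simp: J'_def w_def mult.left_commute)
      finally show ?thesis by (simp add: w_def sum_distrib_left)
    qed
    have "(\<Sum>j\<in>J. T r j * w j) = 0" if "r \<in> insert r0 R" for r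
    proof (cases "r = r0")
      case True
      then show ?thesis by (simp add: s)
    next
      case False
      then have "(\<Sum>j\<in>J'. T' r j * v j) = 0" using that v(3) by simp
      moreover have "(\<Sum>j\<in>J'. T' r j * v j) = T r0 j0 * (\<Sum>j\<in>J'. T r j * v j) - T r j0 * (\<Sum>j\<in>J'. T r0 j * v j)"
        by (simp add: T'_def left_diff_distrib sum_subtractf sum_distrib_left mult.assoc)
      ultimately show ?thesis by (simp add: s)
    qed
    moreover have "w j \<in> C" if j: "j \<in> J" for j
    proof (cases "j = j0")
      case True
      have "(\<Sum>j\<in>J'. T r0 j * v j) \<in> C"
        using insert.prems v(1) by (intro is_subring_sum[OF C] is_subringD(6)[OF C]) (auto simp: J'_def)
      then show ?thesis using True by (simp add: w_def is_subringD(3)[OF C])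
    next
      case False
      then show ?thesis using j v(1) insert.prems j0 by (auto simp: w_def J'_def intro!: is_subringD(6)[OF C])
    qed
    moreover have "\<exists>j\<in>J. w j \<noteq> 0"
    proof -
      obtain j where j: "j \<in> J'" "v j \<noteq> 0" using v(2) by blast
      then have "T r0 j0 * v j \<noteq> 0" using dom[of "T r0 j0" "v j"] j0 v(1) insert.prems by auto
      then show ?thesis using j by (intro bexI[of _ j]) (auto simp: w_def J'_def)
    qed
    ultimately show ?thesis by (intro exI[of _ w]) blast
  qed
qed

section \<open>Polynomial functions\<close>

inductive polyfun :: "(('i \<Rightarrow> 'k::field) \<Rightarrow> 'k) \<Rightarrow> bool" where
  polyfun_const: "polyfun (\<lambda>_. c)"
| polyfun_coord: "polyfun (\<lambda>a. a i)"
| polyfun_add: "polyfun f \<Longrightarrow> polyfun g \<Longrightarrow> polyfun (\<lambda>a. f a + g a)"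
| polyfun_mult: "polyfun f \<Longrightarrow> polyfun g \<Longrightarrow> polyfun (\<lambda>a. f a * g a)"

lemma polyfun_uminus: "polyfun f \<Longrightarrow> polyfun (\<lambda>a. - f a)"
  using polyfun_mult[OF polyfun_const[of "-1"]] by simp

lemma polyfun_diff: "polyfun f \<Longrightarrow> polyfun g \<Longrightarrow> polyfun (\<lambda>a. f a - g a)"
  using polyfun_add[OF _ polyfun_uminus[of g], of f] by simp

lemma polyfun_sum: "(\<And>i. i \<in> I \<Longrightarrow> polyfun (f i)) \<Longrightarrow> polyfun (\<lambda>a. \<Sum>i\<in>I. f i a)"
  by (induction I rule: infinite_finite_induct) (auto intro: polyfun.intros)

lemma polyfun_prod: "(\<And>i. i \<in> I \<Longrightarrow> polyfun (f i)) \<Longrightarrow> polyfun (\<lambda>a. \<Prod>i\<in>I. f i a)"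
  by (induction I rule: infinite_finite_induct) (auto intro: polyfun.intros)

lemma polyfun_power: "polyfun f \<Longrightarrow> polyfun (\<lambda>a. f a ^ n)"
  by (induction n) (auto intro: polyfun.intros)

lemma polyfun_compose:
  assumes "polyfun g" "\<And>i. polyfun (\<sigma> i)" shows "polyfun (\<lambda>a. g (\<lambda>i. \<sigma> i a))"
  using assms(1) by induction (auto intro: polyfun.intros assms(2))

lemma polyfun_eval_mpoly: "polyfun (eval_mpoly \<Phi>)"
  unfolding eval_mpoly_def by (intro polyfun_sum polyfun_mult polyfun_prod polyfun_power polyfun_const polyfun_coord)

lemma polyfun_line:
  assumes "polyfun g" shows "\<exists>p. \<forall>t. poly p t = g (\<lambda>i. a i + t * (b i - a i))"
  using assms
proof induction
  case (polyfun_const c)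
  show ?case by (rule exI[of _ "[:c:]"]) simp
next
  case (polyfun_coord i)
  show ?case by (rule exI[of _ "[:a i, b i - a i:]"]) simp
next
  case (polyfun_add f g)
  then obtain p q where "\<forall>t. poly p t = f (\<lambda>i. a i + t * (b i - a i))" "\<forall>t. poly q t = g (\<lambda>i. a i + t * (b i - a i))" by blast
  then show ?case by (intro exI[of _ "p + q"]) simp
next
  case (polyfun_mult f g)
  then obtain p q where "\<forall>t. poly p t = f (\<lambda>i. a i + t * (b i - a i))" "\<forall>t. poly q t = g (\<lambda>i. a i + t * (b i - a i))" by blast
  then show ?case by (intro exI[of _ "p * q"]) simp
qed

text \<open>The restriction of a polynomial function to a line is a polynomial in one variable, which has finitely
many roots. This replaces the irreducibility of affine space.\<close>

lemma polyfun_common_nonzero: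
  fixes f g :: "('i \<Rightarrow> 'k::field) \<Rightarrow> 'k"
  assumes inf: "infinite (UNIV :: 'k set)" and f: "polyfun f" "f a \<noteq> 0" and g: "polyfun g" "g b \<noteq> 0"
  shows "\<exists>x. f x \<noteq> 0 \<and> g x \<noteq> 0"
proof -
  obtain p where p: "\<And>t. poly p t = f (\<lambda>i. a i + t * (b i - a i))" using polyfun_line[OF f(1)] by blast
  obtain q where q: "\<And>t. poly q t = g (\<lambda>i. a i + t * (b i - a i))" using polyfun_line[OF g(1)] by blast
  have "poly p 0 \<noteq> 0" "poly q 1 \<noteq> 0" using f g by (simp_all add: p q)
  then have "p * q \<noteq> 0" by auto
  then have "finite {t. poly (p * q) t = 0}" by (rule poly_roots_finite)
  then obtain t where "poly (p * q) t \<noteq> 0" using inf by (metis (mono_tags, lifting) ex_new_if_finite mem_Collect_eq)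
  then have "poly p t \<noteq> 0" "poly q t \<noteq> 0" by auto
  then show ?thesis unfolding p q by blast
qed

text \<open>If a matrix of polynomial functions is injective at \<open>y0\<close>, Gaussian elimination at \<open>y0\<close> finds a nonzero
pivot in every column. The product of the pivots is the function \<open>\<Delta>\<close>; where it is nonzero, the same
elimination goes through and gives a left inverse.\<close>

lemma open_left_inverse:
  fixes T :: "'a \<Rightarrow> 'b \<Rightarrow> ('i \<Rightarrow> 'k::field) \<Rightarrow> 'k"
  assumes R: "finite R" and J: "finite J" and "\<And>r j. polyfun (T r j)"
    and "\<And>v. (\<And>r. r \<in> R \<Longrightarrow> (\<Sum>j\<in>J. T r j y0 * v j) = 0) \<Longrightarrow> \<forall>j\<in>J. v j = 0"
  shows "\<exists>\<Delta>. polyfun \<Delta> \<and> \<Delta> y0 \<noteq> 0 \<and> (\<forall>y. \<Delta> y \<noteq> 0 \<longrightarrow>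
    (\<exists>c. \<forall>j\<in>J. \<forall>j'\<in>J. (\<Sum>r\<in>R. c j r * T r j' y) = (if j = j' then 1 else 0)))"
  using J assms(3,4)
proof (induction J arbitrary: T rule: finite_induct)
  case empty
  then show ?case by (intro exI[of _ "\<lambda>_. 1"]) (auto intro: polyfun_const)
next
  case (insert j0 J)
  have "\<exists>r\<in>R. T r j0 y0 \<noteq> 0"
  proof (rule ccontr)
    assume "\<not> ?thesis"
    then have "\<forall>j\<in>insert j0 J. (if j = j0 then 1 else 0 :: 'k) = 0"
      using insert.hyps by (intro insert.prems(2)) (auto intro!: sum.neutral)
    then show False by simp
  qed
  then obtain r0 where r0: "r0 \<in> R" "T r0 j0 y0 \<noteq> 0" by blast
  define T' where "T' r j y = T r0 j0 y * T r j y - T r j0 y * T r0 j y" for r j y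
  have "\<exists>\<Delta>. polyfun \<Delta> \<and> \<Delta> y0 \<noteq> 0 \<and> (\<forall>y. \<Delta> y \<noteq> 0 \<longrightarrow>
    (\<exists>c. \<forall>j\<in>J. \<forall>j'\<in>J. (\<Sum>r\<in>R. c j r * T' r j' y) = (if j = j' then 1 else 0)))"
  proof (rule insert.IH)
    show "polyfun (T' r j)" for r j unfolding T'_def
      by (intro polyfun_diff polyfun_mult insert.prems(1))
    fix v assume v: "\<And>r. r \<in> R \<Longrightarrow> (\<Sum>j\<in>J. T' r j y0 * v j) = 0"
    define w where "w j = (if j = j0 then - (\<Sum>j\<in>J. T r0 j y0 * v j) / T r0 j0 y0 else v j)" for j
    have "\<forall>j\<in>insert j0 J. w j = 0"
    proof (rule insert.prems(2))
      fix r assume r: "r \<in> R"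
      have "(\<Sum>j\<in>insert j0 J. T r j y0 * w j) = T r j0 y0 * w j0 + (\<Sum>j\<in>J. T r j y0 * v j)"
        using insert.hyps by (simp, intro sum.cong) (auto simp: w_def)
      moreover have "T r0 j0 y0 * (T r j0 y0 * w j0 + (\<Sum>j\<in>J. T r j y0 * v j)) = (\<Sum>j\<in>J. T' r j y0 * v j)"
      proof -
        have w0: "T r0 j0 y0 * w j0 = - (\<Sum>j\<in>J. T r0 j y0 * v j)" using r0 by (simp add: w_def)
        have "T r0 j0 y0 * (T r j0 y0 * w j0 + (\<Sum>j\<in>J. T r j y0 * v j)) =
            T r j0 y0 * (T r0 j0 y0 * w j0) + T r0 j0 y0 * (\<Sum>j\<in>J. T r j y0 * v j)" by (simp add: algebra_simps)
        also have "\<dots> = (\<Sum>j\<in>J. T' r j y0 * v j)" unfolding w0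
          by (simp add: T'_def left_diff_distrib sum_subtractf sum_distrib_left mult.assoc)
        finally show ?thesis .
      qed
      ultimately show "(\<Sum>j\<in>insert j0 J. T r j y0 * w j) = 0" using v[OF r] r0 by simp
    qed
    then have "w j = 0" if "j \<in> J" for j using that by simp
    moreover have "w j = v j" if "j \<in> J" for j using that insert.hyps by (auto simp: w_def)
    ultimately show "\<forall>j\<in>J. v j = 0" by simp
  qed
  then obtain \<Delta>' where D: "polyfun \<Delta>'" "\<Delta>' y0 \<noteq> 0" "\<And>y. \<Delta>' y \<noteq> 0 \<Longrightarrow>
    \<exists>c. \<forall>j\<in>J. \<forall>j'\<in>J. (\<Sum>r\<in>R. c j r * T' r j' y) = (if j = j' then 1 else 0)" by blast
  have "\<exists>c. \<forall>j\<in>insert j0 J. \<forall>j'\<in>insert j0 J. (\<Sum>r\<in>R. c j r * T r j' y) = (if j = j' then 1 else 0)"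
    if y: "T r0 j0 y * \<Delta>' y \<noteq> 0" for y
  proof -
    have t0: "T r0 j0 y \<noteq> 0" using y by auto
    obtain c where c: "\<And>j j'. j \<in> J \<Longrightarrow> j' \<in> J \<Longrightarrow> (\<Sum>r\<in>R. c j r * T' r j' y) = (if j = j' then 1 else 0)"
      using D(3)[of y] y by auto
    \<comment> \<open>a left inverse for the columns in \<open>J\<close> that kills the column \<open>j0\<close>\<close>
    define d where "d j r = T r0 j0 y * c j r - (if r = r0 then \<Sum>r'\<in>R. c j r' * T r' j0 y else 0)" for j r
    have dT: "(\<Sum>r\<in>R. d j r * T r j' y) = T r0 j0 y * (\<Sum>r\<in>R. c j r * T r j' y) - (\<Sum>r\<in>R. c j r * T r j0 y) * T r0 j' y" for j j'
    proof -
      have "(\<Sum>r\<in>R. d j r * T r j' y) = (\<Sum>r\<in>R. T r0 j0 y * (c j r * T r j' y)) -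
          (\<Sum>r\<in>R. if r = r0 then (\<Sum>r'\<in>R. c j r' * T r' j0 y) * T r0 j' y else 0)"
        unfolding sum_subtractf[symmetric] by (intro sum.cong) (auto simp: d_def left_diff_distrib)
      then show ?thesis using r0(1) R by (simp add: sum_distrib_left)
    qed
    have d1: "(\<Sum>r\<in>R. d j r * T r j' y) = (if j = j' then 1 else 0)" if "j \<in> J" "j' \<in> J" for j j'
    proof -
      have "(\<Sum>r\<in>R. c j r * T' r j' y) = T r0 j0 y * (\<Sum>r\<in>R. c j r * T r j' y) - (\<Sum>r\<in>R. c j r * T r j0 y) * T r0 j' y"
        by (simp add: T'_def right_diff_distrib sum_subtractf sum_distrib_left sum_distrib_right mult_ac)
      then show ?thesis using c[OF that] dT by simp
    qed
    have d0: "(\<Sum>r\<in>R. d j r * T r j0 y) = 0" for j unfolding dT by simp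
    \<comment> \<open>the missing row: row \<open>r0\<close> of the matrix, cleared in the columns of \<open>J\<close> and divided by the pivot\<close>
    define e where "e j r = (if j = j0 then ((if r = r0 then 1 else 0) - (\<Sum>j\<in>J. T r0 j y * d j r)) / T r0 j0 y else d j r)" for j r
    have e0: "(\<Sum>r\<in>R. e j0 r * T r j' y) = (if j0 = j' then 1 else 0)" if j': "j' \<in> insert j0 J" for j'
    proof -
      have "T r0 j0 y * (\<Sum>r\<in>R. e j0 r * T r j' y) = (\<Sum>r\<in>R. ((if r = r0 then 1 else 0) - (\<Sum>j\<in>J. T r0 j y * d j r)) * T r j' y)"
        unfolding sum_distrib_left e_def using t0 by (intro sum.cong) auto
      also have "\<dots> = (\<Sum>r\<in>R. if r = r0 then T r0 j' y else 0) - (\<Sum>r\<in>R. \<Sum>j\<in>J. T r0 j y * (d j r * T r j' y))"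
        unfolding sum_subtractf[symmetric] by (intro sum.cong) (auto simp: left_diff_distrib sum_distrib_right mult.assoc)
      also have "(\<Sum>r\<in>R. \<Sum>j\<in>J. T r0 j y * (d j r * T r j' y)) = (\<Sum>j\<in>J. T r0 j y * (\<Sum>r\<in>R. d j r * T r j' y))"
        by (subst sum.swap) (simp add: sum_distrib_left)
      also have "\<dots> = (if j0 = j' then 0 else T r0 j' y)"
      proof (cases "j0 = j'")
        case True then show ?thesis using d0 by simp
      next
        case False
        then have j'J: "j' \<in> J" using j' by simp
        have "(\<Sum>j\<in>J. T r0 j y * (\<Sum>r\<in>R. d j r * T r j' y)) = (\<Sum>j\<in>J. if j = j' then T r0 j' y else 0)"
          by (intro sum.cong) (auto simp: d1[OF _ j'J])
        then show ?thesis using False j'J insert.hyps(1) by simp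
      qed
      finally have "T r0 j0 y * (\<Sum>r\<in>R. e j0 r * T r j' y) = T r0 j0 y * (if j0 = j' then 1 else 0)"
        using r0(1) R by (auto split: if_splits)
      then show ?thesis using t0 by simp
    qed
    have "(\<Sum>r\<in>R. e j r * T r j' y) = (if j = j' then 1 else 0)" if "j \<in> insert j0 J" "j' \<in> insert j0 J" for j j'
    proof (cases "j = j0")
      case True
      then show ?thesis using e0[OF that(2)] by simp
    next
      case False
      then have "j \<in> J" using that by simp
      then show ?thesis using False d0 d1 that(2) by (cases "j' = j0") (auto simp: e_def)
    qed
    then show ?thesis by blast
  qed
  then show ?case using D r0 insert.prems(1)
    by (intro exI[of _ "\<lambda>y. T r0 j0 y * \<Delta>' y"]) (auto intro: polyfun_mult)
qed

section \<open>Symbolic powers and the Waldschmidt constant\<close>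

lemma poly_ring_simps:
  "f \<oplus>\<^bsub>poly_ring N\<^esub> g = f + g" "f \<otimes>\<^bsub>poly_ring N\<^esub> g = f * g"
  "\<zero>\<^bsub>poly_ring N\<^esub> = (0 :: (nat, 'k::field) mpoly)" "\<one>\<^bsub>poly_ring N\<^esub> = (1 :: (nat, 'k) mpoly)"
  for f g :: "(nat, 'k::field) mpoly"
  by (simp_all add: poly_ring_def)

lemma carrier_poly_ring: "f \<in> carrier (poly_ring N) \<longleftrightarrow> vars_in {..N} f"
  by (simp add: poly_ring_def vars_in_def)

lemma ideals_set_simps:
  "I \<otimes>\<^bsub>ideals_set R\<^esub> J = ideal_prod R I J" "\<one>\<^bsub>ideals_set R\<^esub> = carrier R"
  "I \<in> carrier (ideals_set R) \<longleftrightarrow> ideal I R"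
  by (simp_all add: ideals_set_def)

abbreviation ideal_power :: "nat \<Rightarrow> (nat, 'k::field) mpoly set \<Rightarrow> nat \<Rightarrow> (nat, 'k) mpoly set" where
  "ideal_power N I m \<equiv> I [^]\<^bsub>ideals_set (poly_ring N)\<^esub> m"

definition point_forms :: "nat \<Rightarrow> (nat \<Rightarrow> 'k::field) set \<Rightarrow> (nat, 'k) mpoly set" where
  "point_forms N P = {f \<in> carrier (poly_ring N). (\<exists>d. homogeneous d f) \<and> (\<forall>a\<in>P. eval_mpoly f a = 0)}"

lemma point_ideal_eq: "point_ideal N P = genideal (poly_ring N) (point_forms N P)"
  by (simp add: point_ideal_def point_forms_def)

lemma ideal_point_ideal: "ideal (point_ideal N P) (poly_ring N)"
  unfolding point_ideal_eq
  by (rule ring.genideal_ideal[OF cring.axioms(1)[OF cring_poly_ring]]) (auto simp: point_forms_def)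

lemma point_forms_subset: "point_forms N P \<subseteq> point_ideal N P"
  unfolding point_ideal_eq
  by (rule ring.genideal_self[OF cring.axioms(1)[OF cring_poly_ring]]) (auto simp: point_forms_def)

text \<open>A ring homomorphism that maps the forms vanishing at a point into the first step of a
  multiplicative filtration maps the \<open>m\<close>-th power of the point ideal into the \<open>m\<close>-th step. All the
  information on symbolic powers used below is obtained in this way.\<close>

lemma ideal_power_filtration:
  fixes \<psi> :: "(nat, 'k::field) mpoly \<Rightarrow> 'r::comm_ring_1" and Fl :: "nat \<Rightarrow> 'r \<Rightarrow> bool"
  assumes \<psi>: "\<And>f g. \<psi> (f + g) = \<psi> f + \<psi> g" "\<And>f g. \<psi> (f * g) = \<psi> f * \<psi> g"
    and Fl: "\<And>m. Fl m 0" "\<And>m x y. Fl m x \<Longrightarrow> Fl m y \<Longrightarrow> Fl m (x + y)" "\<And>x. Fl 0 x"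
      "\<And>m n x y. Fl m x \<Longrightarrow> Fl n y \<Longrightarrow> Fl (m + n) (x * y)"
    and gen: "\<And>g. g \<in> point_forms N P \<Longrightarrow> Fl 1 (\<psi> g)"
    and f: "f \<in> ideal_power N (point_ideal N P) m"
  shows "Fl m (\<psi> f)"
proof -
  interpret R: cring "poly_ring N :: (nat, 'k) mpoly ring" by (rule cring_poly_ring)
  have \<psi>0: "\<psi> 0 = 0" using \<psi>(1)[of 0 0] by simp
  define I where "I = {f \<in> carrier (poly_ring N). Fl 1 (\<psi> f)}"
  have car: "0 \<in> carrier (poly_ring N :: (nat, 'k) mpoly ring)"
    "\<And>f g :: (nat, 'k) mpoly. f \<in> carrier (poly_ring N) \<Longrightarrow> g \<in> carrier (poly_ring N) \<Longrightarrow> f + g \<in> carrier (poly_ring N)"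
    "\<And>f g :: (nat, 'k) mpoly. f \<in> carrier (poly_ring N) \<Longrightarrow> g \<in> carrier (poly_ring N) \<Longrightarrow> f * g \<in> carrier (poly_ring N)"
    "\<And>f :: (nat, 'k) mpoly. f \<in> carrier (poly_ring N) \<Longrightarrow> - f \<in> carrier (poly_ring N)"
    unfolding carrier_poly_ring by (simp, erule (1) vars_in_add, erule (1) vars_in_mult, simp add: vars_in_def)
  have Fl1: "Fl 1 (x * y)" if "Fl 1 x" for x y using Fl(4)[OF that Fl(3)[of y]] by simp
  have neg: "Fl 1 (\<psi> (- f))" if "Fl 1 (\<psi> f)" for f
  proof -
    have "\<psi> (f * (- 1)) = \<psi> f * \<psi> (- 1)" by (rule \<psi>(2))
    then show ?thesis using Fl1[OF that, of "\<psi> (- 1)"] by simp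
  qed
  have "ideal I (poly_ring N)"
  proof (rule idealI)
    show "ring (poly_ring N :: (nat, 'k) mpoly ring)" by (rule R.ring_axioms)
    show "subgroup I (add_monoid (poly_ring N))"
    proof (rule R.add.subgroupI)
      show "I \<subseteq> carrier (poly_ring N)" by (auto simp: I_def)
      show "I \<noteq> {}" using car(1) Fl(1) \<psi>0 by (auto simp: I_def)
      fix a assume a: "a \<in> I"
      have "\<ominus>\<^bsub>poly_ring N\<^esub> a = - a"
        using a car(4) by (intro R.minus_equality) (auto simp: I_def poly_ring_simps)
      then show "\<ominus>\<^bsub>poly_ring N\<^esub> a \<in> I"
        using a neg car(4) by (auto simp: I_def)
      fix b assume "b \<in> I"
      then show "a \<oplus>\<^bsub>poly_ring N\<^esub> b \<in> I"
        using a car(2) Fl(2) \<psi>(1) by (auto simp: I_def poly_ring_simps)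
    qed
    fix a x assume "a \<in> I" and x: "x \<in> carrier (poly_ring N :: (nat, 'k) mpoly ring)"
    then show "x \<otimes>\<^bsub>poly_ring N\<^esub> a \<in> I" "a \<otimes>\<^bsub>poly_ring N\<^esub> x \<in> I"
      using car(3) Fl1 \<psi>(2) by (auto simp: I_def poly_ring_simps mult.commute)
  qed
  moreover have "point_forms N P \<subseteq> I" using gen by (auto simp: I_def point_forms_def)
  ultimately have sub: "point_ideal N P \<subseteq> I" unfolding point_ideal_eq by (rule R.genideal_minimal)
  show ?thesis using f
  proof (induction m arbitrary: f)
    case 0
    then show ?case by (simp add: Fl(3))
  next
    case (Suc m)
    from Suc.prems have "f \<in> ideal_prod (poly_ring N) (ideal_power N (point_ideal N P) m) (point_ideal N P)"
      by (simp add: ideals_set_simps)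
    then show ?case
    proof (induction f rule: ideal_prod.induct)
      case (prod i j)
      then have "Fl (m + 1) (\<psi> i * \<psi> j)" using Suc.IH sub by (intro Fl(4)) (auto simp: I_def)
      then show ?case by (simp add: poly_ring_simps \<psi>)
    next
      case (sum s1 s2)
      then show ?case by (simp add: poly_ring_simps \<psi> Fl(2))
    qed
  qed
qed

lemma ideal_power_in: assumes "ideal I (poly_ring N)" shows "ideal (ideal_power N I m) (poly_ring N)"
proof -
  interpret R: cring "poly_ring N" by (rule cring_poly_ring)
  interpret S: comm_monoid "ideals_set (poly_ring N)" by (rule R.ideals_set_is_comm_monoid)
  show ?thesis using S.nat_pow_closed[of I m] assms by (simp add: ideals_set_simps)
qed

lemma ideal_power_mult:
  assumes I: "ideal I (poly_ring N)" and f: "f \<in> ideal_power N I m" and g: "g \<in> ideal_power N I n"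
  shows "f * g \<in> ideal_power N I (m + n)"
proof -
  interpret R: cring "poly_ring N" by (rule cring_poly_ring)
  interpret S: comm_monoid "ideals_set (poly_ring N)" by (rule R.ideals_set_is_comm_monoid)
  have "ideal_power N I (m + n) = ideal_prod (poly_ring N) (ideal_power N I m) (ideal_power N I n)"
    using S.nat_pow_mult[of I m n] I by (simp add: ideals_set_simps)
  then show ?thesis using ideal_prod.prod[OF f g, of "poly_ring N"] by (simp add: poly_ring_simps)
qed

lemma ideal_power_power:
  assumes I: "ideal I (poly_ring N)" and f: "f \<in> I"
  shows "f ^ m \<in> ideal_power N I m"
proof (induction m)
  case 0
  have "1 \<in> carrier (poly_ring N)" by (simp add: carrier_poly_ring)
  then show ?case by (simp add: ideals_set_simps)
next
  case (Suc m)
  then have "f ^ m \<otimes>\<^bsub>poly_ring N\<^esub> f \<in> ideal_prod (poly_ring N) (ideal_power N I m) I"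
    using f by (intro ideal_prod.prod)
  then show ?case by (simp add: ideals_set_simps poly_ring_simps mult.commute)
qed

lemma deg_le_total_degree: "deg_le (total_degree f) f"
  by (auto simp: deg_le_def total_degree_def)

lemma total_degree_le: "f \<noteq> 0 \<Longrightarrow> deg_le d f \<Longrightarrow> total_degree f \<le> d"
  by (auto simp: deg_le_def total_degree_def)

lemma initial_degree_attained:
  assumes "f \<in> J" "f \<noteq> 0"
  shows "\<exists>g\<in>J. g \<noteq> 0 \<and> total_degree g = initial_degree J"
proof -
  have "\<exists>d. \<exists>g\<in>J. g \<noteq> 0 \<and> total_degree g = d" using assms by blast
  then show ?thesis unfolding initial_degree_def by (rule LeastI_ex)
qed

lemma initial_degree_le: "f \<in> J \<Longrightarrow> f \<noteq> 0 \<Longrightarrow> initial_degree J \<le> total_degree f"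
  unfolding initial_degree_def by (rule Least_le) blast

text \<open>Fekete's lemma.\<close>

lemma subadditive_convergent:
  fixes a :: "nat \<Rightarrow> nat"
  assumes sub: "\<And>m n. a (m + n) \<le> a m + a n"
  shows "convergent (\<lambda>m. real (a m) / real m)"
proof -
  define L where "L = (INF m\<in>{1..}. real (a m) / real m)"
  have bdd: "bdd_below ((\<lambda>m. real (a m) / real m) ` {1..})" by (rule bdd_belowI[of _ 0]) auto
  have low: "L \<le> real (a m) / real m" if "m \<ge> 1" for m
    unfolding L_def using that by (intro cINF_lower bdd) auto
  have mul: "a (k * q) \<le> q * a k + a 0" for k q
  proof (induction q)
    case (Suc q)
    have "a (k * Suc q) \<le> a k + a (k * q)" using sub[of k "k * q"] by (simp add: algebra_simps)
    then show ?case using Suc by simp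
  qed simp
  have "(\<lambda>m. real (a m) / real m) \<longlonglongrightarrow> L"
  proof (rule LIMSEQ_I)
    fix e :: real assume e: "0 < e"
    have "\<exists>k\<in>{1..}. real (a k) / real k < L + e / 2"
      using e bdd unfolding L_def by (subst cINF_less_iff[symmetric]) auto
    then obtain k where k: "k \<ge> 1" "real (a k) / real k < L + e / 2" by auto
    define B where "B = real (a 0 + (\<Sum>r<k. a r))"
    have up: "real (a m) \<le> real m * (real (a k) / real k) + B" for m
    proof -
      have "a (k * (m div k) + m mod k) \<le> a (k * (m div k)) + a (m mod k)" by (rule sub)
      then have "a m \<le> m div k * a k + a 0 + a (m mod k)" using mul[of k "m div k"] by simp
      moreover have "a (m mod k) \<le> (\<Sum>r<k. a r)" using k(1) by (intro member_le_sum) auto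
      ultimately have "a m \<le> m div k * a k + (a 0 + (\<Sum>r<k. a r))" by linarith
      then have "real (a m) \<le> real (m div k * a k + (a 0 + (\<Sum>r<k. a r)))" by (rule of_nat_mono)
      then have "real (a m) \<le> real (m div k) * real (a k) + B" by (simp only: of_nat_add of_nat_mult B_def)
      moreover have "real (m div k) \<le> real m / real k" by (rule of_nat_div_le_of_nat)
      then have "real (m div k) * real (a k) \<le> real m / real k * real (a k)" by (rule mult_right_mono) simp
      ultimately show ?thesis by simp
    qed
    obtain m0 :: nat where m0: "2 * B / e < real m0" using reals_Archimedean2 by blast
    have "norm (real (a m) / real m - L) < e" if m: "m \<ge> max 1 m0" for m
    proof -
      have mp: "real m > 0" using m by simp
      have "2 * B / e < real m" using m0 m by linarith
      then have "B / real m < e / 2" using e mp by (simp add: field_simps)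
      moreover have "real (a m) / real m \<le> real (a k) / real k + B / real m"
        using divide_right_mono[OF up[of m], of "real m"] mp by (simp add: add_divide_distrib)
      ultimately have "real (a m) / real m < L + e" using k(2) by linarith
      then show ?thesis using low[of m] m by simp
    qed
    then show "\<exists>no. \<forall>n\<ge>no. norm (real (a n) / real n - L) < e" by blast
  qed
  then show ?thesis by (rule convergentI)
qed

text \<open>The form \<open>h\<close> ensures that no symbolic power is zero: \<open>h\<^sup>m\<close> lies in the \<open>m\<close>-th one. The product of elements
of the \<open>m\<close>-th and \<open>n\<close>-th symbolic power lies in the \<open>(m + n)\<close>-th one, so their initial degrees are
subadditive and the limit exists.\<close>

lemma waldschmidt_constant_ge:
  fixes X :: "(nat \<Rightarrow> 'k::field) set set"
  assumes h: "h \<noteq> 0" "h \<in> defining_ideal N X"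
    and bd: "\<And>m f. f \<noteq> 0 \<Longrightarrow> f \<in> symbolic_power N X m \<Longrightarrow> c * real m \<le> real (total_degree f)"
  shows "c \<le> waldschmidt_constant N X"
proof -
  define a where "a m = initial_degree (symbolic_power N X m)" for m
  have hm: "h ^ m \<in> symbolic_power N X m" "h ^ m \<noteq> 0" for m
    using h by (auto simp: symbolic_power_def defining_ideal_def intro!: ideal_power_power[OF ideal_point_ideal])
  have att: "\<exists>g\<in>symbolic_power N X m. g \<noteq> 0 \<and> total_degree g = a m" for m
    unfolding a_def by (rule initial_degree_attained[OF hm])
  have "a (m + n) \<le> a m + a n" for m n
  proof -
    obtain f g where f: "f \<in> symbolic_power N X m" "f \<noteq> 0" "total_degree f = a m"
      and g: "g \<in> symbolic_power N X n" "g \<noteq> 0" "total_degree g = a n" using att by meson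
    have "f * g \<in> symbolic_power N X (m + n)"
      using f(1) g(1) by (auto simp: symbolic_power_def intro!: ideal_power_mult[OF ideal_point_ideal])
    moreover have fg: "f * g \<noteq> 0" using f(2) g(2) by simp
    ultimately have "a (m + n) \<le> total_degree (f * g)" unfolding a_def by (rule initial_degree_le)
    also have "\<dots> \<le> a m + a n"
      using deg_le_mult[OF deg_le_total_degree[of f] deg_le_total_degree[of g]] f(3) g(3)
      by (intro total_degree_le fg) simp
    finally show ?thesis .
  qed
  then have "convergent (\<lambda>m. real (a m) / real m)" by (rule subadditive_convergent)
  then have "(\<lambda>m. real (a m) / real m) \<longlonglongrightarrow> lim (\<lambda>m. real (a m) / real m)" by (simp add: convergent_LIMSEQ_iff)
  moreover have "\<exists>n0. \<forall>m\<ge>n0. c \<le> real (a m) / real m"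
  proof (intro exI allI impI)
    fix m :: nat assume m: "1 \<le> m"
    obtain f where "f \<in> symbolic_power N X m" "f \<noteq> 0" "total_degree f = a m" using att by blast
    then have "c * real m \<le> real (a m)" using bd by metis
    then show "c \<le> real (a m) / real m" using m by (simp add: pos_le_divide_eq)
  qed
  ultimately have "c \<le> lim (\<lambda>m. real (a m) / real m)" by (rule LIMSEQ_le_const)
  then show ?thesis by (simp add: waldschmidt_constant_def a_def)
qed

section \<open>Forms of low degree through few points\<close>

text \<open>Exponent vectors in \<open>N + 1\<close> variables are lists of length \<open>N + 1\<close> with sum \<open>d\<close>; these are counted by stars and
bars.\<close>

lemma card_monomials:
  "finite {m. Poly_Mapping.keys m \<subseteq> {..N} \<and> monom_degree m = d}"
  "(N + d) choose N \<le> card {m. Poly_Mapping.keys m \<subseteq> {..N} \<and> monom_degree m = d}"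
proof -
  define Mon where "Mon = {m. Poly_Mapping.keys m \<subseteq> {..N} \<and> monom_degree m = d}"
  have "inj_on (\<lambda>m. restrict (Poly_Mapping.lookup m) {..N}) Mon"
  proof (rule inj_onI)
    fix m m' assume m: "m \<in> Mon" "m' \<in> Mon"
      and e: "restrict (Poly_Mapping.lookup m) {..N} = restrict (Poly_Mapping.lookup m') {..N}"
    show "m = m'"
    proof (rule poly_mapping_eqI)
      fix i
      show "Poly_Mapping.lookup m i = Poly_Mapping.lookup m' i"
      proof (cases "i \<le> N")
        case True
        then show ?thesis using fun_cong[OF e, of i] by simp
      next
        case False
        then have "i \<notin> Poly_Mapping.keys m" "i \<notin> Poly_Mapping.keys m'" using m by (auto simp: Mon_def)
        then show ?thesis by (simp add: in_keys_iff)
      qed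
    qed
  qed
  moreover have "(\<lambda>m. restrict (Poly_Mapping.lookup m) {..N}) ` Mon \<subseteq> {..N} \<rightarrow>\<^sub>E {..d}"
    using lookup_le_monom_degree by (auto simp: Mon_def split: if_splits)
  ultimately show fin: "finite {m. Poly_Mapping.keys m \<subseteq> {..N} \<and> monom_degree m = d}"
    unfolding Mon_def[symmetric] by (rule inj_on_finite) (auto intro: finite_PiE)
  define F where "F l = (\<Sum>i\<in>{..N}. Poly_Mapping.single i (l ! i))" for l :: "nat list"
  have lF: "Poly_Mapping.lookup (F l) i = (if i \<le> N then l ! i else 0)" for l i
    by (simp add: F_def lookup_sum lookup_single when_def)
  have "card {l::nat list. length l = Suc N \<and> sum_list l = d} \<le> card Mon"
  proof (rule card_inj_on_le[of F])
    show "inj_on F {l. length l = Suc N \<and> sum_list l = d}"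
    proof (rule inj_onI)
      fix l l' assume l: "l \<in> {l. length l = Suc N \<and> sum_list l = d}" "l' \<in> {l. length l = Suc N \<and> sum_list l = d}"
        and e: "F l = F l'"
      show "l = l'"
      proof (rule nth_equalityI)
        fix i assume "i < length l"
        then show "l ! i = l' ! i" using l lF[of l i] lF[of l' i] e by simp
      qed (use l in simp)
    qed
    show "F ` {l. length l = Suc N \<and> sum_list l = d} \<subseteq> Mon"
    proof safe
      fix l :: "nat list" assume l: "length l = Suc N" "d = sum_list l"
      have k: "Poly_Mapping.keys (F l) \<subseteq> {..N}" by (auto simp: in_keys_iff lF split: if_splits)
      have "monom_degree (F l) = (\<Sum>i\<in>{..N}. l ! i)"
        by (subst monom_degree_superset[OF _ k]) (auto simp: lF)
      also have "\<dots> = sum_list l" using l by (simp add: sum_list_sum_nth atLeast0LessThan lessThan_Suc_atMost)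
      finally show "F l \<in> Mon" using k by (simp add: Mon_def l)
    qed
    show "finite Mon" using fin by (simp add: Mon_def)
  qed
  moreover have "card {l::nat list. length l = Suc N \<and> sum_list l = d} = (N + d) choose N"
    by (simp add: card_length_sum_list add.commute binomial_symmetric[of d "N + d"])
  ultimately show "(N + d) choose N \<le> card {m. Poly_Mapping.keys m \<subseteq> {..N} \<and> monom_degree m = d}"
    by (simp add: Mon_def)
qed

lemma monom_val_scale: "monom_val (\<lambda>i. c * a i) m = c ^ monom_degree m * monom_val a m"
  unfolding monom_val_def monom_degree_def by (simp add: power_mult_distrib prod.distrib power_sum)

lemma eval_homogeneous_scale:
  assumes "homogeneous d f"
  shows "eval_mpoly f (\<lambda>i. c * a i) = c ^ d * eval_mpoly f a"
  unfolding eval_mpoly_ev ev_def monom_val_scale sum_distrib_left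
  using assms by (intro sum.cong) (auto simp: homogeneous_def)

text \<open>There are at least \<open>C(N + d, N)\<close> coefficients, and every point imposes one linear condition on them.\<close>

lemma ex_form_through_points:
  fixes X :: "(nat \<Rightarrow> 'k::field) set set"
  assumes X: "finite X" "card X < (N + d) choose N" and proj: "X \<subseteq> proj_space N"
  shows "\<exists>f\<in>defining_ideal N X. f \<noteq> 0 \<and> total_degree f \<le> d"
proof -
  define Mon where "Mon = {m. Poly_Mapping.keys m \<subseteq> {..N} \<and> monom_degree m = d}"
  have fM: "finite Mon" and cM: "card X < card Mon" using card_monomials[of N d] X(2) by (auto simp: Mon_def)
  have "\<exists>a. P = {\<lambda>i. c * a i | c. c \<noteq> 0}" if "P \<in> X" for P
  proof -
    have "P \<in> proj_space N" using that proj by blast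
    then show ?thesis unfolding proj_space_def by blast
  qed
  then have "\<forall>P\<in>X. \<exists>a. P = {\<lambda>i. c * a i | c. c \<noteq> 0}" by blast
  from bchoice[OF this] obtain a where a: "\<And>P. P \<in> X \<Longrightarrow> P = {\<lambda>i. c * a P i | c. c \<noteq> 0}"
    by (elim exE) (rule that, erule (1) bspec)
  have "\<exists>v. (\<forall>m\<in>Mon. v m \<in> (UNIV :: 'k set)) \<and> (\<exists>m\<in>Mon. v m \<noteq> 0) \<and> (\<forall>P\<in>X. (\<Sum>m\<in>Mon. monom_val (a P) m * v m) = 0)"
    by (rule ex_kernel_vector) (use X fM cM in \<open>auto simp: is_subring_def\<close>)
  then obtain v where v: "\<exists>m\<in>Mon. v m \<noteq> 0" "\<And>P. P \<in> X \<Longrightarrow> (\<Sum>m\<in>Mon. monom_val (a P) m * v m) = 0" by blast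
  define f where "f = (\<Sum>m\<in>Mon. Poly_Mapping.single m (v m))"
  have lf: "Poly_Mapping.lookup f m = (if m \<in> Mon then v m else 0)" for m
    using fM by (simp add: f_def lookup_sum lookup_single when_def)
  have kf: "Poly_Mapping.keys f \<subseteq> Mon" by (auto simp: in_keys_iff lf split: if_splits)
  have f0: "f \<noteq> 0"
  proof
    assume "f = 0"
    then have "Poly_Mapping.lookup f m = 0" for m by simp
    then show False using v(1) lf by metis
  qed
  have hom: "homogeneous d f" using kf by (auto simp: homogeneous_def Mon_def)
  have car: "f \<in> carrier (poly_ring N)" using kf by (auto simp: carrier_poly_ring vars_in_def Mon_def)
  have "f \<in> point_ideal N P" if P: "P \<in> X" for P
  proof -
    have "eval_mpoly f (a P) = (\<Sum>m\<in>Mon. Poly_Mapping.lookup f m * monom_val (a P) m)"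
      unfolding eval_mpoly_ev by (rule ev_superset[OF is_hom_id fM kf])
    also have "\<dots> = 0" using v(2)[OF P] by (simp add: lf mult.commute)
    finally have zero: "eval_mpoly f (a P) = 0" .
    have "eval_mpoly f b = 0" if "b \<in> P" for b
    proof -
      have "b \<in> {\<lambda>i. c * a P i | c. c \<noteq> 0}" using that by (subst (asm) a[OF P])
      then obtain c where "b = (\<lambda>i. c * a P i)" by blast
      then show ?thesis using zero by (simp add: eval_homogeneous_scale[OF hom])
    qed
    then have "f \<in> point_forms N P" using hom car by (auto simp: point_forms_def)
    then show ?thesis using point_forms_subset by blast
  qed
  then have "f \<in> defining_ideal N X" by (simp add: defining_ideal_def)
  moreover have "total_degree f \<le> d" using hom by (intro total_degree_le f0) (auto simp: homogeneous_def deg_le_def)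
  ultimately show ?thesis using f0 by blast
qed

section \<open>Polynomials in the coordinates of the points and in the Chow coordinates\<close>

text \<open>The module over \<open>C\<close> generated by \<open>B\<close>; for infinite \<open>B\<close> the sum is \<open>0\<close> by convention.\<close>

definition fun_span :: "'r::comm_ring_1 set \<Rightarrow> 'r set \<Rightarrow> 'r set" where
  "fun_span C B = {\<Sum>v\<in>B. g v * v | g. \<forall>v\<in>B. g v \<in> C}"

lemma fun_spanI: "(\<And>v. v \<in> B \<Longrightarrow> g v \<in> C) \<Longrightarrow> (\<Sum>v\<in>B. g v * v) \<in> fun_span C B"
  unfolding fun_span_def by blast

lemma fun_span_add:
  assumes C: "is_subring C" and "x \<in> fun_span C B" "y \<in> fun_span C B" shows "x + y \<in> fun_span C B"
proof -
  obtain g h where "x = (\<Sum>v\<in>B. g v * v)" "\<forall>v\<in>B. g v \<in> C" "y = (\<Sum>v\<in>B. h v * v)" "\<forall>v\<in>B. h v \<in> C"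
    using assms by (auto simp: fun_span_def)
  then show ?thesis
    using fun_spanI[of B "\<lambda>v. g v + h v" C] is_subringD(4)[OF C] by (simp add: distrib_right sum.distrib)
qed

lemma fun_span_0: assumes C: "is_subring C" shows "0 \<in> fun_span C B"
  using fun_spanI[of B "\<lambda>_. 0" C] is_subringD(1)[OF C] by simp

lemma fun_span_sum:
  assumes C: "is_subring C" and "\<And>i. i \<in> I \<Longrightarrow> f i \<in> fun_span C B" shows "sum f I \<in> fun_span C B"
  using assms(2) by (induction I rule: infinite_finite_induct) (auto simp: fun_span_0[OF C] fun_span_add[OF C])

lemma fun_span_base:
  assumes C: "is_subring C" and "finite B" "v \<in> B" "c \<in> C" shows "c * v \<in> fun_span C B"
proof -
  have "(\<Sum>u\<in>B. (if u = v then c else 0) * u) \<in> fun_span C B"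
    using assms is_subringD(1)[OF C] by (intro fun_spanI) auto
  also have "(\<Sum>u\<in>B. (if u = v then c else 0) * u) = (\<Sum>u\<in>B. if u = v then c * u else 0)"
    by (intro sum.cong) auto
  also have "\<dots> = c * v" using assms by simp
  finally show ?thesis .
qed

text \<open>The combinations of \<open>1, z, \<dots>, z\<^sup>s\<^sup>-\<^sup>1\<close> with coefficients in \<open>R\<close> form a ring, since the relation for \<open>z\<^sup>s\<close> makes
them closed under multiplication by \<open>z\<close>. If \<open>R\<close> is a finitely generated \<open>C\<close>-module, then so is this ring,
generated by the products of the generators of \<open>R\<close> with these powers.\<close>

lemma adjoin_integral:
  fixes z :: "'r::comm_ring_1"
  assumes C: "is_subring C" and R: "is_subring R" "C \<subseteq> R" and B: "finite B" "R \<subseteq> fun_span C B"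
    and s: "s \<ge> 1" and z: "z ^ s = (\<Sum>k<s. d k * z ^ k)" "\<And>k. k < s \<Longrightarrow> d k \<in> R"
  shows "\<exists>R' B'. is_subring R' \<and> R \<subseteq> R' \<and> z \<in> R' \<and> finite B' \<and> R' \<subseteq> fun_span C B'"
proof -
  define R' where "R' = {\<Sum>k<s. r k * z ^ k | r. \<forall>k<s. r k \<in> R}"
  have R'I: "(\<Sum>k<s. r k * z ^ k) \<in> R'" if "\<And>k. k < s \<Longrightarrow> r k \<in> R" for r
    unfolding R'_def using that by blast
  have add: "x + y \<in> R'" if x: "x \<in> R'" and y: "y \<in> R'" for x y
  proof -
    obtain r r' where "x = (\<Sum>k<s. r k * z ^ k)" "\<forall>k<s. r k \<in> R" "y = (\<Sum>k<s. r' k * z ^ k)" "\<forall>k<s. r' k \<in> R"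
      using x y by (auto simp: R'_def)
    then show ?thesis using R'I[of "\<lambda>k. r k + r' k"] is_subringD(4)[OF R(1)] by (simp add: distrib_right sum.distrib)
  qed
  have smul: "a * x \<in> R'" if a: "a \<in> R" and x: "x \<in> R'" for a x
  proof -
    obtain r where "x = (\<Sum>k<s. r k * z ^ k)" "\<forall>k<s. r k \<in> R" using x by (auto simp: R'_def)
    then show ?thesis using R'I[of "\<lambda>k. a * r k"] is_subringD(6)[OF R(1)] a by (simp add: sum_distrib_left mult.assoc)
  qed
  obtain s' where s': "s = Suc s'" using s by (cases s) auto
  have zmul: "z * x \<in> R'" if x: "x \<in> R'" for x
  proof -
    obtain r where r: "x = (\<Sum>k<s. r k * z ^ k)" "\<And>k. k < s \<Longrightarrow> r k \<in> R" using x by (auto simp: R'_def)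
    have "z * x = (\<Sum>k<s. r k * z ^ Suc k)" by (simp add: r(1) sum_distrib_left mult_ac)
    also have "\<dots> = (\<Sum>k<s'. r k * z ^ Suc k) + r s' * z ^ s" by (simp add: s')
    also have "(\<Sum>k<s'. r k * z ^ Suc k) = (\<Sum>k<s. (if k = 0 then 0 else r (k - 1)) * z ^ k)"
      unfolding s' by (subst sum.lessThan_Suc_shift) simp
    also have "r s' * z ^ s = (\<Sum>k<s. r s' * d k * z ^ k)" by (simp add: z(1) sum_distrib_left mult.assoc)
    also have "(\<Sum>k<s. (if k = 0 then 0 else r (k - 1)) * z ^ k) + (\<Sum>k<s. r s' * d k * z ^ k)
        = (\<Sum>k<s. ((if k = 0 then 0 else r (k - 1)) + r s' * d k) * z ^ k)"
      by (simp add: distrib_right sum.distrib)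
    also have "\<dots> \<in> R'"
      using r(2) z(2) s' by (intro R'I is_subringD(4,6)[OF R(1)]) (auto intro: is_subringD(1)[OF R(1)])
    finally show ?thesis .
  qed
  have zpow: "z ^ k * x \<in> R'" if "x \<in> R'" for k x
    using that by (induction k) (auto simp: mult.assoc intro: zmul)
  have RR': "R \<subseteq> R'"
  proof
    fix a assume a: "a \<in> R"
    have "(\<Sum>k<s. (if k = 0 then a else 0) * z ^ k) \<in> R'"
      using a is_subringD(1)[OF R(1)] by (intro R'I) auto
    moreover have "(\<Sum>k<s. (if k = 0 then a else 0) * z ^ k) = a"
      unfolding s' sum.lessThan_Suc_shift by simp
    ultimately show "a \<in> R'" by simp
  qed
  have sumR': "(\<And>k. k \<in> K \<Longrightarrow> f k \<in> R') \<Longrightarrow> sum f K \<in> R'" for f and K :: "nat set"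
    using RR' is_subringD(1)[OF R(1)] by (induction K rule: infinite_finite_induct) (auto intro: add)
  have mul: "x * y \<in> R'" if x: "x \<in> R'" and y: "y \<in> R'" for x y
  proof -
    obtain r where r: "x = (\<Sum>k<s. r k * z ^ k)" "\<And>k. k < s \<Longrightarrow> r k \<in> R" using x by (auto simp: R'_def)
    have "x * y = (\<Sum>k<s. r k * (z ^ k * y))" by (simp add: r(1) sum_distrib_right mult.assoc)
    also have "\<dots> \<in> R'" by (intro sumR' smul zpow y r(2)) auto
    finally show ?thesis .
  qed
  have one: "1 \<in> R'" using RR' is_subringD(2)[OF R(1)] by auto
  have sub: "is_subring R'" unfolding is_subring_def
  proof (intro conjI ballI one mul)
    fix x y assume xy: "x \<in> R'" "y \<in> R'"
    have "- 1 \<in> R" by (intro is_subringD(2,3)[OF R(1)])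
    then have "x + (- 1) * y \<in> R'" by (intro add smul xy)
    then show "x - y \<in> R'" by simp
  qed
  have zR': "z \<in> R'" using zmul[OF one] by simp
  define B' where "B' = (\<lambda>(v, k). v * z ^ k) ` (B \<times> {..<s})"
  have finB': "finite B'" using B(1) by (simp add: B'_def)
  have "R' \<subseteq> fun_span C B'"
  proof
    fix x assume "x \<in> R'"
    then obtain r where r: "x = (\<Sum>k<s. r k * z ^ k)" "\<And>k. k < s \<Longrightarrow> r k \<in> R" by (auto simp: R'_def)
    have "r k * z ^ k \<in> fun_span C B'" if k: "k < s" for k
    proof -
      obtain g where g: "r k = (\<Sum>v\<in>B. g v * v)" "\<And>v. v \<in> B \<Longrightarrow> g v \<in> C"
        using r(2)[OF k] B(2) unfolding fun_span_def by blast
      have "r k * z ^ k = (\<Sum>v\<in>B. g v * (v * z ^ k))" by (simp add: g(1) sum_distrib_right mult.assoc)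
      also have "\<dots> \<in> fun_span C B'"
        using g(2) k by (intro fun_span_sum[OF C] fun_span_base[OF C finB']) (auto simp: B'_def)
      finally show ?thesis .
    qed
    then show "x \<in> fun_span C B'" unfolding r(1) by (intro fun_span_sum[OF C]) auto
  qed
  then show ?thesis using sub RR' zR' finB' by blast
qed

section \<open>The Chow form as a function of the points\<close>

lemma linear_form_eq: "linear_form N a = (\<Sum>i\<le>N. const (a i) * var i)"
  by (simp add: linear_form_def const_def var_def mult_single)

lemma linear_form_scale: "linear_form N (\<lambda>i. c * a i) = const c * linear_form N a"
  by (simp add: linear_form_eq const_mult sum_distrib_left mult.assoc)

text \<open>The Chow form as a function of chosen coordinate vectors; unlike the form of a cycle it depends
polynomially on its argument.\<close>

definition chow_prod :: "nat \<Rightarrow> nat \<Rightarrow> (nat \<times> nat \<Rightarrow> 'k::field) \<Rightarrow> (nat, 'k) mpoly" where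
  "chow_prod N s a = (\<Prod>j<s. linear_form N (\<lambda>i. a (j, i)))"

lemma lookup_var_mult':
  "Poly_Mapping.lookup (var i * g) \<mu> =
    (if i \<in> Poly_Mapping.keys \<mu> then Poly_Mapping.lookup g (\<mu> - Poly_Mapping.single i 1) else 0)"
proof (cases "i \<in> Poly_Mapping.keys \<mu>")
  case True
  then have "\<mu> = Poly_Mapping.single i 1 + (\<mu> - Poly_Mapping.single i 1)"
    by (intro poly_mapping_eqI) (auto simp: lookup_add lookup_minus lookup_single when_def in_keys_iff)
  then show ?thesis using True lookup_var_mult[of i g "\<mu> - Poly_Mapping.single i 1"] by simp
next
  case False
  have "\<mu> \<notin> Poly_Mapping.keys (var i * g)"
  proof
    assume "\<mu> \<in> Poly_Mapping.keys (var i * g)"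
    then obtain \<nu> where "\<mu> = Poly_Mapping.single i 1 + \<nu>" using keys_var_mult[of \<mu> i g] by blast
    then show False using False by (simp add: in_keys_iff lookup_add)
  qed
  then show ?thesis using False by (simp add: in_keys_iff)
qed

lemma lookup_linear_form_mult:
  "Poly_Mapping.lookup (linear_form N a * g) \<mu> = (\<Sum>i\<le>N. a i *
    (if i \<in> Poly_Mapping.keys \<mu> then Poly_Mapping.lookup g (\<mu> - Poly_Mapping.single i 1) else 0))"
  by (simp add: linear_form_eq sum_distrib_right lookup_sum mult.assoc lookup_const_mult lookup_var_mult')

lemma chow_prod_Suc: "chow_prod N (Suc s) a = linear_form N (\<lambda>i. a (s, i)) * chow_prod N s a"
  by (simp add: chow_prod_def mult.commute)

lemma polyfun_chow_coeff: "polyfun (\<lambda>a :: nat \<times> nat \<Rightarrow> 'k::field. Poly_Mapping.lookup (chow_prod N s a) \<mu>)"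
proof (induction s arbitrary: \<mu>)
  case 0
  show ?case by (simp add: chow_prod_def polyfun_const)
next
  case (Suc s)
  have "polyfun (\<lambda>a :: nat \<times> nat \<Rightarrow> 'k. if i \<in> Poly_Mapping.keys \<mu> then Poly_Mapping.lookup (chow_prod N s a) (\<mu> - Poly_Mapping.single i 1) else 0)" for i
    using Suc[of "\<mu> - Poly_Mapping.single i 1"]
    by (cases "i \<in> Poly_Mapping.keys \<mu>") (simp_all add: polyfun_const)
  then show ?case unfolding chow_prod_Suc lookup_linear_form_mult
    by (intro polyfun_sum polyfun_mult polyfun_coord)
qed

text \<open>This coefficient is nonzero exactly if all points lie in the chart \<open>x\<^sub>0 \<noteq> 0\<close>.\<close>

lemma chow_coeff_top: "Poly_Mapping.lookup (chow_prod N s a) (Poly_Mapping.single 0 s) = (\<Prod>j<s. a (j, 0))"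
proof (induction s)
  case 0
  show ?case by (simp add: chow_prod_def)
next
  case (Suc s)
  have e: "Poly_Mapping.single 0 (Suc s) - Poly_Mapping.single 0 1 = (Poly_Mapping.single 0 s :: nat \<Rightarrow>\<^sub>0 nat)"
    by (rule poly_mapping_eqI) (simp add: lookup_minus lookup_single when_def)
  have "Poly_Mapping.lookup (chow_prod N (Suc s) a) (Poly_Mapping.single 0 (Suc s))
      = (\<Sum>i\<le>N. if i = 0 then a (s, 0) * Poly_Mapping.lookup (chow_prod N s a) (Poly_Mapping.single 0 s) else 0)"
    unfolding chow_prod_Suc lookup_linear_form_mult by (intro sum.cong) (auto simp: e[unfolded One_nat_def])
  then show ?case by (simp add: Suc mult.commute)
qed

lemma homogeneous_mult: "homogeneous d f \<Longrightarrow> homogeneous e g \<Longrightarrow> homogeneous (d + e) (f * g)"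
  unfolding homogeneous_def by (rule keys_mult_all) (auto simp: monom_degree_add)

lemma homogeneous_add: "homogeneous d f \<Longrightarrow> homogeneous d g \<Longrightarrow> homogeneous d (f + g)"
  unfolding homogeneous_def by (rule keys_add_all)

lemma homogeneous_const: "homogeneous 0 (const c)"
  by (auto simp: homogeneous_def const_def)

lemma homogeneous_var: "homogeneous 1 (var v)"
  by (auto simp: homogeneous_def var_def)

lemma homogeneous_power: "homogeneous d f \<Longrightarrow> homogeneous (n * d) (f ^ n)"
proof (induction n)
  case 0
  then show ?case using homogeneous_const[of 1] by simp
qed (auto intro: homogeneous_mult)

lemma homogeneous_0: "homogeneous d 0"
  by (simp add: homogeneous_def)

lemma homogeneous_sum: "(\<And>i. i \<in> I \<Longrightarrow> homogeneous d (f i)) \<Longrightarrow> homogeneous d (sum f I)"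
  by (induction I rule: infinite_finite_induct) (auto intro!: homogeneous_add homogeneous_0)

lemma homogeneous_linear_form: "homogeneous 1 (linear_form N a)"
  unfolding linear_form_eq
  by (rule homogeneous_sum) (use homogeneous_mult[OF homogeneous_const homogeneous_var] in simp)

lemma chow_prod_homogeneous: "homogeneous s (chow_prod N s a)"
proof (induction s)
  case 0
  then show ?case using homogeneous_const[of 1] by (simp add: chow_prod_def)
next
  case (Suc s)
  then show ?case using homogeneous_mult[OF homogeneous_linear_form Suc] unfolding chow_prod_Suc by simp
qed

lemma vars_in_chow_prod: "vars_in {..N} (chow_prod N s a)"
  unfolding chow_prod_def linear_form_eq
  by (intro vars_in_prod vars_in_sum vars_in_mult vars_in_const vars_in_var) auto

lemma monom_val_mult: "monom_val (\<lambda>v. \<sigma> v * \<tau> v) m = monom_val \<sigma> m * monom_val \<tau> m"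
  by (simp add: monom_val_def power_mult_distrib prod.distrib)

lemma monom_val_one_var: "monom_val (\<lambda>v. if v = w then t else 1) m = t ^ Poly_Mapping.lookup m w"
proof -
  have "monom_val (\<lambda>v. if v = w then t else 1) m = (\<Prod>v\<in>insert w (Poly_Mapping.keys m). (if v = w then t else 1) ^ Poly_Mapping.lookup m v)"
    by (rule monom_val_superset) auto
  also have "\<dots> = (\<Prod>v\<in>insert w (Poly_Mapping.keys m). if v = w then t ^ Poly_Mapping.lookup m w else 1)"
    by (intro prod.cong) auto
  finally show ?thesis by simp
qed

text \<open>Coordinate vectors of the points in the chart \<open>x\<^sub>0 = 1\<close>.\<close>

definition dehom :: "(nat \<times> nat \<Rightarrow> 'k::field) \<Rightarrow> nat \<times> nat \<Rightarrow> 'k" where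
  "dehom y = (\<lambda>(j, i). if i = 0 then 1 else y (j, i))"

text \<open>Each affine coordinate of each point is integral over the coefficients of the Chow form. With
\<open>z = y\<^sub>j\<^sub>i\<close>, the linear form of the \<open>j\<close>-th point vanishes at the vector with \<open>u\<^sub>0 = z\<close>, \<open>u\<^sub>i = - 1\<close> and all other
entries \<open>0\<close>. So the Chow form vanishes there, and its coefficient at \<open>u\<^sub>0\<^sup>s\<close> is \<open>1\<close> in the affine chart.\<close>

lemma coordinate_integral:
  fixes j i :: nat
  assumes j: "j < s" and i: "1 \<le> i" "i \<le> N"
  defines "Mon \<equiv> {m. Poly_Mapping.keys m \<subseteq> {..N} \<and> monom_degree m = s} - {Poly_Mapping.single 0 s}"
  shows "\<exists>\<epsilon> :: (nat \<Rightarrow>\<^sub>0 nat) \<Rightarrow> 'k::field. \<forall>y. y (j, i) ^ s =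
    (\<Sum>k<s. (\<Sum>m\<in>{m \<in> Mon. Poly_Mapping.lookup m 0 = k}. \<epsilon> m * Poly_Mapping.lookup (chow_prod N s (dehom y)) m) * y (j, i) ^ k)"
proof -
  define u2 :: "nat \<Rightarrow> 'k" where "u2 v = (if v = 0 then 1 else if v = i then - 1 else 0)" for v
  have rel: "y (j, i) ^ s =
    (\<Sum>k<s. (\<Sum>m\<in>{m \<in> Mon. Poly_Mapping.lookup m 0 = k}. - monom_val u2 m * Poly_Mapping.lookup (chow_prod N s (dehom y)) m) * y (j, i) ^ k)"
    for y :: "nat \<times> nat \<Rightarrow> 'k"
  proof -
    define z where "z = y (j, i)"
    \<comment> \<open>the vector at which the Chow form vanishes; splitting off the powers of \<open>z\<close> leaves constants\<close>
    define u where "u v = (if v = 0 then z else 1) * u2 v" for v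
    define F where "F = chow_prod N s (dehom y)"
    define w0 :: "nat \<Rightarrow>\<^sub>0 nat" where "w0 = Poly_Mapping.single 0 s"
    define M where "M = {m. Poly_Mapping.keys m \<subseteq> {..N} \<and> monom_degree m = s}"
    have finM: "finite M" unfolding M_def by (rule card_monomials(1))
    have w0M: "w0 \<in> M" by (auto simp: w0_def M_def)
    have kF: "Poly_Mapping.keys F \<subseteq> M"
      using chow_prod_homogeneous[of s N "dehom y"] vars_in_chow_prod[of N s "dehom y"]
      by (auto simp: M_def F_def homogeneous_def vars_in_def)
    have mv: "monom_val u m = z ^ Poly_Mapping.lookup m 0 * monom_val u2 m" for m
      unfolding u_def monom_val_mult monom_val_one_var ..
    have "ev (\<lambda>c. c) u F = (\<Prod>j'<s. \<Sum>i'\<le>N. dehom y (j', i') * u i')"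
      unfolding F_def chow_prod_def linear_form_eq
      by (simp add: ev_prod[OF is_hom_id] ev_sum[OF is_hom_id] ev_mult[OF is_hom_id] ev_const[OF is_hom_id] ev_var[OF is_hom_id])
    also have "\<dots> = 0"
    proof (rule prod_zero)
      have "(\<Sum>i'\<le>N. dehom y (j, i') * u i') = (\<Sum>i'\<in>{0, i}. dehom y (j, i') * u i')"
        using i by (intro sum.mono_neutral_right) (auto simp: u_def u2_def)
      also have "\<dots> = 0" using i by (simp add: u_def u2_def dehom_def z_def)
      finally show "\<exists>j'\<in>{..<s}. (\<Sum>i'\<le>N. dehom y (j', i') * u i') = 0" using j by auto
    qed simp
    also have "ev (\<lambda>c. c) u F = (\<Sum>m\<in>M. Poly_Mapping.lookup F m * monom_val u m)"
      by (rule ev_superset[OF is_hom_id finM kF])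
    also have "\<dots> = Poly_Mapping.lookup F w0 * monom_val u w0 + (\<Sum>m\<in>M - {w0}. Poly_Mapping.lookup F m * monom_val u m)"
      by (rule sum.remove[OF finM w0M])
    also have "Poly_Mapping.lookup F w0 = 1" unfolding F_def w0_def chow_coeff_top by (simp add: dehom_def)
    also have "monom_val u w0 = z ^ s" by (simp add: w0_def u_def u2_def)
    finally have "z ^ s = - (\<Sum>m\<in>M - {w0}. Poly_Mapping.lookup F m * monom_val u m)"
      by (simp add: eq_neg_iff_add_eq_0)
    also have "\<dots> = (\<Sum>m\<in>Mon. (- monom_val u2 m * Poly_Mapping.lookup F m) * z ^ Poly_Mapping.lookup m 0)"
      unfolding Mon_def M_def[symmetric] w0_def[symmetric] mv by (simp add: sum_negf[symmetric] mult_ac)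
    also have "\<dots> = (\<Sum>k<s. \<Sum>m\<in>{m \<in> Mon. Poly_Mapping.lookup m 0 = k}. (- monom_val u2 m * Poly_Mapping.lookup F m) * z ^ Poly_Mapping.lookup m 0)"
    proof (rule sum.group[symmetric])
      show "finite Mon" using finM by (simp add: Mon_def M_def)
      show "(\<lambda>m. Poly_Mapping.lookup m 0) ` Mon \<subseteq> {..<s}"
      proof safe
        fix m assume m: "m \<in> Mon"
        then have d: "monom_degree m = s" by (simp add: Mon_def)
        have "Poly_Mapping.lookup m 0 \<noteq> s"
        proof
          assume e: "Poly_Mapping.lookup m 0 = s"
          have "m = Poly_Mapping.single 0 s"
          proof (rule poly_mapping_eqI)
            fix v
            show "Poly_Mapping.lookup m v = Poly_Mapping.lookup (Poly_Mapping.single 0 s) v"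
            proof (cases "v = 0")
              case False
              have "(\<Sum>v\<in>{0, v}. Poly_Mapping.lookup m v) \<le> (\<Sum>v\<in>insert v (insert 0 (Poly_Mapping.keys m)). Poly_Mapping.lookup m v)"
                by (intro sum_mono2) auto
              also have "\<dots> = monom_degree m" by (rule monom_degree_superset[symmetric]) auto
              finally show ?thesis using False e d by (simp add: lookup_single)
            qed (simp add: e)
          qed
          then show False using m by (simp add: Mon_def)
        qed
        then show "Poly_Mapping.lookup m 0 < s" using lookup_le_monom_degree[of m 0] d by simp
      qed
    qed simp
    also have "\<dots> = (\<Sum>k<s. (\<Sum>m\<in>{m \<in> Mon. Poly_Mapping.lookup m 0 = k}. - monom_val u2 m * Poly_Mapping.lookup F m) * z ^ k)"
      unfolding sum_distrib_right by (intro sum.cong) auto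
    finally show ?thesis by (simp only: z_def F_def)
  qed
  show ?thesis by (rule exI[of _ "\<lambda>m. - monom_val u2 m"], rule allI, rule rel)
qed

text \<open>Composition with this map leaves a polynomial function only those coordinates that are determined by the
cycle up to the order of the points; the others are not integral over the Chow coordinates.\<close>

definition restr :: "nat \<Rightarrow> nat \<Rightarrow> (nat \<times> nat \<Rightarrow> 'k::field) \<Rightarrow> nat \<times> nat \<Rightarrow> 'k" where
  "restr N s y = (\<lambda>p. if p \<in> {..<s} \<times> {1..N} then y p else 0)"

definition chow_functions :: "nat \<Rightarrow> nat \<Rightarrow> ((nat \<times> nat \<Rightarrow> 'k::field) \<Rightarrow> 'k) set" where
  "chow_functions N s = {(\<lambda>y. \<Psi> (Poly_Mapping.lookup (chow_prod N s (dehom y)))) | \<Psi>. polyfun \<Psi>}"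

lemma chow_functionsI: "polyfun \<Psi> \<Longrightarrow> (\<lambda>y. \<Psi> (Poly_Mapping.lookup (chow_prod N s (dehom y)))) \<in> chow_functions N s"
  unfolding chow_functions_def by blast

lemma is_subring_chow_functions: "is_subring (chow_functions N s :: ((nat \<times> nat \<Rightarrow> 'k::field) \<Rightarrow> 'k) set)"
  unfolding is_subring_def
proof (intro conjI ballI)
  show "1 \<in> (chow_functions N s :: ((nat \<times> nat \<Rightarrow> 'k) \<Rightarrow> 'k) set)"
    using chow_functionsI[OF polyfun_const[of "1::'k"], of N s] by (simp add: one_fun_def)
  fix f g :: "(nat \<times> nat \<Rightarrow> 'k) \<Rightarrow> 'k" assume "f \<in> chow_functions N s" "g \<in> chow_functions N s"
  then obtain \<Psi> \<Psi>' where P: "polyfun \<Psi>" "f = (\<lambda>y. \<Psi> (Poly_Mapping.lookup (chow_prod N s (dehom y))))"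
    "polyfun \<Psi>'" "g = (\<lambda>y. \<Psi>' (Poly_Mapping.lookup (chow_prod N s (dehom y))))"
    unfolding chow_functions_def by blast
  show "f - g \<in> chow_functions N s"
    using chow_functionsI[OF polyfun_diff[OF P(1,3)], of N s] by (simp add: P fun_diff_def)
  show "f * g \<in> chow_functions N s"
    using chow_functionsI[OF polyfun_mult[OF P(1,3)], of N s] by (simp add: P times_fun_def)
qed

lemma polyfun_dehom: "polyfun g \<Longrightarrow> polyfun (\<lambda>y. g (dehom y))"
proof -
  assume g: "polyfun g"
  have "polyfun (\<lambda>y. dehom y p)" for p :: "nat \<times> nat"
    by (cases p; cases "snd p = 0") (simp_all add: dehom_def polyfun_const polyfun_coord)
  from polyfun_compose[OF g this] show ?thesis by simp
qed

lemma polyfun_chow_functions: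
  assumes "f \<in> chow_functions N s" shows "polyfun f"
proof -
  obtain \<Psi> where P: "polyfun \<Psi>" "f = (\<lambda>y. \<Psi> (Poly_Mapping.lookup (chow_prod N s (dehom y))))"
    using assms unfolding chow_functions_def by blast
  have "polyfun (\<lambda>y :: nat \<times> nat \<Rightarrow> 'a. Poly_Mapping.lookup (chow_prod N s (dehom y)) m)" for m
    by (rule polyfun_dehom[OF polyfun_chow_coeff])
  from polyfun_compose[OF P(1) this] show ?thesis by (simp add: P)
qed

lemma polyfun_restr: "polyfun g \<Longrightarrow> polyfun (\<lambda>y. g (restr N s y))"
proof -
  assume g: "polyfun g"
  have "polyfun (\<lambda>y. restr N s y p)" for p
    by (cases "p \<in> {..<s} \<times> {1..N}") (simp_all add: restr_def polyfun_const polyfun_coord)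
  from polyfun_compose[OF g this] show ?thesis by simp
qed

text \<open>Adjoining the coordinates one at a time keeps the ring a finite module over the Chow coordinates.\<close>

lemma ex_finite_extension:
  assumes I: "finite I" "I \<subseteq> {..<s} \<times> {1..N}"
  shows "\<exists>R B. is_subring (R :: ((nat \<times> nat \<Rightarrow> 'k::field) \<Rightarrow> 'k) set) \<and> chow_functions N s \<subseteq> R \<and>
    (\<forall>p\<in>I. (\<lambda>y. y p) \<in> R) \<and> finite B \<and> R \<subseteq> fun_span (chow_functions N s) B"
  using I
proof (induction I rule: finite_induct)
  case empty
  let ?C = "chow_functions N s :: ((nat \<times> nat \<Rightarrow> 'k) \<Rightarrow> 'k) set"
  have "f \<in> fun_span ?C {1}" if "f \<in> ?C" for f
    using fun_span_base[OF is_subring_chow_functions, of "{1}" 1 f N s] that by simp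
  then show ?case using is_subring_chow_functions by (intro exI[of _ ?C] exI[of _ "{1}"]) auto
next
  case (insert p I)
  let ?C = "chow_functions N s :: ((nat \<times> nat \<Rightarrow> 'k) \<Rightarrow> 'k) set"
  obtain R B where R: "is_subring R" "?C \<subseteq> R" "\<forall>p\<in>I. (\<lambda>y. y p) \<in> R" "finite B" "R \<subseteq> fun_span ?C B"
    using insert by auto
  obtain j i where p: "p = (j, i)" by (cases p)
  have j: "j < s" and i: "1 \<le> i" "i \<le> N" using insert.prems p by auto
  define Mon where "Mon = {m. Poly_Mapping.keys m \<subseteq> {..N} \<and> monom_degree m = s} - {Poly_Mapping.single 0 s}"
  obtain \<epsilon> :: "(nat \<Rightarrow>\<^sub>0 nat) \<Rightarrow> 'k" where e: "\<And>y. y (j, i) ^ s =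
    (\<Sum>k<s. (\<Sum>m\<in>{m \<in> Mon. Poly_Mapping.lookup m 0 = k}. \<epsilon> m * Poly_Mapping.lookup (chow_prod N s (dehom y)) m) * y (j, i) ^ k)"
    using coordinate_integral[OF j i, where 'k = 'k] unfolding Mon_def by blast
  define d where "d k = (\<lambda>y. \<Sum>m\<in>{m \<in> Mon. Poly_Mapping.lookup m 0 = k}. \<epsilon> m * Poly_Mapping.lookup (chow_prod N s (dehom y)) m)" for k
  have dC: "d k \<in> ?C" for k unfolding d_def
    by (rule chow_functionsI[of "\<lambda>c. \<Sum>m\<in>{m \<in> Mon. Poly_Mapping.lookup m 0 = k}. \<epsilon> m * c m"])
       (intro polyfun_sum polyfun_mult polyfun_const polyfun_coord)
  have pw: "(f ^ k) y = f y ^ k" for f :: "(nat \<times> nat \<Rightarrow> 'k) \<Rightarrow> 'k" and k y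
    by (induction k) (simp_all add: one_fun_def times_fun_def)
  have sm: "(sum F K) y = (\<Sum>k\<in>K. F k y)" for F :: "nat \<Rightarrow> (nat \<times> nat \<Rightarrow> 'k) \<Rightarrow> 'k" and K y
    by (induction K rule: infinite_finite_induct) (simp_all add: zero_fun_def plus_fun_def)
  have "(\<lambda>y. y p) ^ s = (\<Sum>k<s. d k * (\<lambda>y. y p) ^ k)"
    by (rule ext) (simp add: pw sm times_fun_def p e d_def)
  then have "\<exists>R' B'. is_subring R' \<and> R \<subseteq> R' \<and> (\<lambda>y. y p) \<in> R' \<and> finite B' \<and> R' \<subseteq> fun_span ?C B'"
    using dC R j by (intro adjoin_integral[where d = d and s = s, OF is_subring_chow_functions R(1,2,4,5)]) auto
  then obtain R' B' where "is_subring R'" "R \<subseteq> R'" "(\<lambda>y. y p) \<in> R'" "finite B'" "R' \<subseteq> fun_span ?C B'" by blast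
  then show ?case using R by (intro exI[of _ R'] exI[of _ B']) auto
qed

text \<open>Every nonzero polynomial in the affine coordinates of the points divides a nonzero polynomial
in the Chow coordinates. Its powers lie in a finite module over the Chow coordinates and hence satisfy a
linear relation over them; after division by a power of the polynomial, the first nonzero coefficient of
this relation is a multiple of it.\<close>

lemma ex_chow_multiple:
  fixes \<Delta> :: "(nat \<times> nat \<Rightarrow> 'k::field) \<Rightarrow> 'k"
  assumes inf: "infinite (UNIV :: 'k set)" and \<Delta>: "polyfun \<Delta>" "\<Delta> (restr N s y0) \<noteq> 0"
  shows "\<exists>\<Psi>. polyfun \<Psi> \<and> (\<exists>y. \<Psi> (Poly_Mapping.lookup (chow_prod N s (dehom y))) \<noteq> 0) \<and>
    (\<forall>y. \<Psi> (Poly_Mapping.lookup (chow_prod N s (dehom y))) \<noteq> 0 \<longrightarrow> \<Delta> (restr N s y) \<noteq> 0)"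
proof -
  let ?C = "chow_functions N s :: ((nat \<times> nat \<Rightarrow> 'k) \<Rightarrow> 'k) set"
  have C: "is_subring ?C" by (rule is_subring_chow_functions)
  obtain R B where R: "is_subring (R :: ((nat \<times> nat \<Rightarrow> 'k) \<Rightarrow> 'k) set)" "?C \<subseteq> R"
    "\<And>p. p \<in> {..<s} \<times> {1..N} \<Longrightarrow> (\<lambda>y. y p) \<in> R" "finite B" "R \<subseteq> fun_span ?C B"
    using ex_finite_extension[of "{..<s} \<times> {1..N}" s N, where 'k = 'k] by auto
  have pw: "(f ^ k) y = f y ^ k" for f :: "(nat \<times> nat \<Rightarrow> 'k) \<Rightarrow> 'k" and k y
    by (induction k) (simp_all add: one_fun_def times_fun_def)
  have sm: "(sum F K) y = (\<Sum>k\<in>K. F k y)" for F :: "'z \<Rightarrow> (nat \<times> nat \<Rightarrow> 'k) \<Rightarrow> 'k" and K y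
    by (induction K rule: infinite_finite_induct) (simp_all add: zero_fun_def plus_fun_def)
  have cR: "(\<lambda>y. c) \<in> R" for c
    using R(2) chow_functionsI[OF polyfun_const[of c], of N s] by auto
  have inR: "(\<lambda>y. f (restr N s y)) \<in> R" if "polyfun f" for f
    using that
  proof induction
    case (polyfun_coord p)
    show ?case using R(3)[of p] cR[of 0] by (cases "p \<in> {..<s} \<times> {1..N}") (simp_all add: restr_def)
  next
    case (polyfun_add f g)
    then show ?case using is_subringD(4)[OF R(1)] by (fastforce simp: plus_fun_def)
  next
    case (polyfun_mult f g)
    then show ?case using is_subringD(6)[OF R(1)] by (fastforce simp: times_fun_def)
  qed (rule cR)
  define D where "D = (\<lambda>y. \<Delta> (restr N s y))"
  have pD: "polyfun D" unfolding D_def by (rule polyfun_restr[OF \<Delta>(1)])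
  have "D ^ n \<in> R" for n by (intro is_subring_power[OF R(1)]) (simp add: D_def inR \<Delta>(1))
  then have "\<forall>n. \<exists>g. (\<forall>v\<in>B. g v \<in> ?C) \<and> D ^ n = (\<Sum>v\<in>B. g v * v)"
    using R(5) unfolding fun_span_def by blast
  from choice[OF this] obtain g where g: "\<And>n v. v \<in> B \<Longrightarrow> g n v \<in> ?C" "\<And>n. D ^ n = (\<Sum>v\<in>B. g n v * v)" by blast
  have dom: "f = 0 \<or> f' = 0" if f: "polyfun f" "polyfun f'" "f * f' = 0" for f f' :: "(nat \<times> nat \<Rightarrow> 'k) \<Rightarrow> 'k"
  proof (rule ccontr)
    assume "\<not> (f = 0 \<or> f' = 0)"
    then obtain a b where "f a \<noteq> 0" "f' b \<noteq> 0" by (auto simp: fun_eq_iff zero_fun_def)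
    then obtain x where "f x \<noteq> 0" "f' x \<noteq> 0" using polyfun_common_nonzero[OF inf f(1) _ f(2)] by blast
    moreover have "f x * f' x = 0" using fun_cong[OF f(3), of x] by (simp add: times_fun_def zero_fun_def)
    ultimately show False by simp
  qed
  define n where "n = card B"
  have "\<exists>h. (\<forall>j\<in>{..n}. h j \<in> ?C) \<and> (\<exists>j\<in>{..n}. h j \<noteq> 0) \<and> (\<forall>v\<in>B. (\<Sum>j\<in>{..n}. g j v * h j) = 0)"
  proof (rule ex_kernel_vector[OF C])
    show "f = 0 \<or> f' = 0" if "f \<in> ?C" "f' \<in> ?C" "f * f' = 0" for f f'
      using dom[OF polyfun_chow_functions polyfun_chow_functions] that by blast
  qed (use R(4) g in \<open>auto simp: n_def\<close>)
  then obtain h where h: "\<And>j. j \<le> n \<Longrightarrow> h j \<in> ?C" "\<exists>j\<le>n. h j \<noteq> 0" "\<And>v. v \<in> B \<Longrightarrow> (\<Sum>j\<le>n. g j v * h j) = 0"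
    by auto
  have "(\<Sum>j\<le>n. D ^ j * h j) = (\<Sum>j\<le>n. \<Sum>v\<in>B. v * (g j v * h j))"
    unfolding g(2) sum_distrib_right by (intro sum.cong refl) (simp add: mult_ac)
  also have "\<dots> = (\<Sum>v\<in>B. v * (\<Sum>j\<le>n. g j v * h j))" by (subst sum.swap) (simp add: sum_distrib_left)
  also have "\<dots> = 0" by (simp add: h(3))
  finally have rel: "(\<Sum>j\<le>n. D ^ j * h j) = 0" .
  define i where "i = (LEAST j. j \<le> n \<and> h j \<noteq> 0)"
  have i: "i \<le> n" "h i \<noteq> 0" using LeastI_ex[OF h(2)] by (auto simp: i_def)
  have less: "h j = 0" if "j < i" for j
    using not_less_Least[of j "\<lambda>j. j \<le> n \<and> h j \<noteq> 0"] that i(1) by (auto simp: i_def)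
  define W where "W = h i + D * (\<Sum>j\<in>{Suc i..n}. D ^ (j - Suc i) * h j)"
  have "(\<Sum>j\<le>n. D ^ j * h j) = (\<Sum>j\<in>{i..n}. D ^ j * h j)"
    by (rule sum.mono_neutral_right) (auto simp: less)
  also have "\<dots> = D ^ i * h i + (\<Sum>j\<in>{Suc i..n}. D ^ j * h j)" using i(1) by (rule sum.atLeast_Suc_atMost)
  also have "(\<Sum>j\<in>{Suc i..n}. D ^ j * h j) = D ^ i * (D * (\<Sum>j\<in>{Suc i..n}. D ^ (j - Suc i) * h j))"
    unfolding sum_distrib_left
  proof (intro sum.cong refl)
    fix j assume "j \<in> {Suc i..n}"
    then have "j = i + Suc (j - Suc i)" by simp
    then have "D ^ j = D ^ (i + Suc (j - Suc i))" by simp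
    then have "D ^ j = D ^ i * (D * D ^ (j - Suc i))" by (simp only: power_add power_Suc)
    then show "D ^ j * h j = D ^ i * (D * (D ^ (j - Suc i) * h j))" by (simp add: mult.assoc)
  qed
  finally have "D ^ i * W = (\<Sum>j\<le>n. D ^ j * h j)" by (simp only: W_def distrib_left)
  then have "D ^ i * W = 0" by (simp only: rel)
  moreover have "polyfun (D ^ i)"
  proof -
    have "D ^ i = (\<lambda>y. D y ^ i)" by (rule ext) (rule pw)
    then show ?thesis using polyfun_power[OF pD] by simp
  qed
  moreover have "polyfun W"
  proof -
    have ph: "polyfun (h j)" if "j \<le> n" for j by (rule polyfun_chow_functions[OF h(1)[OF that]])
    have "W = (\<lambda>y. h i y + D y * (\<Sum>j\<in>{Suc i..n}. D y ^ (j - Suc i) * h j y))"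
      by (rule ext) (simp add: W_def plus_fun_def times_fun_def sm pw)
    moreover have "polyfun \<dots>"
      by (intro polyfun_add polyfun_mult polyfun_sum polyfun_power pD ph i(1)) auto
    ultimately show ?thesis by simp
  qed
  moreover have "D ^ i \<noteq> 0"
  proof
    assume "D ^ i = 0"
    then have "(D ^ i) y0 = 0" by (simp add: zero_fun_def)
    then show False using \<Delta>(2) by (simp add: pw D_def)
  qed
  ultimately have W0: "W = 0" using dom by blast
  obtain \<Psi> where P: "polyfun \<Psi>" "h i = (\<lambda>y. \<Psi> (Poly_Mapping.lookup (chow_prod N s (dehom y))))"
    using h(1)[OF i(1)] unfolding chow_functions_def by blast
  have "\<exists>y. h i y \<noteq> 0" using i(2) by (auto simp: fun_eq_iff zero_fun_def)
  moreover have "D y \<noteq> 0" if "h i y \<noteq> 0" for y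
  proof
    assume "D y = 0"
    moreover have "h i y + D y * (\<Sum>j\<in>{Suc i..n}. D ^ (j - Suc i) * h j) y = 0"
      using fun_cong[OF W0, of y] by (simp add: W_def plus_fun_def times_fun_def zero_fun_def)
    ultimately show False using that by simp
  qed
  ultimately show ?thesis using P by (intro exI[of _ \<Psi>]) (auto simp: D_def)
qed

text \<open>The coordinate \<open>w\<close> plays the role of the homogenizing variable.\<close>

lemma homogenize:
  assumes "polyfun \<Psi>"
  shows "\<exists>E \<Phi>. homogeneous E \<Phi> \<and> (\<forall>c. c w \<noteq> 0 \<longrightarrow> eval_mpoly \<Phi> c = c w ^ E * \<Psi> (\<lambda>m. c m / c w))"
  using assms
proof induction
  case (polyfun_const a)
  show ?case
    by (intro exI[of _ 0] exI[of _ "const a"]) (auto simp: homogeneous_const eval_mpoly_ev ev_const[OF is_hom_id])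
next
  case (polyfun_coord v)
  show ?case
    by (intro exI[of _ 1] exI[of _ "var v"]) (auto simp: homogeneous_var[unfolded One_nat_def] eval_mpoly_ev ev_var[OF is_hom_id])
next
  case (polyfun_add f g)
  then obtain E \<Phi> E' \<Phi>' where 1: "homogeneous E \<Phi>" "\<And>c. c w \<noteq> 0 \<Longrightarrow> eval_mpoly \<Phi> c = c w ^ E * f (\<lambda>m. c m / c w)"
    and 2: "homogeneous E' \<Phi>'" "\<And>c. c w \<noteq> 0 \<Longrightarrow> eval_mpoly \<Phi>' c = c w ^ E' * g (\<lambda>m. c m / c w)" by metis
  have "homogeneous (E + E') (var w ^ E' * \<Phi> + var w ^ E * \<Phi>')"
    using homogeneous_mult[OF homogeneous_power[OF homogeneous_var] 1(1), of E' w]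
      homogeneous_mult[OF homogeneous_power[OF homogeneous_var] 2(1), of E w]
    by (intro homogeneous_add) (simp_all add: add.commute)
  moreover have "eval_mpoly (var w ^ E' * \<Phi> + var w ^ E * \<Phi>') c = c w ^ (E + E') * (f (\<lambda>m. c m / c w) + g (\<lambda>m. c m / c w))"
    if "c w \<noteq> 0" for c
    using 1(2)[of c, OF that] 2(2)[of c, OF that] unfolding eval_mpoly_ev
    by (simp add: ev_add[OF is_hom_id] ev_mult[OF is_hom_id] ev_power[OF is_hom_id] ev_var[OF is_hom_id] power_add distrib_left mult_ac)
  ultimately show ?case by blast
next
  case (polyfun_mult f g)
  then obtain E \<Phi> E' \<Phi>' where 1: "homogeneous E \<Phi>" "\<And>c. c w \<noteq> 0 \<Longrightarrow> eval_mpoly \<Phi> c = c w ^ E * f (\<lambda>m. c m / c w)"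
    and 2: "homogeneous E' \<Phi>'" "\<And>c. c w \<noteq> 0 \<Longrightarrow> eval_mpoly \<Phi>' c = c w ^ E' * g (\<lambda>m. c m / c w)" by metis
  have "eval_mpoly (\<Phi> * \<Phi>') c = c w ^ (E + E') * (f (\<lambda>m. c m / c w) * g (\<lambda>m. c m / c w))"
    if "c w \<noteq> 0" for c
    using 1(2)[of c, OF that] 2(2)[of c, OF that] unfolding eval_mpoly_ev
    by (simp add: ev_mult[OF is_hom_id] power_add mult_ac)
  then show ?case using homogeneous_mult[OF 1(1) 2(1)] by blast
qed

section \<open>General sets of points\<close>

definition proj_point :: "(nat \<Rightarrow> 'k::field) \<Rightarrow> (nat \<Rightarrow> 'k) set" where
  "proj_point a = {\<lambda>i. c * a i | c. c \<noteq> 0}"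

definition affine_coords :: "nat \<Rightarrow> (nat \<times> nat \<Rightarrow> 'k::field) \<Rightarrow> nat \<Rightarrow> nat \<Rightarrow> 'k" where
  "affine_coords N y j = (\<lambda>i. if i = 0 then 1 else if i \<le> N then y (j, i) else 0)"

lemma self_in_proj_point: "a \<in> proj_point a"
  unfolding proj_point_def by (rule CollectI, rule exI[of _ 1]) simp

lemma proj_point_scale:
  assumes "c \<noteq> 0" shows "proj_point (\<lambda>i. c * a i) = proj_point a"
proof
  show "proj_point (\<lambda>i. c * a i) \<subseteq> proj_point a"
  proof
    fix b assume "b \<in> proj_point (\<lambda>i. c * a i)"
    then obtain d where "d \<noteq> 0" "b = (\<lambda>i. d * (c * a i))" by (auto simp: proj_point_def)
    then show "b \<in> proj_point a" using assms unfolding proj_point_def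
      by (intro CollectI exI[of _ "d * c"]) (auto simp: mult.assoc)
  qed
  show "proj_point a \<subseteq> proj_point (\<lambda>i. c * a i)"
  proof
    fix b assume "b \<in> proj_point a"
    then obtain d where "d \<noteq> 0" "b = (\<lambda>i. d * a i)" by (auto simp: proj_point_def)
    then show "b \<in> proj_point (\<lambda>i. c * a i)" using assms unfolding proj_point_def
      by (intro CollectI exI[of _ "d / c"]) auto
  qed
qed

lemma proj_space_iff:
  "P \<in> proj_space N \<longleftrightarrow> (\<exists>a. P = proj_point a \<and> (\<forall>i>N. a i = 0) \<and> (\<exists>i\<le>N. a i \<noteq> 0))"
  unfolding proj_space_def proj_point_def by blast

lemma affine_coords_in_proj_space: "proj_point (affine_coords N y j) \<in> proj_space N"
  unfolding proj_space_iff
  by (rule exI[of _ "affine_coords N y j"]) (auto simp: affine_coords_def intro!: exI[of _ 0])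

definition cycle_of :: "nat \<Rightarrow> (nat \<Rightarrow> nat \<Rightarrow> 'k::field) \<Rightarrow> (nat \<Rightarrow> 'k) set multiset" where
  "cycle_of s v = image_mset (\<lambda>j. proj_point (v j)) (mset_set {..<s})"

lemma set_cycle_of: "set_mset (cycle_of s v) = (\<lambda>j. proj_point (v j)) ` {..<s}"
  by (simp add: cycle_of_def)

lemma zero_cycles_eq_cycle_of:
  assumes "Z \<in> zero_cycles N s"
  shows "\<exists>v. Z = cycle_of s v \<and> (\<forall>j<s. \<forall>i>N. v j i = 0)"
proof -
  obtain xs where xs: "mset xs = Z" using ex_mset by blast
  have len: "length xs = s" using assms xs by (auto simp: zero_cycles_def)
  have pr: "xs ! j \<in> proj_space N" if "j < s" for j
  proof -
    have "xs ! j \<in> set xs" using that len by simp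
    then show ?thesis using assms xs by (auto simp: zero_cycles_def)
  qed
  have "\<forall>j. \<exists>a. j < s \<longrightarrow> xs ! j = proj_point a \<and> (\<forall>i>N. a i = 0)"
  proof
    fix j
    show "\<exists>a. j < s \<longrightarrow> xs ! j = proj_point a \<and> (\<forall>i>N. a i = 0)"
    proof (cases "j < s")
      case True
      from iffD1[OF proj_space_iff pr[OF True]] obtain a where "xs ! j = proj_point a" "\<forall>i>N. a i = 0"
        by (elim exE conjE)
      then show ?thesis by blast
    qed simp
  qed
  from choice[OF this] obtain v where v: "\<And>j. j < s \<Longrightarrow> xs ! j = proj_point (v j)" "\<And>j i. j < s \<Longrightarrow> i > N \<Longrightarrow> v j i = 0"
    by blast
  have "Z = mset (map ((!) xs) [0..<s])" using xs len map_nth[of xs] by simp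
  also have "\<dots> = image_mset ((!) xs) (mset_set {..<s})" by (simp only: mset_map mset_upt lessThan_atLeast0)
  also have "\<dots> = cycle_of s v" unfolding cycle_of_def by (intro image_mset_cong) (simp add: v(1))
  finally have "Z = cycle_of s v" .
  then show ?thesis using v(2) by blast
qed

lemma cycle_of_in_zero_cycles:
  assumes "\<And>j. j < s \<Longrightarrow> proj_point (v j) \<in> proj_space N"
  shows "cycle_of s v \<in> zero_cycles N s"
  using assms by (auto simp: zero_cycles_def cycle_of_def)

lemma linear_form_cong: "(\<And>i. i \<le> N \<Longrightarrow> a i = b i) \<Longrightarrow> linear_form N a = linear_form N b"
  unfolding linear_form_eq by (intro sum.cong) auto

lemma const_prod: "(\<Prod>i\<in>I. const (f i)) = const (\<Prod>i\<in>I. f i)"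
  by (induction I rule: infinite_finite_induct) (simp_all add: const_mult)

lemma chow_form_cycle_of:
  "\<exists>k. k \<noteq> 0 \<and> chow_form N (cycle_of s v) = const k * chow_prod N s (\<lambda>(j, i). v j i)"
proof -
  have "\<exists>c. c \<noteq> 0 \<and> (SOME a. a \<in> proj_point (v j)) = (\<lambda>i. c * v j i)" for j
  proof -
    have "(SOME a. a \<in> proj_point (v j)) \<in> proj_point (v j)" by (rule someI[of "\<lambda>a. a \<in> proj_point (v j)", OF self_in_proj_point])
    then show ?thesis by (auto simp: proj_point_def)
  qed
  then have "\<forall>j. \<exists>c. c \<noteq> 0 \<and> (SOME a. a \<in> proj_point (v j)) = (\<lambda>i. c * v j i)" by blast
  from choice[OF this] obtain c where c: "\<And>j. c j \<noteq> 0" "\<And>j. (SOME a. a \<in> proj_point (v j)) = (\<lambda>i. c j * v j i)" by blast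
  have "chow_form N (cycle_of s v) = (\<Prod>j<s. linear_form N (SOME a. a \<in> proj_point (v j)))"
    by (simp add: chow_form_def cycle_of_def prod_unfold_prod_mset image_mset.compositionality o_def)
  also have "\<dots> = (\<Prod>j<s. const (c j) * linear_form N (v j))"
    by (simp only: c(2) linear_form_scale)
  also have "\<dots> = const (\<Prod>j<s. c j) * chow_prod N s (\<lambda>(j, i). v j i)"
    by (simp add: prod.distrib const_prod chow_prod_def)
  finally show ?thesis using c(1) by (intro exI[of _ "\<Prod>j<s. c j"]) auto
qed

abbreviation chow_eval :: "nat \<Rightarrow> (nat \<Rightarrow>\<^sub>0 nat, 'k::field) mpoly \<Rightarrow> (nat \<Rightarrow> 'k) set multiset \<Rightarrow> 'k" where
  "chow_eval N \<Phi> Z \<equiv> eval_mpoly \<Phi> (Poly_Mapping.lookup (chow_form N Z))"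

lemma chow_eval_cycle_of:
  assumes "homogeneous E \<Phi>"
  shows "chow_eval N \<Phi> (cycle_of s v) \<noteq> 0 \<longleftrightarrow>
    eval_mpoly \<Phi> (Poly_Mapping.lookup (chow_prod N s (\<lambda>(j, i). v j i))) \<noteq> 0"
proof -
  obtain k where k: "k \<noteq> 0" "chow_form N (cycle_of s v) = const k * chow_prod N s (\<lambda>(j, i). v j i)"
    using chow_form_cycle_of by blast
  have "Poly_Mapping.lookup (chow_form N (cycle_of s v)) =
      (\<lambda>m. k * Poly_Mapping.lookup (chow_prod N s (\<lambda>(j, i). v j i)) m)"
    unfolding k(2) by (rule ext) (rule lookup_const_mult)
  then show ?thesis using k(1) by (simp add: eval_homogeneous_scale[OF assms])
qed

text \<open>The sets on which a form does not vanish are a subbasis by definition. They form a basis because they are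
closed under intersection: multiply the forms.\<close>

lemma open_chow_basis:
  assumes "openin (chow_variety N s) T" "Z \<in> T"
  shows "\<exists>E (\<Phi> :: (nat \<Rightarrow>\<^sub>0 nat, 'k::field) mpoly). homogeneous E \<Phi> \<and> chow_eval N \<Phi> Z \<noteq> 0 \<and>
    (\<forall>Z'\<in>zero_cycles N s. chow_eval N \<Phi> Z' \<noteq> 0 \<longrightarrow> Z' \<in> T)"
proof -
  define S where "S = {{Z \<in> zero_cycles N s. chow_eval N \<Phi> Z \<noteq> 0}
         | \<Phi> :: (nat \<Rightarrow>\<^sub>0 nat, 'k) mpoly. \<exists>d. homogeneous d \<Phi>}"
  have "generate_topology_on S T"
    using assms(1) unfolding chow_variety_def S_def[symmetric] openin_topology_generated_by_iff .
  then have "\<forall>Z\<in>T. \<exists>E (\<Phi> :: (nat \<Rightarrow>\<^sub>0 nat, 'k) mpoly). homogeneous E \<Phi> \<and> chow_eval N \<Phi> Z \<noteq> 0 \<and>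
    (\<forall>Z'\<in>zero_cycles N s. chow_eval N \<Phi> Z' \<noteq> 0 \<longrightarrow> Z' \<in> T)"
  proof induction
    case (Int a b)
    show ?case
    proof
      fix Z assume "Z \<in> a \<inter> b"
      then have Z: "Z \<in> a" "Z \<in> b" by simp_all
      from bspec[OF Int.IH(1) Z(1)] obtain E and \<Phi> :: "(nat \<Rightarrow>\<^sub>0 nat, 'k) mpoly" where
        1: "homogeneous E \<Phi>" "chow_eval N \<Phi> Z \<noteq> 0" "\<forall>Z'\<in>zero_cycles N s. chow_eval N \<Phi> Z' \<noteq> 0 \<longrightarrow> Z' \<in> a"
        by (elim exE conjE)
      from bspec[OF Int.IH(2) Z(2)] obtain E' and \<Phi>' :: "(nat \<Rightarrow>\<^sub>0 nat, 'k) mpoly" where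
        2: "homogeneous E' \<Phi>'" "chow_eval N \<Phi>' Z \<noteq> 0" "\<forall>Z'\<in>zero_cycles N s. chow_eval N \<Phi>' Z' \<noteq> 0 \<longrightarrow> Z' \<in> b"
        by (elim exE conjE)
      have "chow_eval N (\<Phi> * \<Phi>') Z' = chow_eval N \<Phi> Z' * chow_eval N \<Phi>' Z'" for Z'
        unfolding eval_mpoly_ev by (rule ev_mult[OF is_hom_id])
      then show "\<exists>E (\<Phi> :: (nat \<Rightarrow>\<^sub>0 nat, 'k) mpoly). homogeneous E \<Phi> \<and> chow_eval N \<Phi> Z \<noteq> 0 \<and>
        (\<forall>Z'\<in>zero_cycles N s. chow_eval N \<Phi> Z' \<noteq> 0 \<longrightarrow> Z' \<in> a \<inter> b)"
        using 1 2 homogeneous_mult[OF 1(1) 2(1)]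
        by (intro exI[of _ "E + E'"] exI[of _ "\<Phi> * \<Phi>'"]) auto
    qed
  next
    case (UN K)
    show ?case
    proof
      fix Z assume "Z \<in> \<Union>K"
      then obtain k where k: "k \<in> K" "Z \<in> k" by blast
      from bspec[OF UN.IH[OF k(1)] k(2)] show "\<exists>E (\<Phi> :: (nat \<Rightarrow>\<^sub>0 nat, 'k) mpoly). homogeneous E \<Phi> \<and> chow_eval N \<Phi> Z \<noteq> 0 \<and>
        (\<forall>Z'\<in>zero_cycles N s. chow_eval N \<Phi> Z' \<noteq> 0 \<longrightarrow> Z' \<in> \<Union>K)" using k(1) by (meson UnionI)
    qed
  next
    case (Basis t)
    then show ?case unfolding S_def by blast
  next
    case Empty
    show ?case by simp
  qed
  then show ?thesis using assms(2) by blast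
qed

text \<open>The open set \<open>U\<close> is where \<open>w \<Phi>\<^sub>0\<close> does not vanish: \<open>\<Phi>\<^sub>0\<close> homogenizes a multiple of \<open>\<Delta>\<close> in the Chow coordinates, and
\<open>w\<close>, the coefficient of \<open>u\<^sub>0\<^sup>s\<close>, keeps the points of the cycle in the affine chart. It is dense because a
form that does not vanish on all cycles and \<open>w \<Phi>\<^sub>0\<close> pull back to nonzero polynomial functions of the
coordinate vectors, and such functions have a common point where they are nonzero.\<close>

lemma general_points:
  fixes \<Delta> :: "(nat \<times> nat \<Rightarrow> 'k::field) \<Rightarrow> 'k"
  assumes inf: "infinite (UNIV :: 'k set)" and \<Delta>: "polyfun \<Delta>" "\<Delta> (restr N s y0) \<noteq> 0"
    and Q: "\<And>y. \<Delta> (restr N s y) \<noteq> 0 \<Longrightarrow> Q ((\<lambda>j. proj_point (affine_coords N y j)) ` {..<s})"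
  shows "holds_for_general_points N s Q"
proof -
  define w :: "nat \<Rightarrow>\<^sub>0 nat" where "w = Poly_Mapping.single 0 s"
  define cf where "cf a = Poly_Mapping.lookup (chow_prod N s a)" for a :: "nat \<times> nat \<Rightarrow> 'k"
  have cfw: "cf a w = (\<Prod>j<s. a (j, 0))" for a unfolding cf_def w_def by (rule chow_coeff_top)
  obtain \<Psi> y1 where P: "polyfun \<Psi>" "\<Psi> (cf (dehom y1)) \<noteq> 0"
    "\<forall>y. \<Psi> (cf (dehom y)) \<noteq> 0 \<longrightarrow> \<Delta> (restr N s y) \<noteq> 0"
    using ex_chow_multiple[OF inf \<Delta>] unfolding cf_def by (elim exE conjE)
  obtain E \<Phi>0 where h: "homogeneous E \<Phi>0" "\<forall>c. c w \<noteq> 0 \<longrightarrow> eval_mpoly \<Phi>0 c = c w ^ E * \<Psi> (\<lambda>m. c m / c w)"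
    using homogenize[OF P(1), of w] by (elim exE conjE)
  define \<Phi> where "\<Phi> = var w * \<Phi>0"
  have hom: "homogeneous (1 + E) \<Phi>" unfolding \<Phi>_def by (intro homogeneous_mult homogeneous_var h(1))
  have ev: "eval_mpoly \<Phi> c = c w * eval_mpoly \<Phi>0 c" for c
    unfolding \<Phi>_def eval_mpoly_ev by (simp add: ev_mult[OF is_hom_id] ev_var[OF is_hom_id])
  define U where "U = {Z \<in> zero_cycles N s. chow_eval N \<Phi> Z \<noteq> 0}"
  have "openin (chow_variety N s) U"
    unfolding chow_variety_def U_def by (rule topology_generated_by_Basis) (use hom in blast)
  moreover have "chow_variety N s closure_of U = topspace (chow_variety N s)"
  proof (intro equalityI subsetI)
    fix Z :: "(nat \<Rightarrow> 'k) set multiset" assume Z: "Z \<in> topspace (chow_variety N s)"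
    show "Z \<in> chow_variety N s closure_of U"
      unfolding in_closure_of
    proof (intro conjI Z allI impI)
      fix T assume T: "Z \<in> T \<and> openin (chow_variety N s) T"
      obtain E1 \<Phi>1 where 1: "homogeneous E1 \<Phi>1" "chow_eval N \<Phi>1 Z \<noteq> 0"
        "\<forall>Z'\<in>zero_cycles N s. chow_eval N \<Phi>1 Z' \<noteq> 0 \<longrightarrow> Z' \<in> T"
        using open_chow_basis[OF conjunct2[OF T] conjunct1[OF T]] by (elim exE conjE)
      have "Z \<in> zero_cycles N s" using Z by (simp only: topspace_chow_variety)
      from zero_cycles_eq_cycle_of[OF this] obtain v where v: "Z = cycle_of s v" by (elim exE conjE)
      have "polyfun (\<lambda>a. cf a m)" for m unfolding cf_def by (rule polyfun_chow_coeff)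
      then have "polyfun (\<lambda>a. eval_mpoly \<Psi>' (\<lambda>m. cf a m))" for \<Psi>'
        by (rule polyfun_compose[OF polyfun_eval_mpoly])
      note pf = this[of \<Phi>1] this[of \<Phi>]
      have n1: "eval_mpoly \<Phi>1 (cf (\<lambda>(j, i). v j i)) \<noteq> 0"
        using 1(2) unfolding v cf_def chow_eval_cycle_of[OF 1(1)] .
      have "cf (dehom y1) w = 1" unfolding cfw by (simp add: dehom_def)
      then have n2: "eval_mpoly \<Phi> (cf (dehom y1)) \<noteq> 0" using P(2) by (simp add: ev h(2)[rule_format])
      obtain a where a: "eval_mpoly \<Phi>1 (cf a) \<noteq> 0" "eval_mpoly \<Phi> (cf a) \<noteq> 0"
        using polyfun_common_nonzero[of "\<lambda>a. eval_mpoly \<Phi>1 (cf a)" "\<lambda>(j, i). v j i"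
          "\<lambda>a. eval_mpoly \<Phi> (cf a)" "dehom y1", OF inf pf(1) n1 pf(2) n2]
        by (elim exE conjE)
      then have "cf a w \<noteq> 0" by (auto simp: ev)
      then have a0: "a (j, 0) \<noteq> 0" if "j < s" for j using that by (auto simp: cfw)
      define v' where "v' j i = (if i \<le> N then a (j, i) else 0)" for j i
      have "chow_prod N s (\<lambda>(j, i). v' j i) = chow_prod N s a"
        unfolding chow_prod_def by (intro prod.cong linear_form_cong refl) (simp add: v'_def)
      then have "chow_eval N \<Phi>1 (cycle_of s v') \<noteq> 0" "chow_eval N \<Phi> (cycle_of s v') \<noteq> 0"
        using a unfolding chow_eval_cycle_of[OF 1(1)] chow_eval_cycle_of[OF hom] cf_def by auto
      moreover have "cycle_of s v' \<in> zero_cycles N s"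
      proof (rule cycle_of_in_zero_cycles)
        fix j assume "j < s"
        then have "v' j 0 \<noteq> 0" using a0 by (simp add: v'_def)
        then show "proj_point (v' j) \<in> proj_space N" unfolding proj_space_iff
          by (intro exI[of _ "v' j"]) (auto simp: v'_def)
      qed
      ultimately show "\<exists>Z'. Z' \<in> U \<and> Z' \<in> T" using 1(3)
        by (intro exI[of _ "cycle_of s v'"]) (simp add: U_def)
    qed
  next
    fix Z :: "(nat \<Rightarrow> 'k) set multiset" assume "Z \<in> chow_variety N s closure_of U"
    then show "Z \<in> topspace (chow_variety N s)" by (simp add: in_closure_of)
  qed
  moreover have "Q (set_mset Z)" if "Z \<in> U" for Z
  proof -
    have "Z \<in> zero_cycles N s" using that by (simp add: U_def)
    from zero_cycles_eq_cycle_of[OF this] obtain v where v: "Z = cycle_of s v" "\<forall>j<s. \<forall>i>N. v j i = 0" by (elim exE conjE)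
    define V where "V = (\<lambda>(j, i). v j i)"
    have ne: "eval_mpoly \<Phi> (cf V) \<noteq> 0"
      using that unfolding U_def v(1) V_def cf_def by (simp add: chow_eval_cycle_of[OF hom])
    define k where "k = (\<Prod>j<s. v j 0)"
    have kw: "cf V w = k" by (simp add: cfw k_def V_def)
    have k0: "k \<noteq> 0" using ne by (auto simp: ev kw)
    then have v0: "v j 0 \<noteq> 0" if "j < s" for j using that by (auto simp: k_def)
    define y where "y = (\<lambda>(j, i). v j i / v j 0)"
    have "chow_prod N s V = (\<Prod>j<s. linear_form N (\<lambda>i. v j 0 * dehom y (j, i)))"
      unfolding chow_prod_def V_def
      by (intro prod.cong linear_form_cong refl) (use v0 in \<open>auto simp: dehom_def y_def\<close>)
    also have "\<dots> = const k * chow_prod N s (dehom y)"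
      unfolding linear_form_scale by (simp add: prod.distrib const_prod chow_prod_def k_def)
    finally have cV: "cf V m = k * cf (dehom y) m" for m unfolding cf_def by (simp add: lookup_const_mult)
    have "cf V m / k = cf (dehom y) m" for m unfolding cV using k0 by simp
    then have "(\<lambda>m. cf V m / cf V w) = cf (dehom y)" unfolding kw by (rule ext)
    then have "\<Psi> (cf (dehom y)) \<noteq> 0" using ne k0 by (auto simp: ev h(2)[rule_format, of "cf V"] kw)
    then have "Q ((\<lambda>j. proj_point (affine_coords N y j)) ` {..<s})" by (intro Q P(3)[rule_format])
    also have "(\<lambda>j. proj_point (affine_coords N y j)) ` {..<s} = set_mset Z"
      unfolding v(1) set_cycle_of
    proof (intro image_cong refl)
      fix j assume j: "j \<in> {..<s}"
      then have "v j = (\<lambda>i. v j 0 * affine_coords N y j i)"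
        using v0[of j] v(2)[rule_format, of j] by (auto simp: fun_eq_iff affine_coords_def y_def)
      then show "proj_point (affine_coords N y j) = proj_point (v j)"
        using proj_point_scale[of "v j 0" "affine_coords N y j"] v0[of j] j by simp
    qed
    finally show ?thesis .
  qed
  ultimately show ?thesis unfolding holds_for_general_points_def by blast
qed

section \<open>Curves through the points\<close>

lemma poly_ev: "poly (ev (\<lambda>c. [:c:]) \<sigma> f) t = ev (\<lambda>c. c) (\<lambda>i. poly (\<sigma> i) t) f"
  by (simp add: ev_def monom_val_def poly_sum poly_prod)

lemma degree_ev_le:
  assumes "deg_le d f" "\<And>m i. m \<in> Poly_Mapping.keys f \<Longrightarrow> i \<in> Poly_Mapping.keys m \<Longrightarrow> degree (\<sigma> i) \<le> e"
  shows "degree (ev (\<lambda>c. [:c:]) \<sigma> f) \<le> d * e"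
  unfolding ev_def
proof (rule degree_sum_le)
  fix m assume m: "m \<in> Poly_Mapping.keys f"
  have "degree (monom_val \<sigma> m) \<le> (\<Sum>i\<in>Poly_Mapping.keys m. degree (\<sigma> i ^ Poly_Mapping.lookup m i))"
    unfolding monom_val_def using degree_prod_sum_le[OF finite_keys] by (simp add: o_def)
  also have "\<dots> \<le> (\<Sum>i\<in>Poly_Mapping.keys m. Poly_Mapping.lookup m i * e)"
  proof (rule sum_mono)
    fix i assume i: "i \<in> Poly_Mapping.keys m"
    have "degree (\<sigma> i ^ Poly_Mapping.lookup m i) \<le> degree (\<sigma> i) * Poly_Mapping.lookup m i" by (rule degree_power_le)
    also have "\<dots> \<le> e * Poly_Mapping.lookup m i" using assms(2)[OF m i] by (rule mult_le_mono1)
    finally show "degree (\<sigma> i ^ Poly_Mapping.lookup m i) \<le> Poly_Mapping.lookup m i * e" by (simp add: mult.commute)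
  qed
  also have "\<dots> = monom_degree m * e" by (simp add: monom_degree_def sum_distrib_right)
  also have "\<dots> \<le> d * e" using assms(1) m by (intro mult_le_mono1) (simp add: deg_le_def)
  finally show "degree ([:Poly_Mapping.lookup f m:] * monom_val \<sigma> m) \<le> d * e"
    by (simp add: order_trans[OF degree_smult_le])
qed simp

lemma card_roots_le_degree:
  fixes F :: "'k::field poly"
  assumes "finite B" "\<And>b. b \<in> B \<Longrightarrow> [:- b, 1:] ^ m dvd F" "F \<noteq> 0"
  shows "card B * m \<le> degree F"
  using assms
proof (induction B arbitrary: F rule: finite_induct)
  case (insert b B)
  obtain G where G: "F = [:- b, 1:] ^ m * G" using insert.prems(1)[of b] by (auto simp: dvd_def)
  have G0: "G \<noteq> 0" using G insert.prems(2) by auto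
  have "[:- b', 1:] ^ m dvd G" if b': "b' \<in> B" for b'
  proof -
    have "b \<noteq> b'" using that insert.hyps by auto
    then have "poly ([:- b, 1:] ^ m) b' \<noteq> 0" by simp
    then have "order b' ([:- b, 1:] ^ m) = 0" by (rule order_0I)
    moreover have "[:- b, 1:] ^ m * G \<noteq> 0" using G insert.prems(2) by simp
    ultimately have "order b' F = order b' G" unfolding G by (simp add: order_mult)
    moreover have "m \<le> order b' F" using insert.prems b' order_divides[of b' m F] by auto
    ultimately show ?thesis using order_divides[of b' m G] by simp
  qed
  then have "card B * m \<le> degree G" using G0 by (rule insert.IH)
  moreover have "degree F = m + degree G" unfolding G using G0 by (simp add: degree_mult_eq degree_linear_power)
  ultimately show ?case using insert.hyps by simp
qed simp

text \<open>Bezout's theorem for a parametrized curve: along it \<open>f\<close> becomes a polynomial in one variable of degree at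
most \<open>e\<close> times the degree of \<open>f\<close>, with an \<open>m\<close>-fold root at each parameter of a point in \<open>X\<close>. The factor
\<open>c\<close> may be \<open>0\<close>: a form that vanishes at a point of projective space also vanishes at the zero vector.\<close>

lemma curve_bound:
  fixes f :: "(nat, 'k::field) mpoly" and \<sigma> :: "nat \<Rightarrow> 'k poly"
  assumes f: "f \<in> symbolic_power N X m" "f \<in> carrier (poly_ring N)" and B: "finite B"
    and b: "\<And>b. b \<in> B \<Longrightarrow> \<exists>P\<in>X. \<exists>a\<in>P. \<exists>c. \<forall>i\<le>N. poly (\<sigma> i) b = c * a i"
    and e: "\<And>i. i \<le> N \<Longrightarrow> degree (\<sigma> i) \<le> e" and nz: "ev (\<lambda>c. [:c:]) \<sigma> f \<noteq> 0"
  shows "card B * m \<le> total_degree f * e"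
proof -
  have "[:- b, 1:] ^ m dvd ev (\<lambda>c. [:c:]) \<sigma> f" if bB: "b \<in> B" for b
  proof -
    obtain P a c where P: "P \<in> X" "a \<in> P" "\<And>i. i \<le> N \<Longrightarrow> poly (\<sigma> i) b = c * a i" using b[OF bB] by blast
    show ?thesis
    proof (rule ideal_power_filtration[where Fl = "\<lambda>m x. [:- b, 1:] ^ m dvd x" and \<psi> = "ev (\<lambda>c. [:c:]) \<sigma>" and N = N and P = P])
      show "f \<in> ideal_power N (point_ideal N P) m" using f(1) P(1) by (simp add: symbolic_power_def)
      show "[:- b, 1:] ^ m dvd x + y" if "[:- b, 1:] ^ m dvd x" "[:- b, 1:] ^ m dvd y" for m and x y :: "'k poly"
        using that by (rule dvd_add)
      show "[:- b, 1:] ^ (m + n) dvd x * y" if "[:- b, 1:] ^ m dvd x" "[:- b, 1:] ^ n dvd y" for m n and x y :: "'k poly"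
        unfolding power_add using that by (rule mult_dvd_mono)
      show "[:- b, 1:] ^ 1 dvd ev (\<lambda>c. [:c:]) \<sigma> g" if g: "g \<in> point_forms N P" for g
      proof -
        obtain d where hom: "homogeneous d g" and car: "vars_in {..N} g" and z: "eval_mpoly g a = 0"
          using g P(2) by (auto simp: point_forms_def carrier_poly_ring)
        have "poly (ev (\<lambda>c. [:c:]) \<sigma> g) b = ev (\<lambda>c. c) (\<lambda>i. c * a i) g"
          unfolding poly_ev by (rule ev_cong) (use car P(3) in \<open>auto simp: vars_in_def\<close>)
        also have "\<dots> = c ^ d * eval_mpoly g a" using eval_homogeneous_scale[OF hom, of c a] by (simp add: eval_mpoly_ev)
        finally show ?thesis using z by (simp add: poly_eq_0_iff_dvd)
      qed
    qed (simp_all add: ev_add[OF is_hom_pCons] ev_mult[OF is_hom_pCons])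
  qed
  then have "card B * m \<le> degree (ev (\<lambda>c. [:c:]) \<sigma> f)" by (intro card_roots_le_degree B nz)
  also have "\<dots> \<le> total_degree f * e"
    by (rule degree_ev_le[OF deg_le_total_degree]) (use f(2) e in \<open>auto simp: carrier_poly_ring vars_in_def\<close>)
  finally show ?thesis .
qed

lemma symbolic_power_carrier: "X \<noteq> {} \<Longrightarrow> f \<in> symbolic_power N X m \<Longrightarrow> f \<in> carrier (poly_ring N)"
proof -
  assume "X \<noteq> {}" and f: "f \<in> symbolic_power N X m"
  then obtain P where "P \<in> X" by blast
  then have "f \<in> ideal_power N (point_ideal N P) m" using f by (simp add: symbolic_power_def)
  then show ?thesis by (rule ideal.Icarr[OF ideal_power_in[OF ideal_point_ideal]])
qed

lemma ev_at_origin: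
  fixes g :: "(nat, 'k::field) mpoly"
  shows "ev (\<lambda>c. c) (\<lambda>_. 0) g = Poly_Mapping.lookup g 0"
proof -
  have mv: "monom_val (\<lambda>_. 0 :: 'k) m = (if m = 0 then 1 else 0)" for m :: "nat \<Rightarrow>\<^sub>0 nat"
  proof (cases "m = 0")
    case False
    then obtain v where v: "v \<in> Poly_Mapping.keys m" by fastforce
    have "(\<Prod>v\<in>Poly_Mapping.keys m. 0 ^ Poly_Mapping.lookup m v :: 'k) = 0"
      by (rule prod_zero) (use v in \<open>auto simp: in_keys_iff intro!: bexI[of _ v]\<close>)
    then show ?thesis using False by (simp add: monom_val_def)
  qed simp
  have "ev (\<lambda>c. c) (\<lambda>_. 0) g = (\<Sum>m\<in>insert 0 (Poly_Mapping.keys g). Poly_Mapping.lookup g m * (if m = 0 then 1 else 0))"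
    by (subst ev_superset[OF is_hom_id, of "insert 0 (Poly_Mapping.keys g)"]) (auto simp: mv)
  also have "\<dots> = (\<Sum>m\<in>insert 0 (Poly_Mapping.keys g). if m = 0 then Poly_Mapping.lookup g 0 else 0)"
    by (intro sum.cong) auto
  finally show ?thesis by simp
qed

lemma ord_ge_1I:
  fixes g :: "(nat, 'k::field) mpoly"
  assumes "vars_in {1..N} g" "ev (\<lambda>c. c) (\<lambda>_. 0) g = 0" shows "ord_ge 1 g"
  unfolding ord_ge_def
proof
  fix m assume m: "m \<in> Poly_Mapping.keys g"
  then have k: "Poly_Mapping.keys m \<subseteq> {1..N}" using assms(1) by (auto simp: vars_in_def)
  then have o: "odeg m = monom_degree m" by (intro odeg_eq) auto
  have "m \<noteq> 0" using m assms(2) unfolding ev_at_origin by (auto simp: in_keys_iff)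
  then obtain v where "v \<in> Poly_Mapping.keys m" by fastforce
  then have "1 \<le> Poly_Mapping.lookup m v" by (simp add: in_keys_iff Suc_le_eq)
  then show "1 \<le> odeg m" using lookup_le_monom_degree[of m v] o by linarith
qed

text \<open>A polynomial of degree \<open>D\<close> in \<open>N + 1\<close> variables cannot vanish on the grid of points above if the grid is so
large that order \<open>1\<close> requires degree more than \<open>D\<close>. The variables are renumbered because the grid has no
coordinate with index \<open>0\<close>.\<close>

lemma ex_nonzero_value:
  fixes f :: "(nat, 'k::field) mpoly"
  assumes inf: "infinite (UNIV :: 'k set)" and f: "f \<noteq> 0" "vars_in {..N} f"
  shows "\<exists>v. ev (\<lambda>c. c) v f \<noteq> 0"
proof (rule ccontr)
  assume n: "\<not> ?thesis"
  define g where "g = subst (\<lambda>i. var (Suc i)) f"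
  have ev_g: "ev (\<lambda>c. c) y g = ev (\<lambda>c. c) (\<lambda>i. y (Suc i)) f" for y :: "nat \<Rightarrow> 'k"
    unfolding g_def ev_subst[OF is_hom_id] by (simp add: ev_var[OF is_hom_id])
  have "subst (\<lambda>i. var (i - 1)) g = f"
    unfolding g_def ev_subst[OF is_hom_const] by (simp add: ev_var[OF is_hom_const] subst_var)
  then have g0: "g \<noteq> 0" using f(1) by auto
  have gv: "vars_in {1..Suc N} g" unfolding g_def by (rule vars_in_subst[OF f(2)]) (auto intro: vars_in_var)
  define D where "D = total_degree g"
  have gd: "deg_le D g" unfolding D_def by (rule deg_le_total_degree)
  obtain Y :: "(nat \<Rightarrow> 'k) set" where Y: "mult_le_deg (Suc N) Y (real (Suc N) / real (Suc N + Suc N * D))"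
    using ex_points_mult_le_deg[OF inf, of "Suc N" "Suc N * D"] by blast
  have "ord_ge 1 (shift y g)" for y
  proof (rule ord_ge_1I[OF vars_in_shift[OF gv]])
    have "ev (\<lambda>c. c) (\<lambda>_. 0) (shift y g) = ev (\<lambda>c. c) y g"
      unfolding shift_def ev_subst[OF is_hom_id]
      by (simp add: ev_add[OF is_hom_id] ev_var[OF is_hom_id] ev_const[OF is_hom_id])
    then show "ev (\<lambda>c. c) (\<lambda>_. 0) (shift y g) = 0" using n ev_g by simp
  qed
  then have "real 1 \<le> real (Suc N) / real (Suc N + Suc N * D) * real D"
    using Y g0 gv gd unfolding mult_le_deg_def by blast
  moreover have "real (Suc N) / real (Suc N + Suc N * D) * real D = real D / (1 + real D)"
  proof -
    have "real (Suc N + Suc N * D) = real (Suc N) * (1 + real D)" by (simp add: algebra_simps)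
    then show ?thesis by (simp del: of_nat_Suc)
  qed
  moreover have "real D / (1 + real D) < 1" by simp
  ultimately show False by simp
qed

lemma ex_nonzero_value_affine:
  fixes f :: "(nat, 'k::field) mpoly"
  assumes inf: "infinite (UNIV :: 'k set)" and f: "f \<noteq> 0" "vars_in {..N} f"
  shows "\<exists>v. ev (\<lambda>c. c) v f \<noteq> 0 \<and> v 0 \<noteq> 0"
proof -
  have "var 0 \<noteq> (0 :: (nat, 'k) mpoly)"
  proof
    assume "var 0 = (0 :: (nat, 'k) mpoly)"
    then have "Poly_Mapping.lookup (var 0 :: (nat, 'k) mpoly) (Poly_Mapping.single 0 1) = 0" by simp
    then show False by (simp add: var_def)
  qed
  then have "var 0 * f \<noteq> 0" using f(1) by simp
  moreover have "vars_in {..N} (var 0 * f)" by (intro vars_in_mult vars_in_var f(2)) simp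
  ultimately obtain v where "ev (\<lambda>c. c) v (var 0 * f) \<noteq> 0" using ex_nonzero_value[OF inf] by blast
  then show ?thesis by (auto simp: ev_mult[OF is_hom_id] ev_var[OF is_hom_id])
qed

text \<open>The line through a point of \<open>X\<close> and a point \<open>v\<close> at which \<open>f\<close> does not vanish is not contained in the zero
set of \<open>f\<close>.\<close>

lemma total_degree_ge_mult:
  fixes f :: "(nat, 'k::field) mpoly"
  assumes inf: "infinite (UNIV :: 'k set)" and P: "P \<in> X" "a \<in> P" and f: "f \<noteq> 0" "f \<in> symbolic_power N X m"
  shows "m \<le> total_degree f"
proof -
  have car: "f \<in> carrier (poly_ring N)" using P f by (intro symbolic_power_carrier) auto
  obtain v where v: "ev (\<lambda>c. c) v f \<noteq> 0" using ex_nonzero_value[OF inf f(1)] car by (auto simp: carrier_poly_ring)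
  define \<sigma> where "\<sigma> i = [:a i, v i - a i:]" for i
  have "card {0::'k} * m \<le> total_degree f * 1"
  proof (rule curve_bound[OF f(2) car, where \<sigma> = \<sigma>])
    show "\<exists>P\<in>X. \<exists>a\<in>P. \<exists>c. \<forall>i\<le>N. poly (\<sigma> i) b = c * a i" if "b \<in> {0}" for b
      using that P by (intro bexI[of _ P] bexI[of _ a] exI[of _ 1]) (auto simp: \<sigma>_def)
    show "degree (\<sigma> i) \<le> 1" for i by (simp add: \<sigma>_def)
    have "poly (ev (\<lambda>c. [:c:]) \<sigma> f) 1 \<noteq> 0" unfolding poly_ev using v by (simp add: \<sigma>_def)
    then show "ev (\<lambda>c. [:c:]) \<sigma> f \<noteq> 0" by auto
  qed simp
  then show ?thesis by simp
qed

text \<open>After clearing denominators, \<open>\<Sum>\<^sub>j \<lambda>\<^sub>j a\<^sub>j / (t - b\<^sub>j)\<close> parametrizes a curve of degree at most \<open>N\<close> that passes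
through the point \<open>a\<^sub>j\<close> at \<open>t = b\<^sub>j\<close>. As \<open>a\<^sub>0, \<dots>, a\<^sub>N\<close> span, the \<open>\<lambda>\<^sub>j\<close> can be chosen such that at \<open>t = 0\<close> the
curve passes through a given point \<open>v\<close> at which \<open>f\<close> does not vanish.\<close>

lemma total_degree_ge_spanning:
  fixes f :: "(nat, 'k::field) mpoly" and a :: "nat \<Rightarrow> nat \<Rightarrow> 'k"
  assumes inf: "infinite (UNIV :: 'k set)" and a: "\<And>j. j \<le> N \<Longrightarrow> \<exists>P\<in>X. a j \<in> P"
    and span: "\<And>i i'. i \<le> N \<Longrightarrow> i' \<le> N \<Longrightarrow> (\<Sum>j\<le>N. c i j * a j i') = (if i = i' then 1 else 0)"
    and f: "f \<noteq> 0" "f \<in> symbolic_power N X m"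
  shows "Suc N * m \<le> total_degree f * N"
proof -
  have "X \<noteq> {}" using a[of 0] by auto
  then have car: "f \<in> carrier (poly_ring N)" using f by (intro symbolic_power_carrier)
  obtain v where v: "ev (\<lambda>c. c) v f \<noteq> 0" using ex_nonzero_value[OF inf f(1)] car by (auto simp: carrier_poly_ring)
  have "infinite (UNIV - {0 :: 'k})" using inf by simp
  then obtain b :: "nat \<Rightarrow> 'k" where b: "inj b" "range b \<subseteq> UNIV - {0}" using infinite_countable_subset by blast
  have b0: "b j \<noteq> 0" for j using b(2) by auto
  \<comment> \<open>the coefficients of \<open>v\<close> in the basis \<open>a\<close>, corrected by the product that \<open>\<sigma>\<close> has at \<open>t = 0\<close>\<close>
  define lam where "lam j = (\<Sum>i\<le>N. v i * c i j) / (\<Prod>l\<in>{..N} - {j}. - b l)" for j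
  define \<sigma> where "\<sigma> i = (\<Sum>j\<le>N. smult (lam j * a j i) (\<Prod>l\<in>{..N} - {j}. [:- b l, 1:]))" for i
  have pol: "poly (\<sigma> i) t = (\<Sum>j\<le>N. lam j * a j i * (\<Prod>l\<in>{..N} - {j}. t - b l))" for i t
    by (simp add: \<sigma>_def poly_sum poly_prod)
  have at_0: "poly (\<sigma> i) 0 = v i" if i: "i \<le> N" for i
  proof -
    have "poly (\<sigma> i) 0 = (\<Sum>j\<le>N. (\<Sum>i'\<le>N. v i' * c i' j) * a j i)"
      unfolding pol
    proof (intro sum.cong refl)
      fix j
      have "(\<Prod>l\<in>{..N} - {j}. - b l) \<noteq> 0" using b0 by simp
      then show "lam j * a j i * (\<Prod>l\<in>{..N} - {j}. 0 - b l) = (\<Sum>i'\<le>N. v i' * c i' j) * a j i"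
        by (simp add: lam_def field_simps)
    qed
    also have "\<dots> = (\<Sum>i'\<le>N. v i' * (\<Sum>j\<le>N. c i' j * a j i))"
      unfolding sum_distrib_right by (subst sum.swap) (simp add: sum_distrib_left mult.assoc)
    also have "\<dots> = (\<Sum>i'\<le>N. if i' = i then v i else 0)"
      using span i by (intro sum.cong refl) auto
    finally show ?thesis using i by simp
  qed
  have at_b: "poly (\<sigma> i) (b j) = (lam j * (\<Prod>l\<in>{..N} - {j}. b j - b l)) * a j i" if j: "j \<le> N" for i j
  proof -
    have "poly (\<sigma> i) (b j) = (\<Sum>k\<le>N. if k = j then lam j * a j i * (\<Prod>l\<in>{..N} - {j}. b j - b l) else 0)"
      unfolding pol
    proof (intro sum.cong refl)
      fix k
      show "lam k * a k i * (\<Prod>l\<in>{..N} - {k}. b j - b l) = (if k = j then lam j * a j i * (\<Prod>l\<in>{..N} - {j}. b j - b l) else 0)"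
      proof (cases "k = j")
        case False
        then have "(\<Prod>l\<in>{..N} - {k}. b j - b l) = 0" using j by (intro prod_zero) (auto intro!: bexI[of _ j])
        then show ?thesis using False by simp
      qed simp
    qed
    then show ?thesis using j by (simp add: mult_ac)
  qed
  have "card (b ` {..N}) * m \<le> total_degree f * N"
  proof (rule curve_bound[OF f(2) car, where \<sigma> = \<sigma>])
    show "\<exists>P\<in>X. \<exists>a\<in>P. \<exists>c. \<forall>i\<le>N. poly (\<sigma> i) t = c * a i" if t: "t \<in> b ` {..N}" for t
    proof -
      obtain j where j: "j \<le> N" "t = b j" using t by auto
      obtain P where "P \<in> X" "a j \<in> P" using a[OF j(1)] by blast
      then show ?thesis using at_b[OF j(1)] unfolding j(2) by blast
    qed
    show "degree (\<sigma> i) \<le> N" for i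
      unfolding \<sigma>_def
    proof (rule degree_sum_le)
      fix j assume j: "j \<in> {..N}"
      have "degree (\<Prod>l\<in>{..N} - {j}. [:- b l, 1:]) \<le> (\<Sum>l\<in>{..N} - {j}. 1)"
        using degree_prod_sum_le[of "{..N} - {j}" "\<lambda>l. [:- b l, 1:]"] by (simp add: o_def)
      also have "\<dots> = N" using j by simp
      finally show "degree (smult (lam j * a j i) (\<Prod>l\<in>{..N} - {j}. [:- b l, 1:])) \<le> N"
        by (rule order_trans[OF degree_smult_le])
    qed simp
    have "poly (ev (\<lambda>c. [:c:]) \<sigma> f) 0 = ev (\<lambda>c. c) v f"
      unfolding poly_ev by (rule ev_cong) (use car at_0 in \<open>auto simp: carrier_poly_ring vars_in_def\<close>)
    then have "poly (ev (\<lambda>c. [:c:]) \<sigma> f) 0 \<noteq> 0" using v by simp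
    then show "ev (\<lambda>c. [:c:]) \<sigma> f \<noteq> 0" by auto
  qed simp
  moreover have "card (b ` {..N}) = Suc N" using b(1) by (simp add: card_image inj_on_def inj_def)
  ultimately show ?thesis by simp
qed

section \<open>From symbolic powers to affine polynomials\<close>

text \<open>Elements of a symbolic power need not be homogeneous. Instead of setting \<open>x\<^sub>0 = 1\<close>, which could give zero,
substitute \<open>x\<^sub>0 = v\<^sub>0\<close> and \<open>x\<^sub>i = v\<^sub>0 x\<^sub>i\<close>, where \<open>v\<close> is a point with \<open>v\<^sub>0 \<noteq> 0\<close> at which \<open>f\<close> is nonzero. The vector
\<open>v\<^sub>0 (1, y\<^sub>1, \<dots>, y\<^sub>N)\<close> represents the same projective point, so the order of vanishing at \<open>y\<close> is preserved.\<close>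

lemma degree_bound_symbolic_power:
  fixes f :: "(nat, 'k::field) mpoly" and y :: "nat \<times> nat \<Rightarrow> 'k"
  assumes inf: "infinite (UNIV :: 'k set)" and s: "s \<ge> 1"
    and inv: "jets_inverse N M b {..<s} (\<lambda>j i. y (j, i)) c"
    and f: "f \<noteq> 0" "f \<in> symbolic_power N ((\<lambda>j. proj_point (affine_coords N y j)) ` {..<s}) m"
  shows "b * m \<le> total_degree f * (M + N)"
proof -
  define X where "X = (\<lambda>j. proj_point (affine_coords N y j)) ` {..<s}"
  have "X \<noteq> {}" using s by (auto simp: X_def lessThan_empty_iff)
  then have car: "vars_in {..N} f" using f(2) symbolic_power_carrier unfolding X_def[symmetric] carrier_poly_ring[symmetric] by blast
  obtain v where v: "ev (\<lambda>c. c) v f \<noteq> 0" "v 0 \<noteq> 0" using ex_nonzero_value_affine[OF inf f(1) car] by blast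
  define \<tau> where "\<tau> i = (if i = 0 then const (v 0) else const (v 0) * var i)" for i :: nat
  define g where "g = subst \<tau> f"
  have g0: "g \<noteq> 0"
  proof
    assume "g = 0"
    have "ev (\<lambda>c. c) (\<lambda>i. v i / v 0) g = ev (\<lambda>c. c) v f"
      unfolding g_def ev_subst[OF is_hom_id] using v(2)
      by (intro ev_cong) (simp add: \<tau>_def ev_mult[OF is_hom_id] ev_var[OF is_hom_id] ev_const[OF is_hom_id])
    then show False using v(1) \<open>g = 0\<close> by simp
  qed
  have gv: "vars_in {1..N} g" unfolding g_def
    by (rule vars_in_subst[OF car]) (auto simp: \<tau>_def intro!: vars_in_mult vars_in_var)
  have gd: "deg_le (total_degree f) g" unfolding g_def
  proof (rule deg_le_subst[OF deg_le_total_degree])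
    fix i
    show "deg_le 1 (\<tau> i)" using deg_le_mult[OF deg_le_const[of 0 "v 0"] deg_le_var[of 1 i]] by (simp add: \<tau>_def)
  qed
  have go: "ord_ge m (shift (\<lambda>i. y (j, i)) g)" if j: "j \<in> {..<s}" for j
  proof -
    define \<rho> where "\<rho> i = (if i = 0 then const (v 0) else const (v 0) * (var i + const (y (j, i))))" for i :: nat
    have sh: "shift (\<lambda>i. y (j, i)) g = subst \<rho> f"
      unfolding shift_def g_def ev_subst[OF is_hom_const]
      by (rule ev_cong) (simp add: \<tau>_def \<rho>_def ev_mult[OF is_hom_const] ev_var[OF is_hom_const] ev_const[OF is_hom_const])
    have "ord_ge m (subst \<rho> f)"
    proof (rule ideal_power_filtration[where Fl = ord_ge and \<psi> = "subst \<rho>" and N = N and P = "proj_point (affine_coords N y j)"])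
      show "f \<in> ideal_power N (point_ideal N (proj_point (affine_coords N y j))) m"
        using f(2) j by (auto simp: symbolic_power_def)
      show "ord_ge 1 (subst \<rho> h)" if h: "h \<in> point_forms N (proj_point (affine_coords N y j))" for h
      proof (rule ord_ge_1I)
        obtain d where hom: "homogeneous d h" and hc: "vars_in {..N} h" and z: "eval_mpoly h (affine_coords N y j) = 0"
          using h self_in_proj_point[of "affine_coords N y j"] by (auto simp: point_forms_def carrier_poly_ring)
        show "vars_in {1..N} (subst \<rho> h)"
          by (rule vars_in_subst[OF hc]) (auto simp: \<rho>_def intro!: vars_in_mult vars_in_add vars_in_var)
        have "ev (\<lambda>c. c) (\<lambda>_. 0) (subst \<rho> h) = ev (\<lambda>c. c) (\<lambda>i. v 0 * affine_coords N y j i) h"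
          unfolding ev_subst[OF is_hom_id]
          by (rule ev_cong) (use hc in \<open>auto simp: \<rho>_def affine_coords_def vars_in_def ev_mult[OF is_hom_id]
              ev_add[OF is_hom_id] ev_var[OF is_hom_id] ev_const[OF is_hom_id]\<close>)
        also have "\<dots> = 0" using eval_homogeneous_scale[OF hom, of "v 0" "affine_coords N y j"] z by (simp add: eval_mpoly_ev)
        finally show "ev (\<lambda>c. c) (\<lambda>_. 0) (subst \<rho> h) = 0" .
      qed
    qed (simp_all add: ev_add[OF is_hom_const] ev_mult[OF is_hom_const] ord_ge_add ord_ge_mult)
    then show ?thesis by (simp only: sh)
  qed
  show ?thesis
    by (rule degree_bound_of_jets_inverse[OF _ _ inv g0 gv gd go]) (use s in \<open>auto simp: lessThan_empty_iff\<close>)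
qed

section \<open>Chudnovsky's bound\<close>

text \<open>At the configuration \<open>y0\<close> a polynomial of degree at most \<open>b - 1 < c M\<close> whose jets of order less than \<open>M\<close>
vanish must be zero, so the matrix of the jets is injective there and has a left inverse nearby.\<close>

lemma ex_open_jets_inverse:
  fixes y0 :: "nat \<Rightarrow> nat \<Rightarrow> 'k::field"
  assumes b: "b \<ge> 1" and mult: "mult_le_deg N (y0 ` {..<s}) (1 / c)" and c: "c > 0" "real (b - 1) < c * real M"
  shows "\<exists>\<Delta>. polyfun \<Delta> \<and> \<Delta> (restr N s (\<lambda>(j, i). y0 j i)) \<noteq> 0 \<and>
    (\<forall>y. \<Delta> y \<noteq> 0 \<longrightarrow> (\<exists>C. jets_inverse N M b {..<s} (\<lambda>j i. y (j, i)) C))"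
proof -
  define S where "S = {\<alpha> \<in> exps N M. size_exp N \<alpha> < M}"
  define Bm where "Bm = {\<mu> \<in> exps N b. size_exp N \<mu> < b}"
  define T where "T r \<mu> y = jet N (\<lambda>i. y (fst r, i)) \<mu> (snd r)" for r :: "nat \<times> (nat \<Rightarrow> nat)" and \<mu> and y :: "nat \<times> nat \<Rightarrow> 'k"
  define z where "z = restr N s (\<lambda>(j, i). y0 j i)"
  have zj: "(\<lambda>i. z (j, i)) i = y0 j i" if "j < s" "i \<in> {1..N}" for j i using that by (simp add: z_def restr_def)
  have "\<exists>\<Delta>. polyfun \<Delta> \<and> \<Delta> z \<noteq> 0 \<and> (\<forall>y. \<Delta> y \<noteq> 0 \<longrightarrow>
    (\<exists>C. \<forall>j\<in>Bm. \<forall>j'\<in>Bm. (\<Sum>r\<in>{..<s} \<times> S. C j r * T r j' y) = (if j = j' then 1 else 0)))"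
  proof (rule open_left_inverse)
    show "finite ({..<s} \<times> S)" "finite Bm" by (simp_all add: S_def Bm_def)
    show "polyfun (T r \<mu>)" for r \<mu> unfolding T_def jet_def
      by (intro polyfun_prod polyfun_mult polyfun_const polyfun_power polyfun_coord)
    fix v :: "(nat \<Rightarrow> nat) \<Rightarrow> 'k"
    assume v: "\<And>r. r \<in> {..<s} \<times> S \<Longrightarrow> (\<Sum>\<mu>\<in>Bm. T r \<mu> z * v \<mu>) = 0"
    define f where "f = (\<Sum>\<mu>\<in>Bm. Poly_Mapping.single (exps_monom N \<mu>) (v \<mu>))"
    have fin: "finite Bm" by (simp add: Bm_def)
    have lf: "Poly_Mapping.lookup f (exps_monom N \<mu>) = (if \<mu> \<in> Bm then v \<mu> else 0)" if "\<mu> \<in> exps N b" for \<mu>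
    proof -
      have "Poly_Mapping.lookup f (exps_monom N \<mu>) = (\<Sum>\<mu>'\<in>Bm. if \<mu>' = \<mu> then v \<mu> else 0)"
        unfolding f_def lookup_sum
        by (intro sum.cong refl) (use that inj_on_exps_monom[of N b] in \<open>auto simp: lookup_single when_def Bm_def inj_on_eq_iff\<close>)
      then show ?thesis using fin by simp
    qed
    have fv: "vars_in {1..N} f" unfolding f_def
      by (intro vars_in_sum) (use keys_exps_monom in \<open>auto simp: vars_in_def\<close>)
    have fd: "deg_le (b - 1) f" unfolding f_def
      by (intro deg_le_sum) (auto simp: deg_le_def monom_degree_exps_monom Bm_def)
    have fb: "deg_le b f" using fd by (rule deg_le_mono) simp
    have ord: "ord_ge M (shift (y0 j) f)" if j: "j < s" for j
      unfolding ord_ge_def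
    proof
      fix m assume m: "m \<in> Poly_Mapping.keys (shift (y0 j) f)"
      then have k: "Poly_Mapping.keys m \<subseteq> {1..N}" using vars_in_shift[OF fv] by (auto simp: vars_in_def)
      define \<alpha> where "\<alpha> = restrict (Poly_Mapping.lookup m) {1..N}"
      have pa: "exps_monom N \<alpha> = m" unfolding \<alpha>_def by (rule exps_monom_surj[OF k])
      show "M \<le> odeg m"
      proof (rule ccontr)
        assume "\<not> M \<le> odeg m"
        then have sz: "size_exp N \<alpha> < M" using odeg_exps_monom[of N \<alpha>] pa by simp
        have "\<alpha> i \<le> M" if i: "i \<in> {1..N}" for i
        proof -
          have "\<alpha> i \<le> size_exp N \<alpha>" unfolding size_exp_def using i by (intro member_le_sum) auto
          then show ?thesis using sz by simp
        qed
        then have "\<alpha> \<in> S" using sz by (auto simp: S_def exps_def \<alpha>_def)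
        then have "0 = (\<Sum>\<mu>\<in>Bm. T (j, \<alpha>) \<mu> z * v \<mu>)" using v[of "(j, \<alpha>)"] j by simp
        also have "\<dots> = (\<Sum>\<mu>\<in>exps N b. Poly_Mapping.lookup f (exps_monom N \<mu>) * jet N (y0 j) \<mu> \<alpha>)"
        proof (rule sum.mono_neutral_cong_left)
          fix \<mu> assume "\<mu> \<in> Bm"
          moreover have "T (j, \<alpha>) \<mu> z = jet N (y0 j) \<mu> \<alpha>"
            unfolding T_def jet_def using zj[OF j] by (intro prod.cong) auto
          ultimately show "T (j, \<alpha>) \<mu> z * v \<mu> = Poly_Mapping.lookup f (exps_monom N \<mu>) * jet N (y0 j) \<mu> \<alpha>"
            using lf by (simp add: Bm_def)
        qed (auto simp: Bm_def lf)
        also have "\<dots> = Poly_Mapping.lookup (shift (y0 j) f) m" using lookup_shift[OF fv fb, of "y0 j" \<alpha>] pa by simp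
        finally show False using m by (simp add: in_keys_iff)
      qed
    qed
    have "f = 0"
    proof (rule ccontr)
      assume "f \<noteq> 0"
      then have "real M \<le> 1 / c * real (b - 1)" using mult fv fd ord unfolding mult_le_deg_def by auto
      then show False using c by (simp add: field_simps)
    qed
    show "\<forall>\<mu>\<in>Bm. v \<mu> = 0"
    proof
      fix \<mu> assume "\<mu> \<in> Bm"
      then have "v \<mu> = Poly_Mapping.lookup f (exps_monom N \<mu>)" using lf[of \<mu>] by (simp add: Bm_def)
      then show "v \<mu> = 0" using \<open>f = 0\<close> by simp
    qed
  qed
  then obtain \<Delta> where D: "polyfun \<Delta>" "\<Delta> z \<noteq> 0" "\<forall>y. \<Delta> y \<noteq> 0 \<longrightarrow>
    (\<exists>C. \<forall>j\<in>Bm. \<forall>j'\<in>Bm. (\<Sum>r\<in>{..<s} \<times> S. C j r * T r j' y) = (if j = j' then 1 else 0))"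
    by (elim exE conjE)
  have "\<exists>C. jets_inverse N M b {..<s} (\<lambda>j i. y (j, i)) C" if ne: "\<Delta> y \<noteq> 0" for y
  proof -
    obtain C where C: "\<forall>j\<in>Bm. \<forall>j'\<in>Bm. (\<Sum>r\<in>{..<s} \<times> S. C j r * T r j' y) = (if j = j' then 1 else 0)"
      using D(3)[rule_format, OF ne] by (elim exE)
    have "jets_inverse N M b {..<s} (\<lambda>j i. y (j, i)) (\<lambda>\<mu> j \<alpha>. C \<mu> (j, \<alpha>))"
      unfolding jets_inverse_def Bm_def[symmetric] S_def[symmetric]
      using C by (simp add: sum.cartesian_product T_def case_prod_beta)
    then show ?thesis by blast
  qed
  then show ?thesis using D(1,2) unfolding z_def by blast
qed

text \<open>Fewer than \<open>C(N + x + 1, N)\<close> points have \<open>\<alpha>(I) \<le> x + 1\<close>, so the right-hand side of Chudnovsky's inequality is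
at most \<open>(N + x) / N\<close>.\<close>

lemma chudnovsky_of_degree_bound:
  fixes y :: "nat \<times> nat \<Rightarrow> 'k::field"
  assumes N: "N \<ge> 1" and s: "s < (N + Suc x) choose N" and X: "X = (\<lambda>j. proj_point (affine_coords N y j)) ` {..<s}"
    and bd: "\<And>m f. f \<noteq> 0 \<Longrightarrow> f \<in> symbolic_power N X m \<Longrightarrow> (N + x) * m \<le> total_degree f * N"
  shows "waldschmidt_constant N X \<ge> (real (initial_degree (defining_ideal N X)) + real N - 1) / real N"
proof -
  have "card X \<le> s" unfolding X using card_image_le[of "{..<s}"] by simp
  then obtain h where h: "h \<in> defining_ideal N X" "h \<noteq> 0" "total_degree h \<le> Suc x"
    using ex_form_through_points[of X N "Suc x"] s affine_coords_in_proj_space unfolding X by fastforce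
  have "initial_degree (defining_ideal N X) \<le> Suc x" using initial_degree_le[OF h(1,2)] h(3) by simp
  then have "(real (initial_degree (defining_ideal N X)) + real N - 1) / real N \<le> real (N + x) / real N"
    using N by (intro divide_right_mono) auto
  also have "\<dots> \<le> waldschmidt_constant N X"
  proof (rule waldschmidt_constant_ge[OF h(2,1)])
    fix m f assume "f \<noteq> 0" "f \<in> symbolic_power N X m"
    then have "real ((N + x) * m) \<le> real (total_degree f * N)" using bd by (intro of_nat_mono)
    then show "real (N + x) / real N * real m \<le> real (total_degree f)" using N by (simp add: field_simps)
  qed
  finally show ?thesis .
qed

lemma infinite_alg_closed: "infinite (UNIV :: 'k::alg_closed_field set)"
proof
  assume fin: "finite (UNIV :: 'k set)"
  define p where "p = (\<Prod>a\<in>(UNIV :: 'k set). [:- a, 1:]) + 1"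
  have "degree (\<Prod>a\<in>(UNIV :: 'k set). [:- a, 1:]) = card (UNIV :: 'k set)"
    by (subst degree_prod_eq_sum_degree) auto
  moreover have "card (UNIV :: 'k set) > 0" using fin by (simp add: card_gt_0_iff)
  ultimately have "degree p > 0" unfolding p_def by (subst degree_add_eq_left) auto
  then obtain x where "poly p x = 0" using alg_closed_imp_poly_has_root by blast
  moreover have "poly (\<Prod>a\<in>(UNIV :: 'k set). [:- a, 1:]) x = 0"
    unfolding poly_prod using fin by (intro prod_zero) (auto intro!: bexI[of _ x])
  ultimately show False by (simp add: p_def)
qed

theorem theorem5p4:
  fixes N s :: nat
  assumes "N \<ge> 4" and "s \<ge> 1"
  shows "holds_for_general_points N s
           (\<lambda>X :: (nat \<Rightarrow> 'k::alg_closed_field) set set.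
              waldschmidt_constant N X
                \<ge> (real (initial_degree (defining_ideal N X)) + real N - 1) / real N)"
proof -
  let ?Q = "\<lambda>X :: (nat \<Rightarrow> 'k) set set. waldschmidt_constant N X
                \<ge> (real (initial_degree (defining_ideal N X)) + real N - 1) / real N"
  have inf: "infinite (UNIV :: 'k set)" by (rule infinite_alg_closed)
  have N1: "N \<ge> 1" using assms(1) by simp
  have "\<exists>x. (N + x) choose N \<le> s \<and> s < (N + Suc x) choose N"
  proof -
    have big: "x \<le> (N + x) choose N" for x
    proof (induction x)
      case (Suc x)
      obtain n where n: "N = Suc n" using N1 by (cases N) auto
      have "(N + Suc x) choose N = (N + x choose n) + (N + x choose N)" by (simp add: n)
      moreover have "N + x choose n > 0" by (rule zero_less_binomial) (simp add: n)
      ultimately show ?case using Suc by linarith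
    qed simp
    define P where "P x \<longleftrightarrow> s < (N + x) choose N" for x
    have "P (Suc s)" using big[of "Suc s"] by (simp add: P_def)
    then have L: "P (LEAST x. P x)" by (rule LeastI)
    have "\<not> P 0" using assms(2) by (simp add: P_def)
    then obtain x where x: "(LEAST x. P x) = Suc x" using L by (cases "LEAST x. P x") auto
    then have "\<not> P x" using not_less_Least[of x P] by simp
    then show ?thesis using L x by (auto simp: P_def not_less)
  qed
  then obtain x where x: "(N + x) choose N \<le> s" "s < (N + Suc x) choose N" by blast
  consider "x = 0" | "x = 1" | "x \<ge> 2" by linarith
  then show ?thesis
  proof cases
    case 1
    show ?thesis
    proof (rule general_points[OF inf polyfun_const[of 1]])
      fix y :: "nat \<times> nat \<Rightarrow> 'k"
      show "?Q ((\<lambda>j. proj_point (affine_coords N y j)) ` {..<s})"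
      proof (rule chudnovsky_of_degree_bound[OF N1 x(2) refl])
        fix m f assume f: "f \<noteq> 0" "f \<in> symbolic_power N ((\<lambda>j. proj_point (affine_coords N y j)) ` {..<s}) m"
        have "proj_point (affine_coords N y 0) \<in> (\<lambda>j. proj_point (affine_coords N y j)) ` {..<s}"
          using assms(2) by (intro imageI) simp
        from total_degree_ge_mult[OF inf this self_in_proj_point f]
        show "(N + x) * m \<le> total_degree f * N" using 1 by (simp add: mult.commute)
      qed
    qed simp
  next
    case 2
    have Ns: "N < s" using x(1) 2 by simp
    define T where "T j i y = affine_coords N y j i" for j i and y :: "nat \<times> nat \<Rightarrow> 'k"
    \<comment> \<open>the origin and the unit points of affine space, which span\<close>
    define y0 :: "nat \<times> nat \<Rightarrow> 'k" where "y0 = (\<lambda>(j, i). if j = i then 1 else 0)"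
    have "\<exists>\<Delta>. polyfun \<Delta> \<and> \<Delta> (restr N s y0) \<noteq> 0 \<and> (\<forall>y. \<Delta> y \<noteq> 0 \<longrightarrow>
      (\<exists>c. \<forall>i\<in>{..N}. \<forall>i'\<in>{..N}. (\<Sum>j\<in>{..N}. c i j * T j i' y) = (if i = i' then 1 else 0)))"
    proof (rule open_left_inverse)
      show "polyfun (T j i)" for j i
        unfolding T_def affine_coords_def
        by (cases "i = 0"; cases "i \<le> N") (simp_all add: polyfun_const polyfun_coord)
      fix v :: "nat \<Rightarrow> 'k" assume v: "\<And>j. j \<in> {..N} \<Longrightarrow> (\<Sum>i\<in>{..N}. T j i (restr N s y0) * v i) = 0"
      have T0: "T j i (restr N s y0) = (if i = 0 \<or> i = j then 1 else 0)" if "j \<le> N" "i \<le> N" for i j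
        using that Ns by (auto simp: T_def affine_coords_def restr_def y0_def)
      have v0: "v 0 = 0"
      proof -
        have "(\<Sum>i\<in>{..N}. T 0 i (restr N s y0) * v i) = (\<Sum>i\<in>{..N}. if i = 0 then v 0 else 0)"
          by (intro sum.cong refl) (auto simp: T0)
        then show ?thesis using v[of 0] by simp
      qed
      have "v j = 0" if j: "j \<le> N" for j
      proof -
        have "(\<Sum>i\<in>{..N}. T j i (restr N s y0) * v i) = (\<Sum>i\<in>{..N}. if i = j then v j else 0)"
          using j v0 by (intro sum.cong refl) (auto simp: T0)
        then show ?thesis using v[of j] j by simp
      qed
      then show "\<forall>j\<in>{..N}. v j = 0" by simp
    qed simp_all
    then obtain \<Delta> where D: "polyfun \<Delta>" "\<Delta> (restr N s y0) \<noteq> 0" "\<forall>y. \<Delta> y \<noteq> 0 \<longrightarrow>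
      (\<exists>c. \<forall>i\<in>{..N}. \<forall>i'\<in>{..N}. (\<Sum>j\<in>{..N}. c i j * T j i' y) = (if i = i' then 1 else 0))"
      by (elim exE conjE)
    show ?thesis
    proof (rule general_points[OF inf D(1,2)])
      fix y :: "nat \<times> nat \<Rightarrow> 'k" assume "\<Delta> (restr N s y) \<noteq> 0"
      then obtain c where c: "\<forall>i\<in>{..N}. \<forall>i'\<in>{..N}. (\<Sum>j\<in>{..N}. c i j * T j i' (restr N s y)) = (if i = i' then 1 else 0)"
        using D(3) by blast
      have TT: "T j i (restr N s y) = affine_coords N y j i" if "j \<le> N" for j i
        using that Ns by (auto simp: T_def affine_coords_def restr_def)
      show "?Q ((\<lambda>j. proj_point (affine_coords N y j)) ` {..<s})"
      proof (rule chudnovsky_of_degree_bound[OF N1 x(2) refl])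
        fix m f assume f: "f \<noteq> 0" "f \<in> symbolic_power N ((\<lambda>j. proj_point (affine_coords N y j)) ` {..<s}) m"
        have "Suc N * m \<le> total_degree f * N"
        proof (rule total_degree_ge_spanning[OF inf _ _ f])
          show "\<exists>P\<in>(\<lambda>j. proj_point (affine_coords N y j)) ` {..<s}. affine_coords N y j \<in> P" if "j \<le> N" for j
            using that Ns self_in_proj_point by (intro bexI[of _ "proj_point (affine_coords N y j)"]) auto
          show "(\<Sum>j\<le>N. c i j * affine_coords N y j i') = (if i = i' then 1 else 0)" if "i \<le> N" "i' \<le> N" for i i'
          proof -
            have "(\<Sum>j\<le>N. c i j * affine_coords N y j i') = (\<Sum>j\<le>N. c i j * T j i' (restr N s y))"
              by (intro sum.cong refl) (simp add: TT)
            then show ?thesis using c that by simp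
          qed
        qed
        then show "(N + x) * m \<le> total_degree f * N" using 2 by simp
      qed
    qed
  next
    case 3
    obtain n where n: "N = Suc n" "n \<ge> 1" using assms(1) by (cases N) auto
    obtain Y :: "(nat \<Rightarrow> 'k) set" and c where Y: "finite Y" "Y \<noteq> {}" "card Y \<le> (N + x) choose N"
      "c > real (N + x) / real N" "mult_le_deg N Y (1 / c)"
      using ex_points_mult_less_deg[OF inf n(2) 3] unfolding n(1) by (elim exE conjE)
    have c0: "c > 0" using Y(4) by (rule le_less_trans[rotated]) simp
    \<comment> \<open>the special configuration may have fewer than \<open>s\<close> points; some of them are then repeated\<close>
    obtain e where e: "e ` {..<s} = Y"
    proof -
      have "card Y \<le> card {..<s}" using Y(3) x(1) by simp
      then obtain h where h: "h ` Y \<subseteq> {..<s}" "inj_on h Y" using card_le_inj[OF Y(1), of "{..<s}"] by auto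
      obtain y1 where y1: "y1 \<in> Y" using Y(2) by blast
      have "(\<lambda>j. if j \<in> h ` Y then inv_into Y h j else y1) ` {..<s} = Y"
      proof
        show "(\<lambda>j. if j \<in> h ` Y then inv_into Y h j else y1) ` {..<s} \<subseteq> Y"
          using y1 by (auto intro: inv_into_into)
        show "Y \<subseteq> (\<lambda>j. if j \<in> h ` Y then inv_into Y h j else y1) ` {..<s}"
        proof
          fix y assume y: "y \<in> Y"
          then have "y = (if h y \<in> h ` Y then inv_into Y h (h y) else y1)" using h(2) by simp
          moreover have "h y \<in> {..<s}" using h(1) y by blast
          ultimately show "y \<in> (\<lambda>j. if j \<in> h ` Y then inv_into Y h j else y1) ` {..<s}" by (rule image_eqI)
        qed
      qed
      then show thesis by (rule that)
    qed
    define \<delta> where "\<delta> = c - real (N + x) / real N"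
    have d0: "\<delta> > 0" using Y(4) by (simp add: \<delta>_def)
    \<comment> \<open>\<open>M\<close> is so large that the slack \<open>\<delta>\<close> in \<open>c\<close> absorbs the \<open>N\<close> in \<open>M + N\<close>\<close>
    obtain M :: nat where M: "real (N + x) / \<delta> < real M" using reals_Archimedean2 by blast
    have "0 \<le> real (N + x) / \<delta>" using d0 by simp
    then have Mpos: "real M > 0" using M by linarith
    define b where "b = nat \<lceil>c * real M\<rceil>"
    have bge: "c * real M \<le> real b" by (simp add: b_def real_nat_ceiling_ge)
    have b1: "b \<ge> 1" using bge c0 Mpos by (cases b) (auto simp: mult_le_0_iff)
    have blt: "real (b - 1) < c * real M"
    proof -
      have "real b < c * real M + 1" unfolding b_def using c0 Mpos by (simp add: ceiling_less_iff) linarith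
      then show ?thesis using b1 by (simp add: of_nat_diff)
    qed
    \<comment> \<open>that is, \<open>b / (M + N) \<ge> (N + x) / N\<close>\<close>
    have key: "real (N + x) * real (M + N) \<le> real b * real N"
    proof -
      have "real (N + x) \<le> \<delta> * real M" using M d0 by (simp add: field_simps)
      then have "real (N + x) / real N * real N + real (N + x) / real N * real M \<le> c * real M"
        using N1 by (simp add: \<delta>_def left_diff_distrib)
      then have "real (N + x) / real N * (real M + real N) \<le> real b"
        using bge by (simp only: distrib_left)
      then have "real (N + x) / real N * (real M + real N) * real N \<le> real b * real N" by (rule mult_right_mono) simp
      then show ?thesis using N1 by simp
    qed
    obtain \<Delta> where D: "polyfun \<Delta>" "\<Delta> (restr N s (\<lambda>(j, i). e j i)) \<noteq> 0"
      "\<forall>y. \<Delta> y \<noteq> 0 \<longrightarrow> (\<exists>C. jets_inverse N M b {..<s} (\<lambda>j i. y (j, i)) C)"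
      using ex_open_jets_inverse[OF b1 Y(5)[folded e] c0 blt] by (elim exE conjE)
    show ?thesis
    proof (rule general_points[OF inf D(1,2)])
      fix y :: "nat \<times> nat \<Rightarrow> 'k" assume "\<Delta> (restr N s y) \<noteq> 0"
      then obtain C where C: "jets_inverse N M b {..<s} (\<lambda>j i. restr N s y (j, i)) C" using D(3) by blast
      have ac: "affine_coords N (restr N s y) j = affine_coords N y j" if "j < s" for j
        using that by (auto simp: affine_coords_def restr_def)
      have im: "(\<lambda>j. proj_point (affine_coords N (restr N s y) j)) ` {..<s} = (\<lambda>j. proj_point (affine_coords N y j)) ` {..<s}"
        by (intro image_cong refl) (simp add: ac)
      show "?Q ((\<lambda>j. proj_point (affine_coords N y j)) ` {..<s})"
      proof (rule chudnovsky_of_degree_bound[OF N1 x(2) refl])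
        fix m f assume f: "f \<noteq> 0" "f \<in> symbolic_power N ((\<lambda>j. proj_point (affine_coords N y j)) ` {..<s}) m"
        have "b * m \<le> total_degree f * (M + N)"
          by (rule degree_bound_symbolic_power[OF inf assms(2) C f(1)]) (use f(2) im in simp)
        then have "real (b * m) \<le> real (total_degree f * (M + N))" by (rule of_nat_mono)
        then have "real b * real m * real N \<le> real (total_degree f) * real (M + N) * real N"
          by (intro mult_right_mono) simp_all
        moreover have "real (N + x) * real (M + N) * real m \<le> real b * real N * real m"
          using key by (rule mult_right_mono) simp
        ultimately have "real (M + N) * (real (N + x) * real m) \<le> real (M + N) * (real (total_degree f) * real N)"
          by (simp only: mult_ac)
        then have "real (N + x) * real m \<le> real (total_degree f) * real N"
          using N1 by (subst (asm) mult_le_cancel_left_pos) auto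
        then show "(N + x) * m \<le> total_degree f * N" by (simp only: of_nat_mult[symmetric] of_nat_le_iff)
      qed
    qed
  qed
qed

end
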